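(* Let $0<p<1$, $0<q<\infty$, $1\le r<\infty$ and $\beta\in\mathbb{R}$. Then $$\int_0^\infty\int_{\mathbb{R}^d}|f(s,y)|\cdot|g(s,y)|\,\frac{\mathrm{d}y\,\mathrm{d}s}{s}\lesssim\|f\|_{\mathrm Z^{\infty,\infty,r'}_{-\beta+d(\frac1p-1)}}\|g\|_{\mathrm T^{p,q,r}_\beta}$$ for all measurable functions $f,g$ on $\mathbb{R}^{d+1}_+$, with an implicit constant independent of $f,g$. Moreover, one can identify $(\mathrm T^{p,q,r}_\beta)'\simeq\mathrm Z^{\infty,\infty,r'}_{-\beta+d(\frac1p-1)}$ with equivalent norms via the $L^2$-duality pairing.
   Context: The symbol ⨍ denotes the mean-value integral and $B(x,t)$ the open ball in $\mathbb{R}^d$; $\mathbb{R}^{d+1}_+=(0,\infty)\times\mathbb{R}^d$. Conjugate exponent: $\frac1r+\frac1{r'}=1$ for $r\in(1,\infty)$, and $r'=\infty$ for $r=1$. $X'$ denotes the anti-dual space (bounded conjugate-linear functionals) of a (quasi-)Banach space $X$. The identification via the $L^2$-duality pairing means that $f$ corresponds to the functional $g\mapsto\int_0^\infty\int_{\mathbb{R}^d}f(s,y)\overline{g(s,y)}\,\frac{\mathrm{d}y\,\mathrm{d}s}{s}$. For $0<r\le\infty$, $\beta\in\mathbb{R}$ and measurable $f$ on $\mathbb{R}^{d+1}_+$ write $W_{r,\beta}f(t,x)=\big(⨍_{t/2}^t⨍_{B(x,t)}|s^{-\beta}f(s,y)|^r\,\mathrm{d}y\,\mathrm{d}s\big)^{1/r}$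 (essential supremum of $|s^{-\beta}f(s,y)|$ over $(\frac t2,t]\times B(x,t)$ if $r=\infty$). For $0<p,q,r<\infty$, $\mathrm T^{p,q,r}_\beta$ is the set of measurable $f$ with $$\|f\|_{\mathrm T^{p,q,r}_\beta}=\Big\|\Big(\int_0^\infty(W_{r,\beta}f(t,\cdot))^q\frac{\mathrm{d}t}{t}\Big)^{1/q}\Big\|_{L^p(\mathbb{R}^d)}<\infty.$$ For $0<r\le\infty$, $\mathrm Z^{\infty,\infty,r}_\beta$ is the set of measurable $f$ with $$\|f\|_{\mathrm Z^{\infty,\infty,r}_\beta}=\operatorname*{ess\,sup}_{t>0}\|W_{r,\beta}f(t,\cdot)\|_{L^\infty(\mathbb{R}^d)}<\infty.$$ *)

theory Defs
  imports "HOL-Analysis.Analysis" "HOL-Probability.Essential_Supremum"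
begin

text \<open>
  The space \<open>\<real>\<^sup>d\<close> is an arbitrary \<open>'a::euclidean_space\<close> with \<open>d = DIM('a)\<close>. A function on
  \<open>(0,\<infinity>) \<times> \<real>\<^sup>d\<close> is a total function on \<open>real \<times> 'a\<close>; no definition below depends on its values outside
  the half-space. Measurable means Lebesgue measurable, and functions are not quotiented by almost
  everywhere equality.
\<close>

definition half_space :: "(real \<times> 'a::euclidean_space) set" where
  "half_space = {0<..} \<times> UNIV"

abbreviation measurable_hs :: "(real \<times> 'a::euclidean_space \<Rightarrow> complex) \<Rightarrow> bool" where
  "measurable_hs f \<equiv> f \<in> borel_measurable (lebesgue_on half_space)"

text \<open>Power of an extended nonnegative number, used for positive exponents \<open>a\<close> only.\<close>

definition epow :: "ennreal \<Rightarrow> real \<Rightarrow> ennreal" where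
  "epow x a = (if x = \<infinity> then \<infinity> else ennreal (enn2real x powr a))"

definition mean_value :: "'b::euclidean_space set \<Rightarrow> ('b \<Rightarrow> ennreal) \<Rightarrow> ennreal" where
  "mean_value A h = (\<integral>\<^sup>+x\<in>A. h x \<partial>lebesgue) / emeasure lebesgue A"

definition conj_exponent :: "real \<Rightarrow> ennreal" where
  "conj_exponent r = (if r = 1 then \<infinity> else ennreal (r / (r - 1)))"

lemma conj_exponent_sum:
  assumes "1 < r"
  shows "1 / r + 1 / enn2real (conj_exponent r) = 1"
  using assms by (simp add: conj_exponent_def field_simps)

definition W_avg ::
    "ennreal \<Rightarrow> real \<Rightarrow> (real \<times> 'a::euclidean_space \<Rightarrow> complex) \<Rightarrow> real \<Rightarrow> 'a \<Rightarrow> ennreal" where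
  "W_avg r \<beta> f t x =
    (if r = \<infinity>
     then esssup (lebesgue_on ({t/2<..t} \<times> ball x t))
            (\<lambda>(s, y). ennreal (cmod (complex_of_real (s powr (-\<beta>)) * f (s, y))))
     else epow (mean_value {t/2<..t} (\<lambda>s. mean_value (ball x t)
            (\<lambda>y. ennreal (cmod (complex_of_real (s powr (-\<beta>)) * f (s, y)) powr enn2real r))))
            (1 / enn2real r))"

definition T_norm ::
    "real \<Rightarrow> real \<Rightarrow> real \<Rightarrow> real \<Rightarrow> (real \<times> 'a::euclidean_space \<Rightarrow> complex) \<Rightarrow> ennreal" where
  "T_norm p q r \<beta> f =
    epow (\<integral>\<^sup>+x. epow (epow (\<integral>\<^sup>+t\<in>{0<..}. (epow (W_avg (ennreal r) \<beta> f t x) q / ennreal t) \<partial>lebesgue)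
            (1 / q)) p \<partial>lebesgue) (1 / p)"

definition T_space ::
    "real \<Rightarrow> real \<Rightarrow> real \<Rightarrow> real \<Rightarrow> (real \<times> 'a::euclidean_space \<Rightarrow> complex) set" where
  "T_space p q r \<beta> = {f. measurable_hs f \<and> T_norm p q r \<beta> f < \<infinity>}"

text \<open>\<open>Z_norm\<close> and \<open>Z_space\<close> have first two exponents \<open>\<infinity>\<close>; the third is \<open>r\<close>, with \<open>0 < r \<le> \<infinity>\<close>.\<close>

definition Z_norm ::
    "ennreal \<Rightarrow> real \<Rightarrow> (real \<times> 'a::euclidean_space \<Rightarrow> complex) \<Rightarrow> ennreal" where
  "Z_norm r \<beta> f =
    esssup (lebesgue_on {0<..}) (\<lambda>t. esssup lebesgue (\<lambda>x. W_avg r \<beta> f t x))"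

definition Z_space :: "ennreal \<Rightarrow> real \<Rightarrow> (real \<times> 'a::euclidean_space \<Rightarrow> complex) set" where
  "Z_space r \<beta> = {f. measurable_hs f \<and> Z_norm r \<beta> f < \<infinity>}"

text \<open>
  Bounded conjugate-linear functionals on a space \<open>X\<close> of functions with (quasi-)norm \<open>N\<close>.
  Being \<open>extensional\<close>, they are equal iff they agree on \<open>X\<close>. If \<open>N\<close> vanishes on the
  functions that are zero almost everywhere, boundedness makes them constant on classes of almost
  everywhere equal functions, so they are the functionals on the corresponding quotient space.
\<close>

definition antidual ::
    "('b \<Rightarrow> complex) set \<Rightarrow> (('b \<Rightarrow> complex) \<Rightarrow> ennreal) \<Rightarrow> (('b \<Rightarrow> complex) \<Rightarrow> complex) set" where
  "antidual X N = {\<Phi> \<in> extensional X.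
     (\<forall>g\<in>X. \<forall>h\<in>X. \<Phi> (\<lambda>z. g z + h z) = \<Phi> g + \<Phi> h) \<and>
     (\<forall>c. \<forall>g\<in>X. \<Phi> (\<lambda>z. c * g z) = cnj c * \<Phi> g) \<and>
     (\<exists>C::real. \<forall>g\<in>X. ennreal (cmod (\<Phi> g)) \<le> ennreal C * N g)}"

definition antidual_norm ::
    "('b \<Rightarrow> complex) set \<Rightarrow> (('b \<Rightarrow> complex) \<Rightarrow> ennreal) \<Rightarrow> (('b \<Rightarrow> complex) \<Rightarrow> complex) \<Rightarrow> ennreal" where
  "antidual_norm X N \<Phi> = (SUP g\<in>{g\<in>X. N g \<le> 1}. ennreal (cmod (\<Phi> g)))"

definition L2_pairing ::
    "(real \<times> 'a::euclidean_space \<Rightarrow> complex) \<Rightarrow> (real \<times> 'a \<Rightarrow> complex) \<Rightarrow> complex" where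
  "L2_pairing f g =
    (LINT s:{0<..}|lebesgue. (LINT y|lebesgue. f (s, y) * cnj (g (s, y))) / complex_of_real s)"

definition pairing_functional ::
    "(real \<times> 'a::euclidean_space \<Rightarrow> complex) set \<Rightarrow> (real \<times> 'a \<Rightarrow> complex)
      \<Rightarrow> (real \<times> 'a \<Rightarrow> complex) \<Rightarrow> complex" where
  "pairing_functional X f = (\<lambda>g\<in>X. L2_pairing f g)"

text \<open>
  The map sending \<open>f\<close> to the functional \<open>g \<mapsto> \<langle>f, g\<rangle>\<close> identifies the space \<open>Y\<close> (with norm \<open>M\<close>)
  with the anti-dual of \<open>X\<close> (with quasi-norm \<open>N\<close>): it is a linear map onto the anti-dual, injective
  modulo almost everywhere equality, and its norms are equivalent.
\<close>

definition identifies_antidual ::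
    "(real \<times> 'a::euclidean_space \<Rightarrow> complex) set \<Rightarrow> ((real \<times> 'a \<Rightarrow> complex) \<Rightarrow> ennreal)
      \<Rightarrow> (real \<times> 'a \<Rightarrow> complex) set \<Rightarrow> ((real \<times> 'a \<Rightarrow> complex) \<Rightarrow> ennreal) \<Rightarrow> bool" where
  "identifies_antidual X N Y M \<longleftrightarrow>
    pairing_functional X ` Y = antidual X N \<and>
    (\<forall>f1\<in>Y. \<forall>f2\<in>Y. pairing_functional X f1 = pairing_functional X f2 \<longleftrightarrow>
       (AE z in lebesgue_on half_space. f1 z = f2 z)) \<and>
    (\<forall>f1\<in>Y. \<forall>f2\<in>Y. \<forall>a b. (\<lambda>z. a * f1 z + b * f2 z) \<in> Y \<and>
       (\<forall>g\<in>X. pairing_functional X (\<lambda>z. a * f1 z + b * f2 z) g =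
          a * pairing_functional X f1 g + b * pairing_functional X f2 g)) \<and>
    (\<exists>c C::real. 0 < c \<and> 0 < C \<and> (\<forall>f\<in>Y.
       ennreal c * M f \<le> antidual_norm X N (pairing_functional X f) \<and>
       antidual_norm X N (pairing_functional X f) \<le> ennreal C * M f))"

end

theory Submission
  imports Defs
begin

text \<open>
  Write \<open>d\<close> for the dimension and \<open>\<alpha> = d (1/p - 1)\<close>. Averaging over small Whitney boxes \<open>R(t, x)\<close> and Hoelder's
  inequality on each of them bound the pairing by \<open>\<parallel>f\<parallel>\<^sub>Z\<close> times the integral of
  \<open>t powr (\<alpha> - 1) * a(t, x)\<close>, where \<open>a(t, x)\<close> is the \<open>r\<close>-average of the weighted \<open>g\<close> over \<open>R(t, x)\<close>.
  If \<open>F\<close> is the inner functional of the tent space and \<open>N = \<parallel>F\<parallel>\<^sub>p\<close>, then \<open>a(t, x)\<close> is at most a constant times both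
  \<open>F(x)\<close> and \<open>N t powr (-d/p)\<close>; splitting the integral in \<open>t\<close> where the two bounds agree gives
  \<open>N powr (1-p) * F(x) powr p\<close>, whose integral over \<open>x\<close> is \<open>N\<close>.

  Conversely, testing a bounded functional with functions supported in one Whitney box is the usual
  duality between \<open>L\<^sup>r\<close> and its dual on that box, with exactly the powers of \<open>t\<close> that occur in the \<open>Z\<close>-norm. The density is
  obtained locally from the Radon-Nikodym theorem, and the functional is determined by its values on bounded
  functions of bounded support, because truncations converge in the quasi-norm by dominated convergence.
\<close>

section \<open>Powers of extended nonnegative numbers\<close>

text \<open>The exponent \<alpha> is dictated by scaling. A mean over a box of size t is controlled
  by the inner functional at every point of a ball of radius comparable to t, whose volume is of
  order \<open>t powr d\<close>; hence the bound by \<open>t powr (-d/p)\<close>. Multiplied by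
  \<open>t powr (\<alpha> - 1)\<close> it becomes \<open>t powr (-d-1)\<close>, integrable at
  infinity, while \<open>t powr (\<alpha> - 1)\<close> itself is integrable at 0 because
  \<open>p < 1\<close>. Three obstacles shape the rest. The functions are only Lebesgue measurable
  and enter through iterated integrals, so Borel representatives are chosen to have joint
  measurability. In the converse direction the quantity to be bounded also occurs, to a smaller
  power, on the other side; a cutoff makes it finite before that power is cancelled. Finally, a
  functional gives only a finitely additive set function; its bound by the power \<open>1/r\<close>
  of the measure makes it countably additive and absolutely continuous, and the density so found, at
  first merely measurable, is placed in the \<open>Z\<close> space by the converse estimate.\<close>

lemma epow_top [simp]: "epow top a = top"
  by (simp add: epow_def)

lemma epow_ennreal: "0 \<le> c \<Longrightarrow> epow (ennreal c) a = ennreal (c powr a)"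
  by (simp add: epow_def)

lemma epow_0 [simp]: "epow 0 a = 0"
  by (simp add: epow_def)

lemma epow_1 [simp]: "epow x 1 = x"
  by (cases x) (auto simp: epow_def)

lemma one_epow [simp]: "epow 1 a = 1"
  by (simp add: epow_def)

lemma epow_mono: "x \<le> y \<Longrightarrow> 0 \<le> a \<Longrightarrow> epow x a \<le> epow y a"
  by (cases x; cases y) (auto simp: epow_def powr_mono2 top_unique)

lemma epow_epow: "epow (epow x a) b = epow x (a * b)"
  by (cases x) (auto simp: epow_def powr_powr)

lemma epow_mult: "0 < a \<Longrightarrow> epow (x * y) a = epow x a * epow y a"
proof -
  assume a: "0 < a"
  have *: "epow (x * top) a = epow x a * top" if "x \<noteq> 0" for x
    using that a by (cases x) (auto simp: epow_def ennreal_mult_top)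
  show ?thesis
  proof (cases "x = 0 \<or> y = 0 \<or> x = top \<or> y = top")
    case True
    then show ?thesis
      using *[of x] *[of y] mult.commute[of top y] mult.commute[of top "epow y a"]
      by (cases "x = 0"; cases "y = 0") auto
  next
    case False
    then obtain b c where "x = ennreal b" "y = ennreal c" "0 \<le> b" "0 \<le> c"
      by (cases x; cases y) auto
    then show ?thesis
      by (simp add: epow_ennreal powr_mult flip: ennreal_mult)
  qed
qed

lemma epow_eq_0_iff [simp]: "epow x a = 0 \<longleftrightarrow> x = 0"
  by (cases x) (auto simp: epow_def)

lemma epow_less_top_iff: "epow x a < top \<longleftrightarrow> x < top"
  by (cases x) (auto simp: epow_def)

lemma epow_eq_top_iff [simp]: "epow x a = top \<longleftrightarrow> x = top"
  by (cases x) (auto simp: epow_def)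

lemma epow_le_iff: "0 < a \<Longrightarrow> epow x a \<le> y \<longleftrightarrow> x \<le> epow y (1 / a)"
  using epow_mono[of "epow x a" y "1/a"] epow_mono[of x "epow y (1/a)" a]
  by (auto simp: epow_epow)

lemma epow_measurable [measurable]: "(\<lambda>x. epow x a) \<in> borel_measurable borel"
  unfolding epow_def by measurable

lemma epow_add_exponents: "0 < x \<Longrightarrow> x < top \<Longrightarrow> epow x a * epow x b = epow x (a + b)"
  by (cases x) (auto simp: epow_def powr_add simp flip: ennreal_mult)

text \<open>The sum is at most twice the larger summand. The constant \<open>2 powr a\<close> serves
  concave and convex powers alike, so exponents on either side of 1 need no separate
  treatment.\<close>

lemma epow_add_le: "0 < a \<Longrightarrow> epow (x + y) a \<le> ennreal (2 powr a) * (epow x a + epow y a)"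
proof -
  assume a: "0 < a"
  have *: "epow (x + y) a \<le> ennreal (2 powr a) * (epow x a + epow y a)" if "x \<le> y" for x y
  proof -
    have "epow (x + y) a \<le> epow (2 * y) a"
      using that a by (intro epow_mono) (auto simp: mult_2 add_right_mono)
    also have "\<dots> = ennreal (2 powr a) * epow y a"
      using a epow_ennreal[of 2 a] by (simp add: epow_mult)
    also have "\<dots> \<le> ennreal (2 powr a) * (epow x a + epow y a)"
      by (intro mult_left_mono) auto
    finally show ?thesis .
  qed
  show ?thesis
    using *[of x y] *[of y x] by (cases "x \<le> y") (auto simp: add.commute)
qed

text \<open>The values are eventually below 1, so the branch of \<open>epow\<close> at infinity is
  left and continuity of the real power at 0 applies.\<close>

lemma tendsto_epow_0:
  assumes "(f \<longlongrightarrow> 0) F" "0 < a"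
  shows "((\<lambda>n. epow (f n) a) \<longlongrightarrow> 0) F"
proof -
  have "\<forall>\<^sub>F n in F. f n < 1"
    using assms(1) by (rule order_tendstoD) auto
  moreover have "((\<lambda>n. ennreal (enn2real (f n) powr a)) \<longlongrightarrow> ennreal (enn2real 0 powr a)) F"
  proof (intro tendsto_ennrealI tendsto_powr')
    show "((\<lambda>n. enn2real (f n)) \<longlongrightarrow> enn2real 0) F"
      using assms(1) by (intro tendsto_enn2real) auto
  qed (use assms(2) in \<open>auto intro!: tendsto_const\<close>)
  ultimately show ?thesis
    by (rule_tac Lim_transform_eventually[rotated, where f="\<lambda>n. ennreal (enn2real (f n) powr a)"])
       (auto elim!: eventually_mono simp: epow_def)
qed

lemma epow_Young:
  assumes "1 < r"
  shows "x * y \<le> ennreal (1 - 1/r) * epow x (r / (r - 1)) + ennreal (1/r) * epow y r"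
proof -
  have *: "0 < 1 - 1/r" using assms by (simp add: field_simps)
  show ?thesis
  proof (cases "x = top \<or> y = top")
    case True
    then show ?thesis using * assms by (auto simp: ennreal_mult_top)
  next
    case False
    then obtain a b where ab: "x = ennreal a" "y = ennreal b" "0 \<le> a" "0 \<le> b"
      by (cases x; cases y) auto
    have "a * b \<le> a powr (r/(r-1)) / (r/(r-1)) + b powr r / r"
      using assms ab by (intro Youngs_inequality) (auto simp: field_simps)
    also have "\<dots> = (1 - 1/r) * a powr (r/(r-1)) + (1/r) * b powr r"
      using assms by (simp add: field_simps)
    finally show ?thesis
      using ab assms * by (simp add: epow_ennreal flip: ennreal_mult ennreal_plus)
  qed
qed

text \<open>Young's inequality, applied pointwise after each factor has been divided by its norm. A
  vanishing norm is settled first, because the product is then zero almost everywhere even if the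
  other norm is infinite.\<close>

lemma nn_integral_Hoelder:
  assumes r: "1 < r" and [measurable]: "u \<in> borel_measurable M" "v \<in> borel_measurable M"
  shows "(\<integral>\<^sup>+z. u z * v z \<partial>M) \<le>
    epow (\<integral>\<^sup>+z. epow (u z) (r / (r - 1)) \<partial>M) (1 - 1/r) * epow (\<integral>\<^sup>+z. epow (v z) r \<partial>M) (1/r)"
proof -
  define A where "A = (\<integral>\<^sup>+z. epow (u z) (r / (r - 1)) \<partial>M)"
  define B where "B = (\<integral>\<^sup>+z. epow (v z) r \<partial>M)"
  have r': "0 < 1 - 1/r" "1 - 1/r = 1 / (r/(r-1))" using r by (auto simp: field_simps)
  consider "A = 0 \<or> B = 0" | "A \<noteq> 0" "B \<noteq> 0" "A = top \<or> B = top" | "0 < A" "0 < B" "A < top" "B < top"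
    by (metis not_gr_zero top.not_eq_extremum)
  then show ?thesis
  proof cases
    case 1
    then have "AE z in M. u z * v z = 0"
    proof
      assume "A = 0"
      then have "AE z in M. u z = 0" unfolding A_def by (subst (asm) nn_integral_0_iff_AE) auto
      then show ?thesis by eventually_elim simp
    next
      assume "B = 0"
      then have "AE z in M. v z = 0" unfolding B_def by (subst (asm) nn_integral_0_iff_AE) auto
      then show ?thesis by eventually_elim simp
    qed
    then have "(\<integral>\<^sup>+z. u z * v z \<partial>M) = (\<integral>\<^sup>+z. 0 \<partial>M)" by (rule nn_integral_cong_AE)
    then show ?thesis by simp
  next
    case 2
    then have "epow A (1 - 1/r) * epow B (1/r) = top"
      by (auto simp: ennreal_mult_eq_top_iff)
    then show ?thesis unfolding A_def B_def by simp
  next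
    case 3
    then obtain a b where ab: "A = ennreal a" "B = ennreal b" "0 < a" "0 < b"
      by (cases A; cases B) auto
    define a' where "a' = a powr (1 - 1/r)"
    define b' where "b' = b powr (1/r)"
    have pos: "0 < a'" "0 < b'" using ab by (auto simp: a'_def b'_def)
    \<comment> \<open>Division by the norms \<open>a'\<close> and \<open>b'\<close> makes both power
      integrals 1, so that the weights \<open>1 - 1/r\<close> and \<open>1/r\<close> of Young's
      inequality add up to 1.\<close>
    have "(\<integral>\<^sup>+z. u z * v z \<partial>M) =
      (\<integral>\<^sup>+z. ennreal (a' * b') * ((ennreal (1 / a') * u z) * (ennreal (1/b') * v z)) \<partial>M)"
    proof (intro nn_integral_cong)
      fix z
      have "ennreal (a' * b') * ((ennreal (1 / a') * u z) * (ennreal (1/b') * v z)) =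
        (ennreal (a' * b') * (ennreal (1 / a') * ennreal (1/b'))) * (u z * v z)"
        by (simp add: mult_ac)
      also have "ennreal (a' * b') * (ennreal (1 / a') * ennreal (1/b')) = 1"
        using pos by (simp flip: ennreal_mult)
      finally show "u z * v z = ennreal (a' * b') * ((ennreal (1 / a') * u z) * (ennreal (1/b') * v z))"
        by simp
    qed
    also have "\<dots> = ennreal (a' * b') * (\<integral>\<^sup>+z. (ennreal (1 / a') * u z) * (ennreal (1/b') * v z) \<partial>M)"
      by (rule nn_integral_cmult) measurable
    also have "(\<integral>\<^sup>+z. (ennreal (1 / a') * u z) * (ennreal (1/b') * v z) \<partial>M) \<le>
      (\<integral>\<^sup>+z. ennreal (1 - 1/r) * epow (ennreal (1 / a') * u z) (r / (r - 1))
         + ennreal (1/r) * epow (ennreal (1 / b') * v z) r \<partial>M)"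
      by (intro nn_integral_mono epow_Young r)
    also have "\<dots> = (\<integral>\<^sup>+z. ennreal (1 - 1/r) * (ennreal (1/a) * epow (u z) (r / (r - 1)))
         + ennreal (1/r) * (ennreal (1/b) * epow (v z) r) \<partial>M)"
    proof -
      have "(1 / a') powr (r / (r - 1)) = 1 / a" "(1 / b') powr r = 1 / b"
        using r ab r' by (auto simp: a'_def b'_def powr_powr powr_divide)
      then show ?thesis
        using r pos by (simp add: epow_mult epow_ennreal)
    qed
    also have "\<dots> = ennreal (1 - 1/r) * (ennreal (1/a) * A) + ennreal (1/r) * (ennreal (1/b) * B)"
      unfolding A_def B_def by (simp add: nn_integral_add nn_integral_cmult)
    also have "\<dots> = 1"
      using ab r r' by (simp flip: ennreal_mult ennreal_plus)
    finally have "(\<integral>\<^sup>+z. u z * v z \<partial>M) \<le> ennreal (a' * b')"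
      by (simp add: mult_left_mono)
    also have "\<dots> = epow A (1 - 1/r) * epow B (1/r)"
      using ab by (simp add: epow_ennreal a'_def b'_def ennreal_mult)
    finally show ?thesis unfolding A_def B_def .
  qed
qed

section \<open>Borel representatives and Whitney averages\<close>

lemma fst_borel_measurable [measurable]:
  "fst \<in> borel_measurable (borel :: ('a::second_countable_topology \<times> 'b::second_countable_topology) measure)"
  by (intro borel_measurable_continuous_onI continuous_intros)

lemma snd_borel_measurable [measurable]:
  "snd \<in> borel_measurable (borel :: ('a::second_countable_topology \<times> 'b::second_countable_topology) measure)"
  by (intro borel_measurable_continuous_onI continuous_intros)

definition hs_eq :: "(real \<times> 'a::euclidean_space \<Rightarrow> complex) \<Rightarrow> (real \<times> 'a \<Rightarrow> complex) \<Rightarrow> bool" where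
  "hs_eq f g \<longleftrightarrow> (AE z in lborel. 0 < fst z \<longrightarrow> f z = g z)"

lemma half_space_iff [simp]: "z \<in> half_space \<longleftrightarrow> 0 < fst z"
  by (cases z) (auto simp: half_space_def)

lemma half_space_borel [measurable]: "half_space \<in> sets borel"
proof -
  have "open (half_space :: (real \<times> 'a) set)"
    unfolding half_space_def by (intro open_Times) auto
  then show ?thesis by simp
qed

lemma half_space_lebesgue: "half_space \<inter> space lebesgue \<in> sets lebesgue"
  by (simp add: sets_completionI_sets)

lemma AE_lebesgue_on_half_space_iff:
  "(AE z in lebesgue_on half_space. P z) \<longleftrightarrow> (AE z in lborel. 0 < fst z \<longrightarrow> P z)"
  using half_space_lebesgue by (subst AE_restrict_space_iff) (auto simp: AE_completion_iff)

lemma measurable_hs_iff: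
  "measurable_hs f \<longleftrightarrow> (\<lambda>z. if 0 < fst z then f z else 0) \<in> borel_measurable lebesgue"
proof -
  have "measurable_hs f \<longleftrightarrow> (\<lambda>z. indicat_real half_space z *\<^sub>R f z) \<in> borel_measurable lebesgue"
    using half_space_lebesgue by (rule borel_measurable_restrict_space_iff)
  also have "(\<lambda>z. indicat_real half_space z *\<^sub>R f z) = (\<lambda>z. if 0 < fst z then f z else 0)"
    by (auto simp: fun_eq_iff indicator_def)
  finally show ?thesis .
qed

lemma Pair_borel_measurable:
  "(\<lambda>x. (c, x)) \<in> borel_measurable borel" "(\<lambda>x. (x, d)) \<in> borel_measurable borel"
  by (intro borel_measurable_continuous_onI continuous_intros)+

lemma cnj_borel_measurable [measurable]:
  "f \<in> borel_measurable M \<Longrightarrow> (\<lambda>x. cnj (f x)) \<in> borel_measurable M"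
  by (rule measurable_compose[of f M borel]) (auto intro: borel_measurable_continuous_onI continuous_on_cnj)

lemma borel_measurable_hs:
  assumes "f \<in> borel_measurable borel"
  shows "measurable_hs f"
proof -
  have "(\<lambda>z. if 0 < fst z then f z else 0) \<in> borel_measurable lborel"
    using assms by measurable
  then show ?thesis unfolding measurable_hs_iff by (rule measurable_completion)
qed

lemma completion_ex_borel_measurable_complex:
  assumes "f \<in> borel_measurable (completion M)"
  obtains f' :: "_ \<Rightarrow> complex" where "f' \<in> borel_measurable M" "AE x in M. f x = f' x"
proof -
  have "(\<lambda>x. Re (f x)) \<in> borel_measurable (completion M)" "(\<lambda>x. Im (f x)) \<in> borel_measurable (completion M)"
    using assms by simp_all
  then obtain a b where [measurable]: "a \<in> borel_measurable M" "b \<in> borel_measurable M"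
    and ab: "AE x in M. Re (f x) = a x" "AE x in M. Im (f x) = b x"
    using completion_ex_borel_measurable_real[of "\<lambda>x. Re (f x)" M]
      completion_ex_borel_measurable_real[of "\<lambda>x. Im (f x)" M] by blast
  show thesis
  proof
    have "(\<lambda>x. Complex (a x) (b x)) = (\<lambda>x. of_real (a x) + \<i> * of_real (b x))"
      by (auto simp: complex_eq_iff fun_eq_iff)
    then show "(\<lambda>x. Complex (a x) (b x)) \<in> borel_measurable M" by simp
    show "AE x in M. f x = Complex (a x) (b x)"
      using ab by eventually_elim (auto simp: complex_eq_iff)
  qed
qed

text \<open>Joint measurability and the theorems of Tonelli and Fubini are used for Borel functions
  only. Norms and pairings do not change under \<open>hs_eq\<close>, so results for representatives
  carry over.\<close>

lemma measurable_hs_borel_rep: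
  assumes "measurable_hs f"
  obtains f' where "f' \<in> borel_measurable borel" "hs_eq f f'"
proof -
  obtain f' where "f' \<in> borel_measurable lborel"
    and ae: "AE z in lborel. (if 0 < fst z then f z else 0) = f' z"
    using assms unfolding measurable_hs_iff by (rule completion_ex_borel_measurable_complex)
  moreover have "hs_eq f f'"
    unfolding hs_eq_def using ae by eventually_elim auto
  ultimately show thesis using that by simp
qed

lemma hs_eq_trans:
  assumes "hs_eq f g" "hs_eq g h"
  shows "hs_eq f h"
  using assms unfolding hs_eq_def by eventually_elim auto

lemma AE_lborel_pair:
  fixes P :: "real \<times> 'a::euclidean_space \<Rightarrow> bool"
  assumes "AE z in lborel. P z"
  shows "AE s in lborel. AE y in lborel. P (s, y)"
proof (rule lborel_pair.AE_pair)
  show "AE z in lborel \<Otimes>\<^sub>M lborel. P z"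
    unfolding lborel_prod by fact
qed

lemma nn_integral_lborel_Pair:
  fixes h :: "'b::euclidean_space \<times> 'a::euclidean_space \<Rightarrow> ennreal"
  assumes "h \<in> borel_measurable borel"
  shows "(\<integral>\<^sup>+s. \<integral>\<^sup>+y. h (s, y) \<partial>lborel \<partial>lborel) = (\<integral>\<^sup>+z. h z \<partial>lborel)"
  using lborel.nn_integral_fst[of h lborel] assms by (simp add: lborel_prod)

definition weighted :: "real \<Rightarrow> (real \<times> 'a::euclidean_space \<Rightarrow> complex) \<Rightarrow> real \<times> 'a \<Rightarrow> ennreal" where
  "weighted \<beta> f z = ennreal (fst z powr (-\<beta>) * cmod (f z))"

lemma weighted_measurable [measurable]:
  "f \<in> borel_measurable borel \<Longrightarrow> weighted \<beta> f \<in> borel_measurable borel"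
  unfolding weighted_def by measurable

definition wbox :: "real \<Rightarrow> 'a::euclidean_space \<Rightarrow> (real \<times> 'a) set" where
  "wbox t x = {t/2<..t} \<times> ball x t"

text \<open>For positive \<open>t\<close> this is the volume of \<open>wbox t x\<close>, an interval
  of length \<open>t/2\<close> times a ball of radius \<open>t\<close>. It depends on the space only
  through its dimension, hence the type argument.\<close>

definition wvol :: "'a::euclidean_space itself \<Rightarrow> real \<Rightarrow> real" where
  "wvol _ t = unit_ball_vol (real DIM('a)) / 2 * t powr (real DIM('a) + 1)"

lemma wvol_pos: "0 < t \<Longrightarrow> 0 < wvol TYPE('a::euclidean_space) t"
  by (simp add: wvol_def)

lemma wbox_borel [measurable]: "wbox t x \<in> sets (borel :: (real \<times> 'a::euclidean_space) measure)"
  unfolding wbox_def by (rule borel_Times) auto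

lemma wbox_bounded: "bounded (wbox t x)"
  unfolding wbox_def by (intro bounded_Times) auto

lemma emeasure_wbox_finite: "emeasure lborel (wbox t x) < \<infinity>"
  by (rule emeasure_bounded_finite[OF wbox_bounded])

lemma wbox_fst_pos: "z \<in> wbox t x \<Longrightarrow> 0 < t \<Longrightarrow> 0 < fst z"
  by (auto simp: wbox_def)

lemma wbox_subset_half_space: "0 < t \<Longrightarrow> wbox t x \<subseteq> half_space"
  by (auto simp: wbox_def)

lemma AE_lebesgue_on_wbox_iff:
  "(AE z in lebesgue_on (wbox t x). P z) \<longleftrightarrow> (AE z in lborel. z \<in> wbox t x \<longrightarrow> P z)"
  by (subst AE_restrict_space_iff) (auto simp: AE_completion_iff)

lemma weighted_measurable_wbox:
  assumes "measurable_hs f" "0 < t"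
  shows "weighted \<beta> f \<in> borel_measurable (lebesgue_on (wbox t x))"
proof -
  have [measurable]: "f \<in> borel_measurable (lebesgue_on (wbox t x))"
    by (rule measurable_restrict_mono[OF assms(1) wbox_subset_half_space[OF assms(2)]])
  have [measurable]: "fst \<in> borel_measurable (lebesgue_on (wbox t x))"
    by (rule measurable_restrict_space1, rule measurable_completion) simp
  show ?thesis unfolding weighted_def by measurable
qed

lemma W_avg_top_eq:
  "W_avg \<infinity> \<beta> f t x = esssup (lebesgue_on (wbox t x)) (weighted \<beta> f)"
  by (simp add: W_avg_def wbox_def weighted_def[abs_def] norm_mult case_prod_unfold)

lemma W_avg_top_le_iff:
  assumes "measurable_hs f" "0 < t"
  shows "W_avg \<infinity> \<beta> f t x \<le> c \<longleftrightarrow> (AE z in lborel. z \<in> wbox t x \<longrightarrow> weighted \<beta> f z \<le> c)"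
proof -
  note m = weighted_measurable_wbox[OF assms]
  show ?thesis
    unfolding W_avg_top_eq AE_lebesgue_on_wbox_iff[symmetric]
    using esssup_I[OF m, where c=c] esssup_AE[where M="lebesgue_on (wbox t x)" and f="weighted \<beta> f"]
    by (auto elim: eventually_mono order.trans)
qed

text \<open>Equality almost everywhere on the half-space passes to almost every section, and the
  nested means ignore null sets in each of the two variables.\<close>

lemma W_avg_AE_cong:
  assumes "hs_eq f g" "measurable_hs f" "measurable_hs g" "0 < t"
  shows "W_avg r \<beta> f t x = W_avg r \<beta> g t x"
proof (cases "r = \<infinity>")
  case True
  have "AE z in lebesgue_on (wbox t x). weighted \<beta> f z = weighted \<beta> g z"
    using assms(1) unfolding AE_lebesgue_on_wbox_iff hs_eq_def
    by eventually_elim (auto simp: weighted_def dest: wbox_fst_pos[OF _ \<open>0 < t\<close>])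
  then show ?thesis
    using assms True unfolding True W_avg_top_eq
    by (intro esssup_AE_cong weighted_measurable_wbox)
next
  case False
  have ae: "AE s in lebesgue. AE y in lebesgue. 0 < s \<longrightarrow> f (s, y) = g (s, y)"
    using AE_lborel_pair[OF assms(1)[unfolded hs_eq_def]] by (simp add: AE_completion_iff)
  let ?m = "\<lambda>f s. mean_value (ball x t)
    (\<lambda>y. ennreal (cmod (complex_of_real (s powr (-\<beta>)) * f (s, y)) powr enn2real r))"
  have "AE s in lebesgue. 0 < s \<longrightarrow> ?m f s = ?m g s"
    using ae
  proof eventually_elim
    case (elim s)
    show ?case
    proof
      assume "0 < s"
      have "AE y in lebesgue. ennreal (cmod (complex_of_real (s powr (-\<beta>)) * f (s, y)) powr enn2real r) * indicator (ball x t) y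
        = ennreal (cmod (complex_of_real (s powr (-\<beta>)) * g (s, y)) powr enn2real r) * indicator (ball x t) y"
        by (rule eventually_mono[OF elim]) (use \<open>0 < s\<close> in simp)
      then show "?m f s = ?m g s"
        unfolding mean_value_def by (simp only: nn_integral_cong_AE)
    qed
  qed
  then have "AE s in lebesgue. ?m f s * indicator {t/2<..t} s = ?m g s * indicator {t/2<..t} s"
    by eventually_elim (use \<open>0 < t\<close> in \<open>auto simp: indicator_def\<close>)
  then have "mean_value {t/2<..t} (?m f) = mean_value {t/2<..t} (?m g)"
    unfolding mean_value_def[of "{t/2<..t}"] by (simp only: nn_integral_cong_AE)
  then show ?thesis
    using False by (simp add: W_avg_def)
qed

text \<open>The integral over an arbitrary set \<open>A\<close> is normalized by the volume of a Whitney box of size \<open>t\<close>.\<close>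

definition box_mean :: "real \<Rightarrow> (real \<times> 'a::euclidean_space \<Rightarrow> ennreal) \<Rightarrow> (real \<times> 'a) set \<Rightarrow> real \<Rightarrow> ennreal" where
  "box_mean r v A t =
    epow ((\<integral>\<^sup>+z\<in>A. epow (v z) r \<partial>lborel) / ennreal (wvol TYPE('a) t)) (1 / r)"

text \<open>Tonelli's theorem turns the nested means into one integral over the box; the volume of
  the ball times the length \<open>t/2\<close> is \<open>wvol\<close>.\<close>

lemma W_avg_eq:
  fixes f :: "real \<times> 'a::euclidean_space \<Rightarrow> complex"
  assumes [measurable]: "f \<in> borel_measurable borel" and "0 < t" "0 < r"
  shows "W_avg (ennreal r) \<beta> f t x = box_mean r (weighted \<beta> f) (wbox t x) t"
proof -
  define c where "c = unit_ball_vol (real DIM('a)) * t ^ DIM('a)"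
  have c: "0 < c" using \<open>0 < t\<close> by (simp add: c_def)
  have m1: "mean_value (ball x t) h = (\<integral>\<^sup>+y. h y * indicator (ball x t) y \<partial>lborel) / ennreal c" for h :: "'a \<Rightarrow> ennreal"
    using \<open>0 < t\<close> emeasure_ball[of t x] by (simp add: mean_value_def nn_integral_completion c_def)
  have m2: "mean_value {t/2<..t} h = (\<integral>\<^sup>+s. h s * indicator {t/2<..t} s \<partial>lborel) / ennreal (t/2)" for h :: "real \<Rightarrow> ennreal"
    using \<open>0 < t\<close> by (simp add: mean_value_def nn_integral_completion)
  have w: "ennreal (cmod (complex_of_real (s powr - \<beta>) * f (s, y)) powr enn2real (ennreal r)) = epow (weighted \<beta> f (s, y)) r" for s y
    using \<open>0 < r\<close> by (simp add: weighted_def epow_ennreal norm_mult)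
  let ?h = "\<lambda>z. epow (weighted \<beta> f z) r * indicator (wbox t x) z"
  have "(\<integral>\<^sup>+s. (\<integral>\<^sup>+y. epow (weighted \<beta> f (s, y)) r * indicator (ball x t) y \<partial>lborel) / ennreal c * indicator {t/2<..t} s \<partial>lborel)
     = (\<integral>\<^sup>+s. (\<integral>\<^sup>+y. ?h (s, y) \<partial>lborel) / ennreal c \<partial>lborel)"
    by (intro nn_integral_cong) (auto simp: indicator_def wbox_def)
  also have "\<dots> = (\<integral>\<^sup>+s. (\<integral>\<^sup>+y. ?h (s, y) \<partial>lborel) \<partial>lborel) / ennreal c"
    by (intro nn_integral_divide) measurable
  also have "\<dots> = (\<integral>\<^sup>+z. ?h z \<partial>lborel) / ennreal c"
    by (subst nn_integral_lborel_Pair) auto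
  finally have "W_avg (ennreal r) \<beta> f t x = epow ((\<integral>\<^sup>+z. ?h z \<partial>lborel) / ennreal c / ennreal (t/2)) (1/r)"
    using \<open>0 < r\<close> unfolding W_avg_def w m1 m2 by simp
  also have "(\<integral>\<^sup>+z. ?h z \<partial>lborel) / ennreal c / ennreal (t/2) = (\<integral>\<^sup>+z. ?h z \<partial>lborel) / ennreal (wvol TYPE('a) t)"
  proof -
    have "c * (t/2) = wvol TYPE('a) t"
      using \<open>0 < t\<close> by (simp add: c_def wvol_def powr_add powr_realpow)
    then show ?thesis
      using c \<open>0 < t\<close> wvol_pos[OF \<open>0 < t\<close>, where 'a='a]
      by (simp add: divide_ennreal_def inverse_ennreal mult.assoc flip: ennreal_mult) (simp add: field_simps)
  qed
  finally show ?thesis unfolding box_mean_def .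
qed

text \<open>Tonelli's theorem for the integrand multiplied by the joint indicator of parameter and
  point. A domain that moves with the parameter only has to be a measurable relation between the
  two.\<close>

lemma nn_integral_section_measurable:
  fixes v :: "'c::euclidean_space \<Rightarrow> ennreal" and A :: "'d::euclidean_space \<Rightarrow> 'c set"
  assumes [measurable]: "v \<in> borel_measurable borel" "Measurable.pred (borel \<Otimes>\<^sub>M borel) (\<lambda>w. snd w \<in> A (fst w))"
  shows "(\<lambda>w. \<integral>\<^sup>+z\<in>A w. v z \<partial>lborel) \<in> borel_measurable borel"
proof -
  have "(\<lambda>w. indicator {w. snd w \<in> A (fst w)} w :: ennreal) \<in> borel_measurable (borel \<Otimes>\<^sub>M borel)"
    by measurable
  then have [measurable]: "(\<lambda>w. indicator (A (fst w)) (snd w) :: ennreal) \<in> borel_measurable (borel \<Otimes>\<^sub>M borel)"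
    by (simp add: indicator_def)
  have "(\<lambda>w. v (snd w) * indicator (A (fst w)) (snd w)) \<in> borel_measurable (borel \<Otimes>\<^sub>M lborel)"
    by measurable
  then show ?thesis
    by (intro lborel.borel_measurable_nn_integral) (simp add: case_prod_unfold)
qed

lemma box_mean_measurable:
  fixes v :: "real \<times> 'a::euclidean_space \<Rightarrow> ennreal"
  assumes [measurable]: "v \<in> borel_measurable borel"
    and A: "Measurable.pred (borel \<Otimes>\<^sub>M borel) (\<lambda>w :: (real \<times> 'a) \<times> (real \<times> 'a). snd w \<in> A (fst w))"
  shows "(\<lambda>w. box_mean r v (A w) (fst w)) \<in> borel_measurable borel"
proof -
  have [measurable]: "(\<lambda>w. \<integral>\<^sup>+z\<in>A w. epow (v z) r \<partial>lborel) \<in> borel_measurable borel"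
    using A by (intro nn_integral_section_measurable) measurable
  show ?thesis unfolding box_mean_def wvol_def by measurable
qed

lemma pred_wbox:
  "Measurable.pred (borel \<Otimes>\<^sub>M borel) (\<lambda>w :: (real \<times> 'a) \<times> (real \<times> 'a::euclidean_space). snd w \<in> wbox (fst (fst w)) (snd (fst w)))"
proof -
  have "(\<lambda>w :: (real \<times> 'a) \<times> (real \<times> 'a). snd w \<in> wbox (fst (fst w)) (snd (fst w))) =
    (\<lambda>w. fst (fst w) / 2 < fst (snd w) \<and> fst (snd w) \<le> fst (fst w) \<and> dist (snd (fst w)) (snd (snd w)) < fst (fst w))"
    by (auto simp: wbox_def fun_eq_iff)
  also have "Measurable.pred (borel \<Otimes>\<^sub>M borel) \<dots>"
    by measurable
  finally show ?thesis .
qed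

lemma box_mean_wbox_measurable [measurable]:
  assumes "v \<in> borel_measurable borel"
  shows "(\<lambda>w. box_mean r v (wbox (fst w) (snd w)) (fst w)) \<in> borel_measurable borel"
  using assms pred_wbox by (rule box_mean_measurable)

text \<open>The root of order \<open>q\<close> is left out; it is merged with the outer power into
  the exponent \<open>p / q\<close>.\<close>

definition T_inner :: "real \<Rightarrow> real \<Rightarrow> (real \<times> 'a::euclidean_space \<Rightarrow> ennreal) \<Rightarrow> 'a \<Rightarrow> ennreal" where
  "T_inner q r v x = (\<integral>\<^sup>+t\<in>{0<..}. (epow (box_mean r v (wbox t x) t) q / ennreal t) \<partial>lborel)"

lemma T_inner_measurable [measurable]:
  assumes [measurable]: "v \<in> borel_measurable borel"
  shows "T_inner q r v \<in> borel_measurable borel"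
proof -
  have [measurable]: "(\<lambda>w. box_mean r v (wbox (fst w) (snd w)) (fst w)) \<in> borel_measurable (borel \<Otimes>\<^sub>M borel)"
    using box_mean_wbox_measurable[OF assms] by (simp add: borel_prod)
  have "(\<lambda>w. box_mean r v (wbox (snd w) (fst w)) (snd w)) \<in> borel_measurable (borel \<Otimes>\<^sub>M borel)"
    using measurable_compose[OF measurable_Pair[OF measurable_snd measurable_fst] box_mean_wbox_measurable[OF assms, unfolded borel_prod[symmetric]]]
    by simp
  then have [measurable]: "(\<lambda>w. box_mean r v (wbox (snd w) (fst w)) (snd w)) \<in> borel_measurable (borel \<Otimes>\<^sub>M lborel)"
    by simp
  have "(\<lambda>w. epow (box_mean r v (wbox (snd w) (fst w)) (snd w)) q / ennreal (snd w) * indicator {0<..} (snd w)) \<in> borel_measurable (borel \<Otimes>\<^sub>M lborel)"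
    by measurable
  then show ?thesis
    unfolding T_inner_def by (intro lborel.borel_measurable_nn_integral) (simp add: case_prod_unfold)
qed

lemma T_norm_eq:
  assumes "f \<in> borel_measurable borel" "0 < r"
  shows "T_norm p q r \<beta> f = epow (\<integral>\<^sup>+x. epow (T_inner q r (weighted \<beta> f) x) (p / q) \<partial>lborel) (1 / p)"
proof -
  have "(\<integral>\<^sup>+t\<in>{0<..}. (epow (W_avg (ennreal r) \<beta> f t x) q / ennreal t) \<partial>lebesgue) =
     T_inner q r (weighted \<beta> f) x" for x
    unfolding T_inner_def nn_integral_completion
    by (intro nn_integral_cong) (auto simp: indicator_def W_avg_eq assms)
  then show ?thesis
    unfolding T_norm_def by (simp add: epow_epow nn_integral_completion)
qed

lemma T_norm_cong:
  assumes "hs_eq f g" "measurable_hs f" "measurable_hs g"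
  shows "T_norm p q r \<beta> f = T_norm p q r \<beta> g"
proof -
  have "(\<integral>\<^sup>+t\<in>{0<..}. (epow (W_avg (ennreal r) \<beta> f t x) q / ennreal t) \<partial>lebesgue) =
     (\<integral>\<^sup>+t\<in>{0<..}. (epow (W_avg (ennreal r) \<beta> g t x) q / ennreal t) \<partial>lebesgue)" for x
    by (intro nn_integral_cong) (auto simp: indicator_def W_avg_AE_cong[OF assms])
  then show ?thesis unfolding T_norm_def by simp
qed

lemma Z_norm_cong:
  assumes "hs_eq f g" "measurable_hs f" "measurable_hs g"
  shows "Z_norm r \<beta> f = Z_norm r \<beta> g"
proof -
  have eq: "esssup lebesgue (\<lambda>x. W_avg r \<beta> f t x) = esssup lebesgue (\<lambda>x. W_avg r \<beta> g t x)" if "0 < t" for t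
    using that by (simp add: W_avg_AE_cong[OF assms])
  \<comment> \<open>For functions that are not measurable, both sides take the default value
    infinity of \<open>esssup\<close>, so measurability has to be transferred before the values are
    compared.\<close>
  have "esssup M u = esssup M v" if "\<And>t. t \<in> space M \<Longrightarrow> u t = v t" for M and u v :: "real \<Rightarrow> ennreal"
  proof -
    have "u \<in> borel_measurable M \<longleftrightarrow> v \<in> borel_measurable M"
      using that by (rule measurable_cong)
    then show ?thesis
      using that by (cases "u \<in> borel_measurable M")
        (auto simp: esssup_non_measurable intro!: esssup_AE_cong AE_I2)
  qed
  then show ?thesis
    unfolding Z_norm_def by (rule) (use eq in simp)
qed

section \<open>The embedding into a weighted Lebesgue space\<close>

text \<open>The shrunken box \<open>rbox t x\<close> lies in \<open>wbox t' x'\<close> for a set of parameters \<open>(t', x')\<close> of positive measure.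
  So it is controlled by the two norms, which see the averages only for almost all parameters.\<close>

definition rbox :: "real \<Rightarrow> 'a::euclidean_space \<Rightarrow> (real \<times> 'a) set" where
  "rbox t x = {2/3*t<..t} \<times> ball x (t/2)"

lemma rbox_borel [measurable]: "rbox t x \<in> sets (borel :: (real \<times> 'a::euclidean_space) measure)"
  unfolding rbox_def by (rule borel_Times) auto

lemma ennreal_divide_eq: "0 < c \<Longrightarrow> x / ennreal c = x * ennreal (1 / c)"
  by (simp add: divide_ennreal_def inverse_ennreal inverse_eq_divide)

lemma box_mean_section_measurable [measurable]:
  assumes "v \<in> borel_measurable borel"
  shows "(\<lambda>t. box_mean r v (wbox t x) t) \<in> borel_measurable borel"
proof -
  from measurable_compose[OF Pair_borel_measurable(2) box_mean_wbox_measurable[OF assms]] show ?thesis by simp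
qed

text \<open>The lower end \<open>2/3 * t\<close> of \<open>rbox\<close> is half of the largest
  admissible \<open>t'\<close>, and the halved radius leaves room \<open>t/2\<close> for moving the
  centre.\<close>

lemma rbox_subset_wbox:
  assumes "0 < t" "t \<le> t'" "t' \<le> 4/3 * t" "dist x x' \<le> t/2"
  shows "rbox t x \<subseteq> wbox t' x'"
proof -
  have "dist x' y < t'" if "dist x y < t/2" for y
    using that assms dist_triangle[of x' y x] by (simp add: dist_commute)
  then show ?thesis using assms by (auto simp: rbox_def wbox_def)
qed

lemma wvol_scale: "0 < t \<Longrightarrow> 0 < c \<Longrightarrow> wvol TYPE('a::euclidean_space) (c * t) = c powr (real DIM('a) + 1) * wvol TYPE('a) t"
  by (simp add: wvol_def powr_mult)

lemma wvol_mono: "0 < t \<Longrightarrow> t \<le> t' \<Longrightarrow> wvol TYPE('a::euclidean_space) t \<le> wvol TYPE('a) t'"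
  unfolding wvol_def by (intro mult_left_mono powr_mono2) auto

lemma box_mean_scale:
  fixes v :: "real \<times> 'a::euclidean_space \<Rightarrow> ennreal"
  assumes "A \<subseteq> B" "0 < t" "0 < t'" "wvol TYPE('a) t' \<le> c * wvol TYPE('a) t" "0 < c" "0 < r"
  shows "box_mean r v A t \<le> ennreal (c powr (1/r)) * box_mean r v B t'"
proof -
  have pos: "0 < wvol TYPE('a) t" "0 < wvol TYPE('a) t'"
    using assms by (auto intro: wvol_pos)
  have *: "(\<integral>\<^sup>+z\<in>A. epow (v z) r \<partial>lborel) \<le> (\<integral>\<^sup>+z\<in>B. epow (v z) r \<partial>lborel)" (is "?A \<le> ?B")
    using assms(1) by (intro nn_integral_mono) (auto simp: indicator_def)
  have "?A / ennreal (wvol TYPE('a) t) \<le> ?B * (ennreal (1 / wvol TYPE('a) t))"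
    unfolding divide_ennreal_def using pos * by (simp add: inverse_ennreal inverse_eq_divide mult_right_mono)
  also have "\<dots> \<le> ?B * ennreal (c * (1 / wvol TYPE('a) t'))"
    using pos assms by (intro mult_left_mono ennreal_leI) (auto simp: field_simps)
  also have "\<dots> = ennreal c * (?B / ennreal (wvol TYPE('a) t'))"
    using pos assms by (simp only: ennreal_divide_eq ennreal_mult'[OF less_imp_le[OF \<open>0 < c\<close>]] mult_ac)
  finally have "epow (?A / ennreal (wvol TYPE('a) t)) (1/r) \<le> epow (ennreal c * (?B / ennreal (wvol TYPE('a) t'))) (1/r)"
    using assms by (intro epow_mono) auto
  then show ?thesis
    using assms by (simp add: box_mean_def epow_mult epow_ennreal)
qed

lemma box_mean_rbox_le:
  fixes v :: "real \<times> 'a::euclidean_space \<Rightarrow> ennreal"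
  assumes "0 < t" "t \<le> t'" "t' \<le> 4/3 * t" "dist x x' \<le> t/2" "0 < r"
  shows "box_mean r v (rbox t x) t \<le>
    ennreal (((4/3) powr (real DIM('a) + 1)) powr (1/r)) * box_mean r v (wbox t' x') t'"
proof (rule box_mean_scale[OF rbox_subset_wbox[OF assms(1-4)]])
  have "wvol TYPE('a) t' \<le> wvol TYPE('a) (4/3 * t)"
    using assms by (intro wvol_mono) auto
  then show "wvol TYPE('a) t' \<le> (4/3) powr (real DIM('a) + 1) * wvol TYPE('a) t"
    using wvol_scale[of t "4/3", where 'a='a] assms by simp
qed (use assms in auto)

text \<open>The left side is dominated by the mean over every box at \<open>x'\<close> whose size
  lies between \<open>t\<close> and \<open>4/3 * t\<close>. Averaging the power \<open>q\<close>
  over these sizes with respect to dt'/t' yields a part of the integral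
  \<open>T_inner\<close>.\<close>

lemma box_mean_le_T_inner:
  assumes r: "0 < r" and q: "0 < q"
  obtains K where "0 < K"
    "\<And>(v :: real \<times> 'a::euclidean_space \<Rightarrow> ennreal) t x x'. v \<in> borel_measurable borel \<Longrightarrow> 0 < t \<Longrightarrow> dist x x' \<le> t/2 \<Longrightarrow>
    box_mean r v (rbox t x) t \<le> ennreal K * epow (T_inner q r v x') (1/q)"
proof -
  define K1 where "K1 = ((4/3) powr (real DIM('a) + 1)) powr (1/r)"
  have K1: "0 < K1" by (simp add: K1_def)
  have "box_mean r v (rbox t x) t \<le> ennreal (K1 * 4 powr (1/q)) * epow (T_inner q r v x') (1/q)"
    if [measurable]: "v \<in> borel_measurable borel" and t: "0 < t" and x: "dist x x' \<le> t/2"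
    for t and x x' :: 'a and v :: "real \<times> 'a \<Rightarrow> ennreal"
  proof -
    define a where "a = box_mean r v (rbox t x) t"
    have a: "epow a q \<le> ennreal (K1 powr q) * epow (box_mean r v (wbox t' x') t') q"
      if t': "t \<le> t'" "t' \<le> 4/3*t" for t'
    proof -
      have "epow a q \<le> epow (ennreal K1 * box_mean r v (wbox t' x') t') q"
        unfolding a_def K1_def using q by (intro epow_mono box_mean_rbox_le t t' x r) auto
      then show ?thesis using K1 q by (simp add: epow_mult epow_ennreal)
    qed
    \<comment> \<open>The interval has length \<open>t/3\<close>, so \<open>3/t\<close> normalises
      it; since \<open>t' <= 4/3 * t\<close>, also \<open>3/t <= 4/t'\<close>, which produces the
      measure dt'/t' at the cost of the factor 4.\<close>
    have "epow a q = (\<integral>\<^sup>+t'. epow a q * ennreal (3/t) * indicator {t..4/3*t} t' \<partial>lborel)"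
    proof -
      have "ennreal (3/t) * ennreal (4/3*t - t) = 1"
        using t by (simp flip: ennreal_mult)
      then show ?thesis using t by (simp add: nn_integral_cmult mult.assoc)
    qed
    also have "\<dots> \<le> (\<integral>\<^sup>+t'. ennreal (4 * K1 powr q) * (epow (box_mean r v (wbox t' x') t') q / ennreal t' * indicator {0<..} t') \<partial>lborel)"
    proof (intro nn_integral_mono)
      fix t'
      have "epow a q * ennreal (3/t) \<le> ennreal (4 * K1 powr q) * (epow (box_mean r v (wbox t' x') t') q / ennreal t')"
        if t': "t \<le> t'" "t' \<le> 4/3*t"
      proof -
        have "epow a q * ennreal (3/t) \<le> (ennreal (K1 powr q) * epow (box_mean r v (wbox t' x') t') q) * ennreal (4 * (1/t'))"
          using t t' by (intro mult_mono a ennreal_leI) (auto simp: field_simps)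
        also have "\<dots> = ennreal (4 * K1 powr q) * (epow (box_mean r v (wbox t' x') t') q / ennreal t')"
        proof -
          have 1: "ennreal (4 * (1/t')) = 4 * ennreal (1/t')" "ennreal (4 * K1 powr q) = 4 * ennreal (K1 powr q)"
            using t t' by (subst ennreal_mult'; simp)+
          have "0 < t'" using t t' by simp
          then show ?thesis
            unfolding 1 by (simp only: ennreal_divide_eq mult_ac)
        qed
        finally show ?thesis .
      qed
      then show "epow a q * ennreal (3/t) * indicator {t..4/3*t} t' \<le>
        ennreal (4 * K1 powr q) * (epow (box_mean r v (wbox t' x') t') q / ennreal t' * indicator {0<..} t')"
        using t by (auto simp: indicator_def)
    qed
    also have "\<dots> = ennreal (4 * K1 powr q) * T_inner q r v x'"
      unfolding T_inner_def by (rule nn_integral_cmult) measurable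
    finally have "epow a q \<le> ennreal (4 * K1 powr q) * T_inner q r v x'" .
    then have "a \<le> epow (ennreal (4 * K1 powr q) * T_inner q r v x') (1/q)"
      using q by (simp add: epow_le_iff)
    also have "\<dots> = ennreal (K1 * 4 powr (1/q)) * epow (T_inner q r v x') (1/q)"
      using q K1 by (simp add: epow_mult epow_ennreal powr_mult powr_powr mult.commute)
    finally show ?thesis unfolding a_def .
  qed
  then show thesis using K1 by (intro that[of "K1 * 4 powr (1/q)"]) auto
qed

text \<open>With the weight and the modulus split off, domination, scaling and quasi-subadditivity
  of the tent space norm become statements about nonnegative functions.\<close>

definition T_fun :: "real \<Rightarrow> real \<Rightarrow> real \<Rightarrow> (real \<times> 'a::euclidean_space \<Rightarrow> ennreal) \<Rightarrow> ennreal" where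
  "T_fun p q r v = epow (\<integral>\<^sup>+x. epow (T_inner q r v x) (p / q) \<partial>lborel) (1 / p)"

text \<open>The bound by \<open>T_inner\<close> holds at all \<open>x'\<close> in the ball of radius
  \<open>t/2\<close> about \<open>x\<close>. Its power \<open>p\<close> is integrated over that
  ball; the volume \<open>c\<close>, of order \<open>t powr d\<close>, moves to the right side and
  gives the decay in \<open>t\<close>.\<close>

lemma box_mean_le_T_fun:
  fixes v :: "real \<times> 'a::euclidean_space \<Rightarrow> ennreal"
  assumes [measurable]: "v \<in> borel_measurable borel" and K: "0 < K" "\<And>t x x'. 0 < t \<Longrightarrow> dist x x' \<le> t/2 \<Longrightarrow>
    box_mean r v (rbox t x) t \<le> ennreal K * epow (T_inner q r v x') (1/q)"
   and p: "0 < p" and q: "0 < q" and t: "0 < t"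
  shows "box_mean r v (rbox t x) t \<le>
    ennreal (K * (unit_ball_vol (real DIM('a)) * (1/2) ^ DIM('a)) powr (-1/p)) * T_fun p q r v * ennreal (t powr (- real DIM('a) / p))"
proof -
  define a where "a = box_mean r v (rbox t x) t"
  define c where "c = unit_ball_vol (real DIM('a)) * (t/2) ^ DIM('a)"
  have c: "0 < c" using t by (simp add: c_def)
  have "epow a p * ennreal c = (\<integral>\<^sup>+x'. epow a p * indicator (ball x (t/2)) x' \<partial>lborel)"
    using t emeasure_ball[of "t/2" x] by (simp add: nn_integral_cmult_indicator c_def)
  also have "\<dots> \<le> (\<integral>\<^sup>+x'. ennreal (K powr p) * epow (T_inner q r v x') (p/q) \<partial>lborel)"
  proof (intro nn_integral_mono)
    fix x'
    have "epow a p \<le> ennreal (K powr p) * epow (T_inner q r v x') (p/q)" if "dist x x' < t/2"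
    proof -
      have "epow a p \<le> epow (ennreal K * epow (T_inner q r v x') (1/q)) p"
        unfolding a_def using p t that by (intro epow_mono K) auto
      then show ?thesis using p K by (simp add: epow_mult epow_ennreal epow_epow)
    qed
    then show "epow a p * indicator (ball x (t/2)) x' \<le> ennreal (K powr p) * epow (T_inner q r v x') (p/q)"
      by (auto simp: indicator_def)
  qed
  also have "\<dots> = ennreal (K powr p) * epow (T_fun p q r v) p"
    using p by (simp add: nn_integral_cmult T_fun_def epow_epow)
  finally have "epow (epow a p * ennreal c) (1/p) \<le> epow (ennreal (K powr p) * epow (T_fun p q r v) p) (1/p)"
    using p by (intro epow_mono) auto
  then have "a * ennreal (c powr (1/p)) \<le> ennreal K * T_fun p q r v"
    using p K c by (simp add: epow_mult epow_epow epow_ennreal powr_powr)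
  then have "a * ennreal (c powr (1/p)) * ennreal (c powr (-1/p)) \<le> ennreal K * T_fun p q r v * ennreal (c powr (-1/p))"
    by (rule mult_right_mono) auto
  also have "a * ennreal (c powr (1/p)) * ennreal (c powr (-1/p)) = a"
    using c by (simp add: mult.assoc powr_minus flip: ennreal_mult)
  also have "c powr (-1/p) = (unit_ball_vol (real DIM('a)) * (1/2) ^ DIM('a)) powr (-1/p) * t powr (- real DIM('a) / p)"
  proof -
    have "c = (unit_ball_vol (real DIM('a)) * (1/2) ^ DIM('a)) * t powr (real DIM('a))"
      using t by (simp add: c_def powr_realpow power_divide)
    then show ?thesis using t by (simp add: powr_mult powr_powr)
  qed
  finally show ?thesis unfolding a_def using K by (simp add: ennreal_mult mult_ac)
qed

text \<open>With \<alpha> as below, the constant bound is used near 0, where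
  \<open>t powr (\<alpha> - 1)\<close> is integrable as \<alpha> is positive, and the decaying bound
  near infinity, where it leaves \<open>t powr (-d-1)\<close>. At the cut both pieces have the same
  size up to the factors \<open>1/\<alpha>\<close> and \<open>1/d\<close>.\<close>

lemma nn_integral_power_split:
  fixes a :: "real \<Rightarrow> ennreal" and d p :: real
  assumes d: "0 < d" and p: "0 < p" "p < 1" and \<nu>: "0 < \<nu>" "\<nu> < top"
    and a: "\<And>t. 0 < t \<Longrightarrow> a t \<le> \<phi>" "\<And>t. 0 < t \<Longrightarrow> a t \<le> \<nu> * ennreal (t powr (-d/p))"
  shows "(\<integral>\<^sup>+t\<in>{0<..}. ennreal (t powr (d * (1/p - 1) - 1)) * a t \<partial>lborel)
    \<le> ennreal (1 / (d * (1/p - 1)) + 1/d) * (epow \<nu> (1 - p) * epow \<phi> p)"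
proof -
  define \<alpha> where "\<alpha> = d * (1/p - 1)"
  have \<alpha>: "0 < \<alpha>" using d p by (simp add: \<alpha>_def field_simps)
  consider "\<phi> = 0" | "\<phi> = top" | "0 < \<phi>" "\<phi> < top"
    using top.not_eq_extremum not_gr_zero by metis
  then show ?thesis
  proof cases
    case 1
    then have "(\<integral>\<^sup>+t\<in>{0<..}. ennreal (t powr (d * (1/p - 1) - 1)) * a t \<partial>lborel) = (\<integral>\<^sup>+(t::real). 0 \<partial>lborel)"
      using a(1) by (intro nn_integral_cong) (auto simp: indicator_def)
    then show ?thesis by simp
  next
    case 2
    then have "epow \<nu> (1 - p) * epow \<phi> p = top"
      using \<nu> by (auto simp: ennreal_mult_eq_top_iff)
    moreover have "0 < 1 / \<alpha> + 1/d" using \<alpha> d by (simp add: add_pos_pos)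
    ultimately show ?thesis by (simp add: ennreal_mult_top \<alpha>_def)
  next
    case 3
    then obtain F N where FN: "\<phi> = ennreal F" "\<nu> = ennreal N" "0 < F" "0 < N"
      using \<nu> by (cases \<phi>; cases \<nu>) auto
    \<comment> \<open>the two bounds for \<open>a t\<close> agree at \<open>t = T\<close>\<close>
    define T where "T = (N/F) powr (p/d)"
    have T: "0 < T" using FN by (simp add: T_def)
    have "(\<integral>\<^sup>+t\<in>{0<..}. ennreal (t powr (d * (1/p - 1) - 1)) * a t \<partial>lborel) \<le>
      (\<integral>\<^sup>+t. ennreal F * (ennreal (t powr (\<alpha> - 1)) * indicator {0..T} t) + ennreal N * (ennreal (t powr (-d-1)) * indicator {T..} t) \<partial>lborel)"
    proof (intro nn_integral_mono)
      fix t :: real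
      show "ennreal (t powr (d * (1/p - 1) - 1)) * a t * indicator {0<..} t \<le>
        ennreal F * (ennreal (t powr (\<alpha> - 1)) * indicator {0..T} t) + ennreal N * (ennreal (t powr (-d-1)) * indicator {T..} t)"
      proof (cases "0 < t")
        case True
        have 1: "ennreal (t powr (\<alpha> - 1)) * a t \<le> ennreal F * ennreal (t powr (\<alpha> - 1))"
          using a(1)[OF True] FN by (subst mult.commute) (auto intro: mult_right_mono)
        have "ennreal (t powr (\<alpha> - 1)) * a t \<le> ennreal (t powr (\<alpha> - 1)) * (ennreal N * ennreal (t powr (-d/p)))"
          using a(2)[OF True] FN by (auto intro: mult_left_mono)
        also have "\<dots> = ennreal N * ennreal (t powr (\<alpha> - 1 + (-d/p)))"
          by (simp only: powr_add ennreal_mult[OF powr_ge_zero powr_ge_zero] mult_ac)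
        also have "\<alpha> - 1 + (-d/p) = -d - 1" by (simp add: \<alpha>_def field_simps)
        finally have 2: "ennreal (t powr (\<alpha> - 1)) * a t \<le> ennreal N * ennreal (t powr (-d-1))" .
        show ?thesis
        proof (cases "t \<le> T")
          case True
          then show ?thesis using 1 \<open>0 < t\<close> unfolding \<alpha>_def[symmetric]
            by (simp add: add_increasing2)
        next
          case False
          then show ?thesis using 2 \<open>0 < t\<close> unfolding \<alpha>_def[symmetric] by simp
        qed
      qed auto
    qed
    also have "\<dots> = ennreal F * ennreal (T powr \<alpha> / \<alpha>) + ennreal N * ennreal (T powr (-d) / d)"
    proof -
      have 1: "(\<integral>\<^sup>+t. ennreal (t powr (\<alpha> - 1)) * indicator {0..T} t \<partial>lborel) = ennreal (T powr \<alpha> / \<alpha>)"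
        using has_integral_powr_from_0[of "\<alpha> - 1" T] \<alpha> T
        by (intro nn_integral_has_integral_lebesgue') auto
      have 2: "(\<integral>\<^sup>+t. ennreal (t powr (-d-1)) * indicator {T..} t \<partial>lborel) = ennreal (T powr (-d) / d)"
        using has_integral_powr_to_inf[of "-d-1" T] d T
        by (intro nn_integral_has_integral_lebesgue') auto
      show ?thesis
        using 1 2 by (subst nn_integral_add; (subst nn_integral_cmult)?) (auto simp: nn_integral_cmult)
    qed
    also have "\<dots> = ennreal ((1/\<alpha> + 1/d) * (N powr (1-p) * F powr p))"
    proof -
      have "p / d * \<alpha> = 1 - p"
        using p d by (simp add: \<alpha>_def right_diff_distrib)
      then have "T powr \<alpha> = (N/F) powr (1 - p)"
        by (simp only: T_def powr_powr)
      then have 1: "F * T powr \<alpha> = N powr (1-p) * F powr p"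
        using FN by (simp add: powr_divide powr_diff field_simps)
      have e: "T powr (-d) = (N/F) powr (-p)"
        using p d by (simp add: T_def powr_powr)
      have 2: "N * T powr (-d) = N powr (1-p) * F powr p"
        unfolding e using FN by (simp add: powr_divide powr_diff powr_minus field_simps)
      have "F * (T powr \<alpha> / \<alpha>) + N * (T powr (-d) / d) = (1/\<alpha> + 1/d) * (N powr (1-p) * F powr p)"
        using 1 2 by (simp add: algebra_simps)
      then show ?thesis
        using FN \<alpha> d by (simp flip: ennreal_mult ennreal_plus)
    qed
    also have "\<dots> = ennreal (1 / \<alpha> + 1/d) * (epow \<nu> (1 - p) * epow \<phi> p)"
      using FN \<alpha> d by (simp add: epow_ennreal ennreal_mult)
    finally show ?thesis unfolding \<alpha>_def .
  qed
qed


lemma pred_rbox: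
  "Measurable.pred (borel \<Otimes>\<^sub>M borel) (\<lambda>w :: (real \<times> 'a) \<times> (real \<times> 'a::euclidean_space). snd w \<in> rbox (fst (fst w)) (snd (fst w)))"
proof -
  have "(\<lambda>w :: (real \<times> 'a) \<times> (real \<times> 'a). snd w \<in> rbox (fst (fst w)) (snd (fst w))) =
    (\<lambda>w. 2/3 * fst (fst w) < fst (snd w) \<and> fst (snd w) \<le> fst (fst w) \<and> dist (snd (fst w)) (snd (snd w)) < fst (fst w) / 2)"
    by (auto simp: rbox_def fun_eq_iff)
  also have "Measurable.pred (borel \<Otimes>\<^sub>M borel) \<dots>"
    by measurable
  finally show ?thesis .
qed

lemma box_mean_rbox_measurable [measurable]:
  assumes "v \<in> borel_measurable borel"
  shows "(\<lambda>w. box_mean r v (rbox (fst w) (snd w)) (fst w)) \<in> borel_measurable borel"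
  using assms pred_rbox by (rule box_mean_measurable)

lemma box_mean_rbox_section_measurable [measurable]:
  assumes "v \<in> borel_measurable borel"
  shows "(\<lambda>t. box_mean r v (rbox t x) t) \<in> borel_measurable borel"
proof -
  from measurable_compose[OF Pair_borel_measurable(2) box_mean_rbox_measurable[OF assms]] show ?thesis by simp
qed

text \<open>For fixed \<open>x\<close> the splitting uses \<open>T_inner\<close> at the centre
  \<open>x' = x\<close> as constant bound and \<open>T_fun\<close> for the decaying bound. The case
  \<open>N = 0\<close> is separate, since the cut between the two bounds would then sit at
  0.\<close>

lemma T_fun_embedding:
  assumes p: "0 < p" "p < 1" and q: "0 < q" and r: "0 < r"
  obtains C where "0 < C"
    "\<And>v :: real \<times> 'a::euclidean_space \<Rightarrow> ennreal. v \<in> borel_measurable borel \<Longrightarrow>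
      (\<integral>\<^sup>+x. (\<integral>\<^sup>+t\<in>{0<..}. ennreal (t powr (real DIM('a) * (1/p - 1) - 1)) * box_mean r v (rbox t x) t \<partial>lborel) \<partial>lborel)
        \<le> ennreal C * T_fun p q r v"
proof -
  define d where "d = real DIM('a)"
  have d: "0 < d" by (simp add: d_def)
  obtain K where K: "0 < K" "\<And>(v :: real \<times> 'a \<Rightarrow> ennreal) t x x'. v \<in> borel_measurable borel \<Longrightarrow> 0 < t \<Longrightarrow> dist x x' \<le> t/2 \<Longrightarrow>
    box_mean r v (rbox t x) t \<le> ennreal K * epow (T_inner q r v x') (1/q)"
    using box_mean_le_T_inner[OF r q] by metis
  define L where "L = K * (unit_ball_vol d * (1/2) ^ DIM('a)) powr (-1/p)"
  have "0 < unit_ball_vol d * (1/2) ^ DIM('a)" by (simp add: d_def)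
  then have L: "0 < L" unfolding L_def using K(1) by (intro mult_pos_pos) auto
  define C where "C = (1 / (d * (1/p - 1)) + 1/d) * (L powr (1 - p) * K powr p)"
  have "0 < d * (1/p - 1)" using d p by (simp add: field_simps)
  then have C0: "0 < 1 / (d * (1/p - 1)) + 1/d" using d by (simp add: add_pos_pos)
  have C: "0 < C" unfolding C_def using K L by (intro mult_pos_pos C0) auto
  have main: "(\<integral>\<^sup>+x. (\<integral>\<^sup>+t\<in>{0<..}. ennreal (t powr (d * (1/p - 1) - 1)) * box_mean r v (rbox t x) t \<partial>lborel) \<partial>lborel)
        \<le> ennreal C * T_fun p q r v" (is "?I \<le> _")
    if [measurable]: "v \<in> borel_measurable borel" for v :: "real \<times> 'a \<Rightarrow> ennreal"
  proof -
    define N where "N = T_fun p q r v"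
    have bound: "box_mean r v (rbox t x) t \<le> ennreal L * N * ennreal (t powr (- d / p))" if "0 < t" for t x
      using box_mean_le_T_fun[OF \<open>v \<in> _\<close> K(1) K(2)[OF \<open>v \<in> _\<close>] p(1) q that, of x]
      unfolding N_def L_def d_def by simp
    consider "N = 0" | "N = top" | "0 < N" "N < top"
      using top.not_eq_extremum not_gr_zero by metis
    then show ?thesis
    proof cases
      case 1
      have "?I = (\<integral>\<^sup>+(x::'a). \<integral>\<^sup>+(t::real). 0 \<partial>lborel \<partial>lborel)"
        using bound 1 by (intro nn_integral_cong) (auto simp: indicator_def)
      then show ?thesis by simp
    next
      case 2
      then show ?thesis using C by (simp add: N_def ennreal_mult_top)
    next
      case 3
      have "?I \<le> (\<integral>\<^sup>+x. ennreal C * (epow N (1 - p) * epow (T_inner q r v x) (p / q)) \<partial>lborel)"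
      proof (intro nn_integral_mono)
        fix x
        have "(\<integral>\<^sup>+t\<in>{0<..}. ennreal (t powr (d * (1/p - 1) - 1)) * box_mean r v (rbox t x) t \<partial>lborel)
          \<le> ennreal (1 / (d * (1/p - 1)) + 1/d) * (epow (ennreal L * N) (1 - p) * epow (ennreal K * epow (T_inner q r v x) (1/q)) p)"
        proof (rule nn_integral_power_split[OF d p])
          show "0 < ennreal L * N" "ennreal L * N < top"
            using L 3 by (auto simp: ennreal_zero_less_mult_iff ennreal_mult_less_top)
        qed (use K(2) bound in auto)
        also have "\<dots> = ennreal C * (epow N (1 - p) * epow (T_inner q r v x) (p / q))"
          using p K L C0 by (simp add: epow_mult epow_epow epow_ennreal C_def ennreal_mult mult_ac)
        finally show "(\<integral>\<^sup>+t\<in>{0<..}. ennreal (t powr (d * (1/p - 1) - 1)) * box_mean r v (rbox t x) t \<partial>lborel)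
          \<le> ennreal C * (epow N (1 - p) * epow (T_inner q r v x) (p / q))" .
      qed
      also have "\<dots> = ennreal C * (epow N (1 - p) * epow N p)"
        using p by (simp add: nn_integral_cmult N_def T_fun_def epow_epow)
      also have "\<dots> = ennreal C * N"
        using 3 by (simp add: epow_add_exponents)
      finally show ?thesis unfolding N_def .
    qed
  qed
  show thesis
    by (rule that[OF C]) (use main in \<open>simp add: d_def\<close>)
qed

section \<open>The pairing inequality\<close>

lemma ennreal_mult_divide_cancel: "0 < c \<Longrightarrow> ennreal c * (x / ennreal c) = x"
proof -
  assume "0 < c"
  then have "ennreal c * ennreal (1 / c) = 1" by (simp flip: ennreal_mult)
  then show ?thesis using \<open>0 < c\<close> by (simp only: ennreal_divide_eq mult.left_commute[of _ x] mult_1_right)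
qed

text \<open>By Tonelli's theorem it suffices that, for each point \<open>z\<close>, the weights of
  the boxes containing \<open>z\<close> integrate to at least \<open>1 / (K * fst z)\<close>. The
  parameters of such boxes fill a volume of order \<open>fst z powr (d + 1)\<close>, which explains
  the exponent \<open>-d-2\<close>.\<close>

lemma nn_integral_box_average:
  fixes h :: "real \<times> 'a::euclidean_space \<Rightarrow> ennreal"
  assumes [measurable]: "h \<in> borel_measurable borel"
  defines "d \<equiv> real DIM('a)"
  defines "K \<equiv> 1 / (unit_ball_vol d * (3/2) powr (-d-2) * (1/2) powr (d + 1))"
  shows "(\<integral>\<^sup>+z\<in>half_space. (h z / ennreal (fst z)) \<partial>lborel) \<le>
    ennreal K * (\<integral>\<^sup>+x. (\<integral>\<^sup>+t\<in>{0<..}. (ennreal (t powr (-d-2)) * (\<integral>\<^sup>+z\<in>rbox t x. h z \<partial>lborel)) \<partial>lborel) \<partial>lborel)"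
proof -
  have d: "0 < d" by (simp add: d_def)
  have \<omega>: "0 < unit_ball_vol d" by (simp add: d_def)
  then have K: "0 < K" by (simp add: K_def)
  let ?k = "\<lambda>t x z. ennreal (t powr (-d-2)) * indicator (rbox t x) z * indicator {0<..} t"
  \<comment> \<open>All \<open>(t, x)\<close> with \<open>s <= t < 3/2 * s\<close> and
    \<open>dist y x < s/2\<close> put \<open>(s, y)\<close> into \<open>rbox t x\<close>. The lower
    bound \<open>(3/2 * s) powr (-d-2)\<close> of the weight there, times the volume of these
    parameters, is \<open>1 / (K * s)\<close>; this is the origin of \<open>K\<close>.\<close>
  have lower: "ennreal (1 / fst z) \<le> ennreal K * (\<integral>\<^sup>+x. \<integral>\<^sup>+t. ?k t x z \<partial>lborel \<partial>lborel)"
    if s: "0 < fst z" for z :: "real \<times> 'a"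
  proof -
    obtain s y where z: "z = (s, y)" "0 < s" using s by (cases z) auto
    have "(\<integral>\<^sup>+x. ennreal ((3/2 * s) powr (-d-2) * (s/2)) * indicator (ball y (s/2)) x \<partial>lborel)
      \<le> (\<integral>\<^sup>+x. \<integral>\<^sup>+t. ?k t x z \<partial>lborel \<partial>lborel)"
    proof (intro nn_integral_mono)
      fix x
      have "ennreal ((3/2 * s) powr (-d-2) * (s/2)) \<le> (\<integral>\<^sup>+t. ?k t x z \<partial>lborel)" if "dist y x < s/2"
      proof -
        have "ennreal ((3/2 * s) powr (-d-2) * (s/2)) = ennreal ((3/2 * s) powr (-d-2)) * ennreal (3/2 * s - s)"
        proof -
          have e: "3/2 * s - s = s/2" by simp
          show ?thesis unfolding e using z by (intro ennreal_mult) auto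
        qed
        also have "\<dots> = (\<integral>\<^sup>+t. ennreal ((3/2 * s) powr (-d-2)) * indicator {s..<3/2 * s} t \<partial>lborel)"
          using z by (simp add: nn_integral_cmult)
        also have "\<dots> \<le> (\<integral>\<^sup>+t. ?k t x z \<partial>lborel)"
        proof (intro nn_integral_mono)
          fix t
          show "ennreal ((3/2 * s) powr (-d-2)) * indicator {s..<3/2 * s} t \<le> ?k t x z"
          proof (cases "t \<in> {s..<3/2 * s}")
            case True
            then have "z \<in> rbox t x" using z that by (auto simp: rbox_def dist_commute)
            moreover have "(3/2 * s) powr (-d-2) \<le> t powr (-d-2)"
              using True z d by (intro powr_mono2') auto
            ultimately show ?thesis using True z by (auto intro!: ennreal_leI)
          qed auto
        qed
        finally show ?thesis .
      qed
      then show "ennreal ((3/2 * s) powr (-d-2) * (s/2)) * indicator (ball y (s/2)) x \<le> (\<integral>\<^sup>+t. ?k t x z \<partial>lborel)"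
        by (auto simp: indicator_def)
    qed
    also have "(\<integral>\<^sup>+x. ennreal ((3/2 * s) powr (-d-2) * (s/2)) * indicator (ball y (s/2)) x \<partial>lborel)
      = ennreal ((3/2 * s) powr (-d-2) * (s/2)) * ennreal (unit_ball_vol d * (s/2) ^ DIM('a))"
      using z emeasure_ball[of "s/2" y] by (simp add: nn_integral_cmult_indicator d_def)
    also have "\<dots> = ennreal ((1/K) * (1/s))"
    proof -
      have e1: "(s/2) ^ DIM('a) = (s/2) powr d" using z by (simp add: powr_realpow d_def)
      have e2: "(3/2 * s) powr (-d-2) = (3/2) powr (-d-2) * s powr (-d-2)"
        by (rule powr_mult)
      have "((3/2 * s) powr (-d-2) * (s/2)) * (unit_ball_vol d * (s/2) ^ DIM('a)) =
        (unit_ball_vol d * (3/2) powr (-d-2)) * s powr (-d-2) * ((s/2) powr d * (s/2) powr 1)"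
        unfolding e1 e2 using z by simp
      also have "(s/2) powr d * (s/2) powr 1 = (1/2) powr (d + 1) * s powr (d+1)"
        by (simp only: powr_add[symmetric] powr_mult[symmetric]) simp
      also have "(unit_ball_vol d * (3/2) powr (-d-2)) * s powr (-d-2) * ((1/2) powr (d + 1) * s powr (d+1)) =
        (unit_ball_vol d * (3/2) powr (-d-2) * (1/2) powr (d + 1)) * (s powr (-d-2) * s powr (d + 1))"
        by (simp only: mult_ac)
      also have "s powr (-d-2) * s powr (d + 1) = s powr (-1)"
        by (simp flip: powr_add)
      also have "\<dots> = 1/s" using z by (simp add: powr_minus inverse_eq_divide)
      finally have "((3/2 * s) powr (-d-2) * (s/2)) * (unit_ball_vol d * (s/2) ^ DIM('a)) = (1/K) * (1/s)"
        by (simp only: K_def) simp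
      then show ?thesis using z \<omega> by (simp flip: ennreal_mult)
    qed
    finally have "ennreal K * ennreal ((1/K) * (1/s)) \<le> ennreal K * (\<integral>\<^sup>+x. \<integral>\<^sup>+t. ?k t x z \<partial>lborel \<partial>lborel)"
      by (intro mult_left_mono) auto
    moreover have "ennreal K * ennreal ((1/K) * (1/s)) = ennreal (1 / s)"
      using K z by (simp flip: ennreal_mult)
    ultimately show ?thesis using z by simp
  qed
  have pr: "Measurable.pred (borel \<Otimes>\<^sub>M borel) (\<lambda>w :: (real \<times> 'a) \<times> (real \<times> 'a). snd w \<in> rbox (fst (fst w)) (snd (fst w)))"
    by (rule pred_rbox)
  have ind: "(\<lambda>w. indicator (rbox (fst (fst w)) (snd (fst w))) (snd w) :: ennreal) \<in>
      borel_measurable (borel :: ((real \<times> 'a) \<times> (real \<times> 'a)) measure)"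
  proof -
    have "(\<lambda>w :: (real \<times> 'a) \<times> (real \<times> 'a). indicator (rbox (fst (fst w)) (snd (fst w))) (snd w) :: ennreal) =
      (\<lambda>w. if snd w \<in> rbox (fst (fst w)) (snd (fst w)) then 1 else 0)"
      by (auto simp: fun_eq_iff indicator_def)
    also have "\<dots> \<in> borel_measurable (borel \<Otimes>\<^sub>M borel)"
      using pr by measurable
    finally show ?thesis by (simp add: borel_prod)
  qed
  have ind_comp: "(\<lambda>w. indicator (rbox (a w) (b w)) (c w) :: ennreal) \<in> borel_measurable M"
    if [measurable]: "a \<in> borel_measurable M" "b \<in> borel_measurable M" "c \<in> borel_measurable M" for a and b :: "_ \<Rightarrow> 'a" and c M
  proof -
    have "(\<lambda>w. ((a w, b w), c w)) \<in> M \<rightarrow>\<^sub>M borel" by measurable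
    from measurable_compose[OF this ind] show ?thesis by simp
  qed
  note [measurable] = ind_comp
  have "(\<integral>\<^sup>+z\<in>half_space. (h z / ennreal (fst z)) \<partial>lborel) \<le>
    (\<integral>\<^sup>+z. h z * (ennreal K * (\<integral>\<^sup>+x. \<integral>\<^sup>+t. ?k t x z \<partial>lborel \<partial>lborel)) \<partial>lborel)"
  proof (intro nn_integral_mono)
    fix z :: "real \<times> 'a"
    show "h z / ennreal (fst z) * indicator half_space z \<le> h z * (ennreal K * (\<integral>\<^sup>+x. \<integral>\<^sup>+t. ?k t x z \<partial>lborel \<partial>lborel))"
    proof (cases "0 < fst z")
      case True
      then show ?thesis using mult_left_mono[OF lower[OF True], of "h z"]
        by (simp add: ennreal_divide_eq)
    qed auto
  qed
  also have "\<dots> = ennreal K * (\<integral>\<^sup>+z. \<integral>\<^sup>+x. \<integral>\<^sup>+t. h z * ?k t x z \<partial>lborel \<partial>lborel \<partial>lborel)"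
  proof -
    have "(\<integral>\<^sup>+x. \<integral>\<^sup>+t. h z * ?k t x z \<partial>lborel \<partial>lborel) = h z * (\<integral>\<^sup>+x. \<integral>\<^sup>+t. ?k t x z \<partial>lborel \<partial>lborel)" for z
      by (subst nn_integral_cmult; (subst nn_integral_cmult)?) measurable
    then show ?thesis
      by (subst nn_integral_cmult[symmetric]) (auto simp: mult_ac)
  qed
  also have "(\<integral>\<^sup>+z. \<integral>\<^sup>+x. \<integral>\<^sup>+t. h z * ?k t x z \<partial>lborel \<partial>lborel \<partial>lborel) =
    (\<integral>\<^sup>+x. \<integral>\<^sup>+z. \<integral>\<^sup>+t. h z * ?k t x z \<partial>lborel \<partial>lborel \<partial>lborel)"
    by (rule lborel_pair.Fubini') measurable
  also have "\<dots> = (\<integral>\<^sup>+x. \<integral>\<^sup>+t. \<integral>\<^sup>+z. h z * ?k t x z \<partial>lborel \<partial>lborel \<partial>lborel)"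
    by (intro nn_integral_cong lborel_pair.Fubini') measurable
  also have "\<dots> = (\<integral>\<^sup>+x. (\<integral>\<^sup>+t\<in>{0<..}. (ennreal (t powr (-d-2)) * (\<integral>\<^sup>+z\<in>rbox t x. h z \<partial>lborel)) \<partial>lborel) \<partial>lborel)"
  proof (intro nn_integral_cong)
    fix x :: 'a and t :: real
    have "(\<integral>\<^sup>+z. h z * ?k t x z \<partial>lborel) = (\<integral>\<^sup>+z. ennreal (t powr (-d-2)) * indicator {0<..} t * (h z * indicator (rbox t x) z) \<partial>lborel)"
      by (simp add: mult_ac)
    also have "\<dots> = ennreal (t powr (-d-2)) * indicator {0<..} t * (\<integral>\<^sup>+z\<in>rbox t x. h z \<partial>lborel)"
      by (rule nn_integral_cmult) measurable
    finally show "(\<integral>\<^sup>+z. h z * ?k t x z \<partial>lborel) = ennreal (t powr (-d-2)) * (\<integral>\<^sup>+z\<in>rbox t x. h z \<partial>lborel) * indicator {0<..} t"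
      by (simp add: mult_ac)
  qed
  finally show ?thesis .
qed


text \<open>Normalising the two integrals brings out the volume to the powers \<open>1 - 1/r\<close>
  and \<open>1/r\<close>, which recombine to the volume itself.\<close>

lemma box_mean_Hoelder:
  fixes u v :: "real \<times> 'a::euclidean_space \<Rightarrow> ennreal"
  assumes [measurable]: "u \<in> borel_measurable borel" "v \<in> borel_measurable borel" "A \<in> sets borel"
    and r: "1 < r" and t: "0 < t"
  shows "(\<integral>\<^sup>+z\<in>A. (u z * v z) \<partial>lborel) \<le>
    ennreal (wvol TYPE('a) t) * (box_mean (r / (r - 1)) u A t * box_mean r v A t)"
proof -
  have w: "0 < wvol TYPE('a) t" using t by (rule wvol_pos)
  have *: "epow I a = ennreal (wvol TYPE('a) t powr a) * epow (I / ennreal (wvol TYPE('a) t)) a"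
    if "0 < a" for I a
  proof -
    have "I = ennreal (wvol TYPE('a) t) * (I / ennreal (wvol TYPE('a) t))"
      using w by (rule ennreal_mult_divide_cancel[symmetric])
    then have "epow I a = epow (ennreal (wvol TYPE('a) t) * (I / ennreal (wvol TYPE('a) t))) a"
      by (rule arg_cong)
    then show ?thesis using that w by (simp only: epow_mult epow_ennreal less_imp_le)
  qed
  have ind: "epow (x * indicator A z) a = epow x a * indicator A z" for x z a
    by (auto simp: indicator_def)
  have "(\<integral>\<^sup>+z\<in>A. (u z * v z) \<partial>lborel) = (\<integral>\<^sup>+z. (u z * indicator A z) * (v z * indicator A z) \<partial>lborel)"
    by (intro nn_integral_cong) (auto simp: indicator_def)
  also have "\<dots> \<le> epow (\<integral>\<^sup>+z\<in>A. epow (u z) (r / (r - 1)) \<partial>lborel) (1 - 1/r) * epow (\<integral>\<^sup>+z\<in>A. epow (v z) r \<partial>lborel) (1/r)"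
    using nn_integral_Hoelder[OF r, of "\<lambda>z. u z * indicator A z" lborel "\<lambda>z. v z * indicator A z"]
    by (simp add: ind)
  also have "\<dots> = (ennreal (wvol TYPE('a) t powr (1 - 1/r)) * box_mean (r / (r - 1)) u A t) *
    (ennreal (wvol TYPE('a) t powr (1/r)) * box_mean r v A t)"
  proof -
    have e: "1 / (r / (r - 1)) = 1 - 1/r" "0 < 1 - 1/r" "0 < 1/r" using r by (auto simp: field_simps)
    show ?thesis
      unfolding box_mean_def e(1) by (subst *[OF e(2)], subst *[OF e(3)]) (rule refl)
  qed
  also have "\<dots> = (ennreal (wvol TYPE('a) t powr (1 - 1/r)) * ennreal (wvol TYPE('a) t powr (1/r))) *
    (box_mean (r / (r - 1)) u A t * box_mean r v A t)"
    by (simp only: mult_ac)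
  also have "ennreal (wvol TYPE('a) t powr (1 - 1/r)) * ennreal (wvol TYPE('a) t powr (1/r)) = ennreal (wvol TYPE('a) t)"
    using w by (simp flip: ennreal_mult powr_add)
  finally show ?thesis .
qed

text \<open>A nonempty open set is not negligible, so an almost everywhere property cannot fail on
  all of it.\<close>

lemma AE_lborel_obtain_open:
  fixes S :: "'a::euclidean_space set"
  assumes "AE x in lborel. P x" "open S" "S \<noteq> {}"
  obtains x where "x \<in> S" "P x"
proof (rule ccontr)
  assume "\<not> thesis"
  then have "AE x in lebesgue. x \<notin> S"
    using assms(1) that unfolding AE_completion_iff by (auto elim: eventually_mono)
  then have "negligible S"
    using \<open>open S\<close> by (simp add: negligible_iff_null_sets AE_iff_null_sets)
  then show False using assms open_not_negligible by blast
qed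

lemma Z_norm_AE:
  "AE t in lborel. 0 < t \<longrightarrow> (AE x in lborel. W_avg r \<gamma> f t x \<le> Z_norm r \<gamma> f)"
proof -
  have "AE t in lebesgue_on {0<..}. esssup lebesgue (\<lambda>x. W_avg r \<gamma> f t x) \<le> Z_norm r \<gamma> f"
    unfolding Z_norm_def by (rule esssup_AE)
  then have "AE t in lborel. 0 < t \<longrightarrow> esssup lebesgue (\<lambda>x. W_avg r \<gamma> f t x) \<le> Z_norm r \<gamma> f"
    by (subst (asm) AE_restrict_space_iff) (auto simp: AE_completion_iff)
  then show ?thesis
  proof eventually_elim
    case (elim t)
    show ?case
    proof
      assume "0 < t"
      have "AE x in lborel. W_avg r \<gamma> f t x \<le> esssup lebesgue (\<lambda>x. W_avg r \<gamma> f t x)"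
        using esssup_AE[where M=lebesgue and f="\<lambda>x. W_avg r \<gamma> f t x"] by (simp add: AE_completion_iff)
      then show "AE x in lborel. W_avg r \<gamma> f t x \<le> Z_norm r \<gamma> f"
        by (rule eventually_mono) (use elim \<open>0 < t\<close> in auto)
    qed
  qed
qed

lemma Z_norm_obtain:
  fixes x :: "'a::euclidean_space"
  assumes "0 < t"
  obtains t' x' where "t < t'" "t' < 4/3 * t" "dist x x' < t/2" "W_avg r \<gamma> f t' x' \<le> Z_norm r \<gamma> f"
proof -
  obtain t' where t': "t' \<in> {t<..<4/3 * t}" "0 < t' \<longrightarrow> (AE x in lborel. W_avg r \<gamma> f t' x \<le> Z_norm r \<gamma> f)"
    by (rule AE_lborel_obtain_open[OF Z_norm_AE, of "{t<..<4/3 * t}"]) (use assms in auto)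
  then have "AE x in lborel. W_avg r \<gamma> f t' x \<le> Z_norm r \<gamma> f" using assms by auto
  then obtain x' where "x' \<in> ball x (t/2)" "W_avg r \<gamma> f t' x' \<le> Z_norm r \<gamma> f"
    by (rule AE_lborel_obtain_open[of _ "ball x (t/2)"]) (use assms in auto)
  then show thesis using t' by (intro that[of t' x']) auto
qed

text \<open>Each small box is placed inside one full box on which \<open>Z_norm\<close> is a bound.
  For \<open>r = 1\<close> that bound is pointwise almost everywhere; otherwise Hoelder's inequality
  is used, and \<open>K\<close> pays for the change of box.\<close>

lemma rbox_pairing_le:
  assumes r: "1 \<le> r"
  obtains K where "0 < K"
    "\<And>(f :: real \<times> 'a::euclidean_space \<Rightarrow> complex) (v :: real \<times> 'a \<Rightarrow> ennreal) \<gamma> t x.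
      f \<in> borel_measurable borel \<Longrightarrow> v \<in> borel_measurable borel \<Longrightarrow> 0 < t \<Longrightarrow>
      (\<integral>\<^sup>+z\<in>rbox t x. (weighted \<gamma> f z * v z) \<partial>lborel) \<le>
        ennreal (K * wvol TYPE('a) t) * (Z_norm (conj_exponent r) \<gamma> f * box_mean r v (rbox t x) t)"
proof (cases "r = 1")
  case True
  have "(\<integral>\<^sup>+z\<in>rbox t x. (weighted \<gamma> f z * v z) \<partial>lborel) \<le>
        ennreal (1 * wvol TYPE('a) t) * (Z_norm (conj_exponent r) \<gamma> f * box_mean r v (rbox t x) t)"
    if [measurable]: "f \<in> borel_measurable borel" "v \<in> borel_measurable borel" and t: "0 < t"
    for f :: "real \<times> 'a \<Rightarrow> complex" and v :: "real \<times> 'a \<Rightarrow> ennreal" and \<gamma> t x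
  proof -
    define Z where "Z = Z_norm (conj_exponent r) \<gamma> f"
    obtain t' x' where tx: "t < t'" "t' < 4/3 * t" "dist x x' < t/2" "W_avg \<infinity> \<gamma> f t' x' \<le> Z"
      using Z_norm_obtain[OF t, of x "conj_exponent r" \<gamma> f] True unfolding Z_def conj_exponent_def by auto
    have ae: "AE z in lborel. z \<in> wbox t' x' \<longrightarrow> weighted \<gamma> f z \<le> Z"
      using tx t W_avg_top_le_iff[OF borel_measurable_hs[OF that(1)], of t' \<gamma> x' Z] by simp
    have sub: "rbox t x \<subseteq> wbox t' x'" using tx t by (intro rbox_subset_wbox) auto
    have "(\<integral>\<^sup>+z\<in>rbox t x. (weighted \<gamma> f z * v z) \<partial>lborel) \<le> (\<integral>\<^sup>+z. Z * (v z * indicator (rbox t x) z) \<partial>lborel)"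
    proof (rule nn_integral_mono_AE)
      show "AE z in lborel. weighted \<gamma> f z * v z * indicator (rbox t x) z \<le> Z * (v z * indicator (rbox t x) z)"
        using ae by eventually_elim (use sub in \<open>auto simp: indicator_def mult_right_mono\<close>)
    qed
    also have "\<dots> = Z * (\<integral>\<^sup>+z\<in>rbox t x. v z \<partial>lborel)"
      by (rule nn_integral_cmult) measurable
    also have "(\<integral>\<^sup>+z\<in>rbox t x. v z \<partial>lborel) = ennreal (wvol TYPE('a) t) * box_mean r v (rbox t x) t"
      using True ennreal_mult_divide_cancel[OF wvol_pos[OF t, where 'a='a]]
      by (simp add: box_mean_def del: ennreal_times_divide)
    finally show ?thesis unfolding Z_def by (simp add: mult_ac)
  qed
  then show thesis by (intro that[of 1]) auto
next
  case False
  then have r: "1 < r" using r by simp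
  define r' where "r' = r / (r - 1)"
  have r': "0 < r'" using r by (simp add: r'_def)
  define K where "K = ((4/3) powr (real DIM('a) + 1)) powr (1/r')"
  have "(\<integral>\<^sup>+z\<in>rbox t x. (weighted \<gamma> f z * v z) \<partial>lborel) \<le>
        ennreal (K * wvol TYPE('a) t) * (Z_norm (conj_exponent r) \<gamma> f * box_mean r v (rbox t x) t)"
    if [measurable]: "f \<in> borel_measurable borel" "v \<in> borel_measurable borel" and t: "0 < t"
    for f :: "real \<times> 'a \<Rightarrow> complex" and v :: "real \<times> 'a \<Rightarrow> ennreal" and \<gamma> t x
  proof -
    define Z where "Z = Z_norm (conj_exponent r) \<gamma> f"
    obtain t' x' where tx: "t < t'" "t' < 4/3 * t" "dist x x' < t/2" "W_avg (ennreal r') \<gamma> f t' x' \<le> Z"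
      using Z_norm_obtain[OF t, of x "conj_exponent r" \<gamma> f] r unfolding Z_def conj_exponent_def r'_def by auto
    have "box_mean r' (weighted \<gamma> f) (rbox t x) t \<le> ennreal K * box_mean r' (weighted \<gamma> f) (wbox t' x') t'"
      unfolding K_def using tx t r' by (intro box_mean_rbox_le) auto
    also have "\<dots> \<le> ennreal K * Z"
      using tx(4) W_avg_eq[OF that(1) _ r', of t' \<gamma> x'] tx t by (intro mult_left_mono) auto
    finally have 1: "box_mean r' (weighted \<gamma> f) (rbox t x) t \<le> ennreal K * Z" .
    have "(\<integral>\<^sup>+z\<in>rbox t x. (weighted \<gamma> f z * v z) \<partial>lborel) \<le>
      ennreal (wvol TYPE('a) t) * (box_mean r' (weighted \<gamma> f) (rbox t x) t * box_mean r v (rbox t x) t)"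
      unfolding r'_def by (rule box_mean_Hoelder) (use r t in auto)
    also have "\<dots> \<le> ennreal (wvol TYPE('a) t) * ((ennreal K * Z) * box_mean r v (rbox t x) t)"
      by (intro mult_left_mono mult_right_mono 1) auto
    also have "\<dots> = ennreal (K * wvol TYPE('a) t) * (Z * box_mean r v (rbox t x) t)"
      using wvol_pos[OF t, where 'a='a] by (simp add: K_def ennreal_mult mult_ac)
    finally show ?thesis unfolding Z_def .
  qed
  then show thesis by (intro that[of K]) (auto simp: K_def)
qed

lemma pairing_bound_borel:
  assumes p: "0 < p" "p < 1" and q: "0 < q" and r: "1 \<le> r"
  obtains C where "0 < C"
    "\<And>f g :: real \<times> 'a::euclidean_space \<Rightarrow> complex. f \<in> borel_measurable borel \<Longrightarrow> g \<in> borel_measurable borel \<Longrightarrow>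
      (\<integral>\<^sup>+z\<in>half_space. (ennreal (cmod (f z) * cmod (g z)) / ennreal (fst z)) \<partial>lborel)
        \<le> ennreal C * Z_norm (conj_exponent r) (- \<beta> + real DIM('a) * (1 / p - 1)) f * T_norm p q r \<beta> g"
proof -
  define d where "d = real DIM('a)"
  define \<alpha> where "\<alpha> = d * (1/p - 1)"
  define \<gamma> where "\<gamma> = - \<beta> + \<alpha>"
  have \<alpha>: "0 < \<alpha>" using p by (simp add: \<alpha>_def d_def field_simps)
  obtain K1 where K1: "0 < K1"
    "\<And>(f :: real \<times> 'a \<Rightarrow> complex) (v :: real \<times> 'a \<Rightarrow> ennreal) \<gamma> t x.
      f \<in> borel_measurable borel \<Longrightarrow> v \<in> borel_measurable borel \<Longrightarrow> 0 < t \<Longrightarrow>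
      (\<integral>\<^sup>+z\<in>rbox t x. (weighted \<gamma> f z * v z) \<partial>lborel) \<le>
        ennreal (K1 * wvol TYPE('a) t) * (Z_norm (conj_exponent r) \<gamma> f * box_mean r v (rbox t x) t)"
    by (rule rbox_pairing_le[OF r, where 'a='a]) (erule that, blast)
  have r0: "0 < r" using r by simp
  obtain K2 where K2: "0 < K2"
    "\<And>v :: real \<times> 'a \<Rightarrow> ennreal. v \<in> borel_measurable borel \<Longrightarrow>
      (\<integral>\<^sup>+x. (\<integral>\<^sup>+t\<in>{0<..}. ennreal (t powr (real DIM('a) * (1/p - 1) - 1)) * box_mean r v (rbox t x) t \<partial>lborel) \<partial>lborel)
        \<le> ennreal K2 * T_fun p q r v"
    by (rule T_fun_embedding[OF p q r0, where 'a='a]) (erule that, blast)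
  define K3 where "K3 = 1 / (unit_ball_vol d * (3/2) powr (-d-2) * (1/2) powr (d + 1))"
  have \<omega>: "0 < unit_ball_vol d" by (simp add: d_def)
  then have K3: "0 < K3" by (simp add: K3_def)
  define L where "L = K1 * (unit_ball_vol d / 2)"
  have L: "0 < L" using K1 \<omega> by (simp add: L_def)
  show thesis
  proof
    show "0 < K3 * L * K2" using K1 K2 K3 L by simp
    fix f g :: "real \<times> 'a \<Rightarrow> complex"
    assume [measurable]: "f \<in> borel_measurable borel" "g \<in> borel_measurable borel"
    define h where "h z = ennreal (cmod (f z) * cmod (g z))" for z
    have [measurable]: "h \<in> borel_measurable borel" unfolding h_def by measurable
    define Z where "Z = Z_norm (conj_exponent r) \<gamma> f"
    let ?v = "weighted \<beta> g"
    \<comment> \<open>The weights of \<open>f\<close> and \<open>g\<close> multiply to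
      \<open>fst z powr (-\<alpha>)\<close>. Since \<alpha> is positive, the compensating factor
      \<open>fst z powr \<alpha>\<close> may be replaced by \<open>t powr \<alpha>\<close> on the
      box.\<close>
    have h: "(\<integral>\<^sup>+z\<in>rbox t x. h z \<partial>lborel) \<le> ennreal (t powr \<alpha> * (K1 * wvol TYPE('a) t)) * (Z * box_mean r ?v (rbox t x) t)"
      if t: "0 < t" for t x
    proof -
      have "(\<integral>\<^sup>+z\<in>rbox t x. h z \<partial>lborel) \<le> (\<integral>\<^sup>+z. ennreal (t powr \<alpha>) * (weighted \<gamma> f z * ?v z * indicator (rbox t x) z) \<partial>lborel)"
      proof (intro nn_integral_mono)
        fix z
        have "h z \<le> ennreal (t powr \<alpha>) * (weighted \<gamma> f z * ?v z)" if "z \<in> rbox t x"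
        proof -
          have s: "0 < fst z" "fst z \<le> t" using that t by (auto simp: rbox_def)
          have "cmod (f z) * cmod (g z) = fst z powr \<alpha> * ((fst z powr (-\<gamma>) * cmod (f z)) * (fst z powr (-\<beta>) * cmod (g z)))"
          proof -
            have "fst z powr \<alpha> * (fst z powr (-\<gamma>) * fst z powr (-\<beta>)) = 1"
              using s by (simp add: \<gamma>_def flip: powr_add)
            then show ?thesis by (simp add: mult_ac)
          qed
          also have "\<dots> \<le> t powr \<alpha> * ((fst z powr (-\<gamma>) * cmod (f z)) * (fst z powr (-\<beta>) * cmod (g z)))"
            using s \<alpha> by (intro mult_right_mono powr_mono2) auto
          finally show ?thesis
            unfolding h_def weighted_def by (simp add: ennreal_leI flip: ennreal_mult)
        qed
        then show "h z * indicator (rbox t x) z \<le> ennreal (t powr \<alpha>) * (weighted \<gamma> f z * ?v z * indicator (rbox t x) z)"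
          by (auto simp: indicator_def)
      qed
      also have "\<dots> = ennreal (t powr \<alpha>) * (\<integral>\<^sup>+z\<in>rbox t x. (weighted \<gamma> f z * ?v z) \<partial>lborel)"
        by (rule nn_integral_cmult) measurable
      also have "\<dots> \<le> ennreal (t powr \<alpha>) * (ennreal (K1 * wvol TYPE('a) t) * (Z * box_mean r ?v (rbox t x) t))"
        unfolding Z_def by (intro mult_left_mono K1 t) auto
      finally show ?thesis using K1 wvol_pos[OF t, where 'a='a] by (simp add: ennreal_mult mult_ac)
    qed
    \<comment> \<open>The three powers come from the averaging over boxes, the weights, and the
      volume of the box. Together they give exactly the weight in
      \<open>T_fun_embedding\<close>.\<close>
    have pw: "t powr (-d-2) * (t powr \<alpha> * (K1 * wvol TYPE('a) t)) = L * t powr (\<alpha> - 1)" if "0 < t" for t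
    proof -
      have "t powr (-d-2) * (t powr \<alpha> * (K1 * wvol TYPE('a) t)) = L * (t powr (-d-2) * (t powr \<alpha> * t powr (d + 1)))"
        by (simp add: L_def wvol_def d_def)
      also have "t powr (-d-2) * (t powr \<alpha> * t powr (d + 1)) = t powr (\<alpha> - 1)"
        by (simp flip: powr_add)
      finally show ?thesis .
    qed
    have "(\<integral>\<^sup>+z\<in>half_space. (h z / ennreal (fst z)) \<partial>lborel) \<le>
      ennreal K3 * (\<integral>\<^sup>+x. (\<integral>\<^sup>+t\<in>{0<..}. (ennreal (t powr (-d-2)) * (\<integral>\<^sup>+z\<in>rbox t x. h z \<partial>lborel)) \<partial>lborel) \<partial>lborel)"
      unfolding K3_def d_def by (rule nn_integral_box_average) measurable
    also have "\<dots> \<le> ennreal K3 * (\<integral>\<^sup>+x. (\<integral>\<^sup>+t. (ennreal L * Z) * (ennreal (t powr (\<alpha> - 1)) * box_mean r ?v (rbox t x) t * indicator {0<..} t) \<partial>lborel) \<partial>lborel)"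
    proof (intro mult_left_mono nn_integral_mono)
      fix x t
      have "ennreal (t powr (-d-2)) * (\<integral>\<^sup>+z\<in>rbox t x. h z \<partial>lborel) \<le>
        (ennreal L * Z) * (ennreal (t powr (\<alpha> - 1)) * box_mean r ?v (rbox t x) t)" if t: "0 < t"
      proof -
        have "ennreal (t powr (-d-2)) * (\<integral>\<^sup>+z\<in>rbox t x. h z \<partial>lborel) \<le>
          ennreal (t powr (-d-2)) * (ennreal (t powr \<alpha> * (K1 * wvol TYPE('a) t)) * (Z * box_mean r ?v (rbox t x) t))"
          by (intro mult_left_mono h t) auto
        also have "\<dots> = ennreal (t powr (-d-2) * (t powr \<alpha> * (K1 * wvol TYPE('a) t))) * (Z * box_mean r ?v (rbox t x) t)"
          using K1 wvol_pos[OF t, where 'a='a] by (subst ennreal_mult) (auto simp: mult.assoc)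
        also have "\<dots> = ennreal (L * t powr (\<alpha> - 1)) * (Z * box_mean r ?v (rbox t x) t)"
          by (simp only: pw[OF t])
        also have "\<dots> = (ennreal L * Z) * (ennreal (t powr (\<alpha> - 1)) * box_mean r ?v (rbox t x) t)"
          using L by (simp add: ennreal_mult mult_ac)
        finally show ?thesis .
      qed
      then show "ennreal (t powr (-d-2)) * (\<integral>\<^sup>+z\<in>rbox t x. h z \<partial>lborel) * indicator {0<..} t \<le>
        (ennreal L * Z) * (ennreal (t powr (\<alpha> - 1)) * box_mean r ?v (rbox t x) t * indicator {0<..} t)"
        by (auto simp: indicator_def)
    qed auto
    also have "\<dots> = ennreal K3 * ((ennreal L * Z) * (\<integral>\<^sup>+x. (\<integral>\<^sup>+t\<in>{0<..}. (ennreal (t powr (\<alpha> - 1)) * box_mean r ?v (rbox t x) t) \<partial>lborel) \<partial>lborel))"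
    proof -
      have "(\<lambda>w. (snd w, fst w)) \<in> borel \<Otimes>\<^sub>M lborel \<rightarrow>\<^sub>M (borel :: (real \<times> 'a) measure)"
        unfolding borel_prod[symmetric] by measurable
      from measurable_compose[OF this box_mean_rbox_measurable[of ?v r]]
      have [measurable]: "(\<lambda>w. box_mean r ?v (rbox (snd w) (fst w)) (snd w)) \<in> borel_measurable (borel \<Otimes>\<^sub>M lborel)"
        by simp
      have "(\<lambda>w. ennreal (snd w powr (\<alpha> - 1)) * box_mean r ?v (rbox (snd w) (fst w)) (snd w) * indicator {0<..} (snd w)) \<in> borel_measurable (borel \<Otimes>\<^sub>M lborel)"
        by measurable
      then have "(\<lambda>x. (\<integral>\<^sup>+t\<in>{0<..}. (ennreal (t powr (\<alpha> - 1)) * box_mean r ?v (rbox t x) t) \<partial>lborel)) \<in> borel_measurable lborel"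
        by (intro lborel.borel_measurable_nn_integral) (simp add: case_prod_unfold)
      then show ?thesis
        by (subst nn_integral_cmult[symmetric], simp)
           (intro arg_cong2[where f="(*)"] nn_integral_cong nn_integral_cmult refl, measurable)
    qed
    also have "\<dots> \<le> ennreal K3 * ((ennreal L * Z) * (ennreal K2 * T_fun p q r ?v))"
      using K2(2)[of ?v] unfolding \<alpha>_def d_def by (intro mult_left_mono) auto
    also have "\<dots> = ennreal (K3 * L * K2) * Z * T_norm p q r \<beta> g"
      using K1 K2 K3 L r0 by (simp add: T_norm_eq T_fun_def ennreal_mult mult_ac)
    finally show "(\<integral>\<^sup>+z\<in>half_space. (ennreal (cmod (f z) * cmod (g z)) / ennreal (fst z)) \<partial>lborel)
      \<le> ennreal (K3 * L * K2) * Z_norm (conj_exponent r) (- \<beta> + real DIM('a) * (1 / p - 1)) f * T_norm p q r \<beta> g"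
      unfolding h_def Z_def \<gamma>_def \<alpha>_def d_def .
  qed
qed

section \<open>Quasi-norm estimates in the tent space\<close>

lemma box_mean_mono:
  "(\<And>z. z \<in> A \<Longrightarrow> u z \<le> v z) \<Longrightarrow> 0 < r \<Longrightarrow> box_mean r u A t \<le> box_mean r v A t"
  unfolding box_mean_def
  by (intro epow_mono divide_right_mono_ennreal nn_integral_mono) (auto simp: indicator_def epow_mono)

text \<open>A box \<open>wbox t x\<close> meets the support only if \<open>a <= t <= 2 * b\<close>
  and \<open>x\<close> lies within \<open>\<rho> + 2 * b\<close> of \<open>x0\<close>. On these
  parameters the mean is at most the one normalised by the smallest volume, that of size
  \<open>a\<close>; the range of \<open>t\<close> contributes at most \<open>2 * b / a\<close> and
  the range of \<open>x\<close> the volume of a ball.\<close>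

lemma T_fun_box_le:
  fixes v :: "real \<times> 'a::euclidean_space \<Rightarrow> ennreal"
  assumes [measurable]: "v \<in> borel_measurable borel"
    and supp: "\<And>z. z \<notin> {a<..b} \<times> ball x0 \<rho> \<Longrightarrow> v z = 0"
    and a: "0 < a" "a \<le> b" and \<rho>: "0 \<le> \<rho>" and p: "0 < p" and q: "0 < q" and r: "0 < r"
  shows "T_fun p q r v \<le>
    ennreal ((2*b/a) powr (1/q) * (unit_ball_vol (real DIM('a)) * (\<rho> + 2*b) ^ DIM('a)) powr (1/p))
      * epow ((\<integral>\<^sup>+z. epow (v z) r \<partial>lborel) / ennreal (wvol TYPE('a) a)) (1/r)"
proof -
  define M where "M = epow ((\<integral>\<^sup>+z. epow (v z) r \<partial>lborel) / ennreal (wvol TYPE('a) a)) (1/r)"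
  define B where "B = ball x0 (\<rho> + 2*b)"
  define U where "U = unit_ball_vol (real DIM('a)) * (\<rho> + 2*b) ^ DIM('a)"
  have U: "0 \<le> U" using a \<rho> by (simp add: U_def)
  define k where "k = 2*b/a"
  have k: "0 < k" using a by (simp add: k_def)
  have bm: "box_mean r v (wbox t x) t \<le> M * indicator {a..2*b} t * indicator B x" if t: "0 < t" for t x
  proof (cases "t \<in> {a..2*b} \<and> x \<in> B")
    case True
    have "box_mean r v (wbox t x) t \<le> M"
      unfolding box_mean_def M_def
    proof (intro epow_mono)
      have "(\<integral>\<^sup>+z\<in>wbox t x. epow (v z) r \<partial>lborel) / ennreal (wvol TYPE('a) t) \<le>
        (\<integral>\<^sup>+z. epow (v z) r \<partial>lborel) / ennreal (wvol TYPE('a) t)"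
        by (intro divide_right_mono_ennreal nn_integral_mono) (auto simp: indicator_def)
      also have "\<dots> \<le> (\<integral>\<^sup>+z. epow (v z) r \<partial>lborel) / ennreal (wvol TYPE('a) a)"
      proof -
        have "1 / wvol TYPE('a) t \<le> 1 / wvol TYPE('a) a"
          using a True wvol_mono[of a t, where 'a='a] wvol_pos[of a, where 'a='a]
          by (intro divide_left_mono mult_pos_pos wvol_pos) auto
        then show ?thesis
          unfolding ennreal_divide_eq[OF wvol_pos[OF t]] ennreal_divide_eq[OF wvol_pos[OF a(1)]]
          by (intro mult_left_mono ennreal_leI) auto
      qed
      finally show "(\<integral>\<^sup>+z\<in>wbox t x. epow (v z) r \<partial>lborel) / ennreal (wvol TYPE('a) t) \<le>
        (\<integral>\<^sup>+z. epow (v z) r \<partial>lborel) / ennreal (wvol TYPE('a) a)" .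
    qed (use r in auto)
    then show ?thesis using True by simp
  next
    case False
    have "v z = 0" if z: "z \<in> wbox t x" for z
    proof (rule supp, rule notI)
      assume "z \<in> {a<..b} \<times> ball x0 \<rho>"
      then obtain s y where "z = (s, y)" "a < s" "s \<le> b" "dist x0 y < \<rho>" by auto
      moreover from this z have "t / 2 < s" "s \<le> t" "dist x y < t" by (auto simp: wbox_def)
      moreover have "dist x0 x \<le> dist x0 y + dist x y" by (metis dist_triangle dist_commute)
      ultimately have "t \<in> {a..2*b} \<and> x \<in> B" by (auto simp: B_def)
      with False show False by simp
    qed
    then have "(\<integral>\<^sup>+z\<in>wbox t x. epow (v z) r \<partial>lborel) = (\<integral>\<^sup>+(z::real \<times> 'a). 0 \<partial>lborel)"
      by (intro nn_integral_cong) (auto simp: indicator_def)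
    then show ?thesis by (simp add: box_mean_def)
  qed
  have Ti: "T_inner q r v x \<le> ennreal k * epow M q * indicator B x" for x
  proof -
    have "T_inner q r v x \<le> (\<integral>\<^sup>+t. epow M q * ennreal (1/a) * indicator B x * indicator {a..2*b} t \<partial>lborel)"
      unfolding T_inner_def
    proof (intro nn_integral_mono)
      fix t
      show "epow (box_mean r v (wbox t x) t) q / ennreal t * indicator {0<..} t \<le>
        epow M q * ennreal (1/a) * indicator B x * indicator {a..2*b} t"
      proof (cases "0 < t")
        case True
        have "epow (box_mean r v (wbox t x) t) q / ennreal t \<le> epow (M * indicator {a..2*b} t * indicator B x) q * ennreal (1/t)"
          unfolding ennreal_divide_eq[OF True] using q by (intro mult_right_mono epow_mono bm True) auto
        also have "\<dots> \<le> epow M q * ennreal (1/a) * indicator B x * indicator {a..2*b} t"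
          using a by (auto simp: indicator_def intro!: mult_left_mono ennreal_leI divide_left_mono)
        finally show ?thesis using True by simp
      qed auto
    qed
    also have "\<dots> = epow M q * ennreal (1/a) * indicator B x * ennreal (2*b-a)"
      using a by (simp add: nn_integral_cmult_indicator)
    also have "\<dots> = (ennreal (1/a) * ennreal (2*b-a)) * epow M q * indicator B x"
      by (simp only: mult_ac)
    also have "\<dots> \<le> ennreal k * epow M q * indicator B x"
      using a by (intro mult_right_mono) (auto simp: k_def divide_right_mono intro!: ennreal_leI simp flip: ennreal_mult)
    finally show ?thesis .
  qed
  have "(\<integral>\<^sup>+x. epow (T_inner q r v x) (p / q) \<partial>lborel) \<le> (\<integral>\<^sup>+x. ennreal (k powr (p/q)) * epow M p * indicator B x \<partial>lborel)"
  proof (intro nn_integral_mono)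
    fix x
    have "epow (T_inner q r v x) (p / q) \<le> epow (ennreal k * epow M q * indicator B x) (p / q)"
      using p q by (intro epow_mono Ti) auto
    also have "\<dots> = ennreal (k powr (p/q)) * epow M p * indicator B x"
      using p q k by (auto simp: indicator_def epow_mult epow_epow epow_ennreal)
    finally show "epow (T_inner q r v x) (p / q) \<le> ennreal (k powr (p/q)) * epow M p * indicator B x" .
  qed
  also have "\<dots> = ennreal (k powr (p/q)) * epow M p * ennreal U"
    using a \<rho> by (simp add: B_def U_def nn_integral_cmult_indicator emeasure_ball)
  finally have "T_fun p q r v \<le> epow \<dots> (1/p)"
    unfolding T_fun_def using p by (intro epow_mono) auto
  also have "\<dots> = ennreal (k powr (1/q) * U powr (1/p)) * M"
    using p q k U by (simp add: epow_mult epow_epow epow_ennreal powr_powr ennreal_mult mult_ac)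
  finally show ?thesis unfolding M_def k_def U_def .
qed

text \<open>Dominated convergence at three levels: inside a box, in \<open>t\<close>, and in
  \<open>x\<close>. Finiteness of \<open>T_fun p q r v\<close> provides, from the outside in, a
  finite dominating integral for almost every parameter of the next level.\<close>

lemma T_fun_tendsto_0:
  fixes v :: "real \<times> 'a::euclidean_space \<Rightarrow> ennreal"
  assumes [measurable]: "v \<in> borel_measurable borel" "\<And>n. e n \<in> borel_measurable borel"
    and le: "\<And>n z. e n z \<le> v z" and lim: "\<And>z. 0 < fst z \<Longrightarrow> (\<lambda>n. e n z) \<longlonglongrightarrow> 0"
    and fin: "T_fun p q r v < top" and p: "0 < p" and q: "0 < q" and r: "0 < r"
  shows "(\<lambda>n. T_fun p q r (e n)) \<longlonglongrightarrow> 0"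
proof -
  have bm_le: "box_mean r (e n) A t \<le> box_mean r v A t" for n A t
    using r le by (intro box_mean_mono)
  have 1: "(\<lambda>n. box_mean r (e n) (wbox t x) t) \<longlonglongrightarrow> 0"
    if t: "0 < t" and f: "box_mean r v (wbox t x) t < top" for t x
  proof -
    have "(\<integral>\<^sup>+z\<in>wbox t x. epow (v z) r \<partial>lborel) < top"
    proof (rule ccontr)
      assume "\<not> ?thesis"
      then have "(\<integral>\<^sup>+z\<in>wbox t x. epow (v z) r \<partial>lborel) = top" using top.not_eq_extremum by blast
      then show False
        using f wvol_pos[OF t, where 'a='a] by (simp add: box_mean_def ennreal_divide_eq ennreal_top_mult)
    qed
    then have "(\<lambda>n. \<integral>\<^sup>+z\<in>wbox t x. epow (e n z) r \<partial>lborel) \<longlonglongrightarrow> (\<integral>\<^sup>+(z::real\<times>'a). 0 \<partial>lborel)"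
    proof (intro nn_integral_dominated_convergence[where w="\<lambda>z. epow (v z) r * indicator (wbox t x) z"])
      show "AE z in lborel. epow (e n z) r * indicator (wbox t x) z \<le> epow (v z) r * indicator (wbox t x) z" for n
        using r le by (intro AE_I2 mult_right_mono epow_mono) auto
      show "AE z in lborel. (\<lambda>n. epow (e n z) r * indicator (wbox t x) z) \<longlonglongrightarrow> 0"
      proof (rule AE_I2)
        fix z
        show "(\<lambda>n. epow (e n z) r * indicator (wbox t x) z) \<longlonglongrightarrow> 0"
          using tendsto_epow_0[OF lim, of z r] wbox_fst_pos[of z t x] t r by (cases "z \<in> wbox t x") auto
      qed
    qed auto
    then have "(\<lambda>n. ennreal (1 / wvol TYPE('a) t) * (\<integral>\<^sup>+z\<in>wbox t x. epow (e n z) r \<partial>lborel)) \<longlonglongrightarrow> ennreal (1 / wvol TYPE('a) t) * 0"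
      by (intro ennreal_tendsto_cmult) auto
    then have "(\<lambda>n. epow (ennreal (1 / wvol TYPE('a) t) * (\<integral>\<^sup>+z\<in>wbox t x. epow (e n z) r \<partial>lborel)) (1/r)) \<longlonglongrightarrow> 0"
      using r by (intro tendsto_epow_0) auto
    then show ?thesis
      unfolding box_mean_def ennreal_divide_eq[OF wvol_pos[OF t]] by (simp add: mult.commute)
  qed
  have T_le: "T_inner q r (e n) x \<le> T_inner q r v x" for n x
    unfolding T_inner_def using q by (intro nn_integral_mono mult_right_mono divide_right_mono_ennreal epow_mono bm_le) auto
  have 2: "(\<lambda>n. T_inner q r (e n) x) \<longlonglongrightarrow> 0" if f: "T_inner q r v x < top" for x
  proof -
    have "AE t in lborel. epow (box_mean r v (wbox t x) t) q / ennreal t * indicator {0<..} t \<noteq> \<infinity>"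
      using f unfolding T_inner_def by (intro nn_integral_PInf_AE) auto
    then have ae: "AE t in lborel. 0 < t \<longrightarrow> box_mean r v (wbox t x) t < top"
    proof eventually_elim
      case (elim t)
      show ?case
      proof
        assume "0 < t"
        then show "box_mean r v (wbox t x) t < top"
          using elim q by (cases "box_mean r v (wbox t x) t = top") (auto simp: ennreal_divide_eq ennreal_top_mult less_top)
      qed
    qed
    have "(\<lambda>n. \<integral>\<^sup>+t\<in>{0<..}. (epow (box_mean r (e n) (wbox t x) t) q / ennreal t) \<partial>lborel) \<longlonglongrightarrow> (\<integral>\<^sup>+(t::real). 0 \<partial>lborel)"
    proof (intro nn_integral_dominated_convergence[where w="\<lambda>t. epow (box_mean r v (wbox t x) t) q / ennreal t * indicator {0<..} t"])
      show "AE t in lborel. epow (box_mean r (e n) (wbox t x) t) q / ennreal t * indicator {0<..} t \<le>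
        epow (box_mean r v (wbox t x) t) q / ennreal t * indicator {0<..} t" for n
        using q by (intro AE_I2 mult_right_mono divide_right_mono_ennreal epow_mono bm_le) auto
      show "AE t in lborel. (\<lambda>n. epow (box_mean r (e n) (wbox t x) t) q / ennreal t * indicator {0<..} t) \<longlonglongrightarrow> 0"
        using ae
      proof eventually_elim
        case (elim t)
        show ?case
        proof (cases "0 < t")
          case True
          have "(\<lambda>n. ennreal (1/t) * epow (box_mean r (e n) (wbox t x) t) q) \<longlonglongrightarrow> ennreal (1/t) * 0"
            using True elim q by (intro ennreal_tendsto_cmult tendsto_epow_0 1) auto
          then show ?thesis using True by (simp add: ennreal_divide_eq mult.commute)
        qed auto
      qed
      show "(\<integral>\<^sup>+t\<in>{0<..}. (epow (box_mean r v (wbox t x) t) q / ennreal t) \<partial>lborel) < \<infinity>"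
        using f by (simp add: T_inner_def)
    qed measurable
    then show ?thesis by (simp add: T_inner_def)
  qed
  have fin': "(\<integral>\<^sup>+x. epow (T_inner q r v x) (p / q) \<partial>lborel) < top"
    using fin by (simp add: T_fun_def epow_less_top_iff)
  have "AE x in lborel. epow (T_inner q r v x) (p / q) \<noteq> \<infinity>"
    using fin' by (intro nn_integral_PInf_AE) auto
  then have ae: "AE x in lborel. T_inner q r v x < top"
    by eventually_elim (auto simp: less_top)
  have "(\<lambda>n. \<integral>\<^sup>+x. epow (T_inner q r (e n) x) (p / q) \<partial>lborel) \<longlonglongrightarrow> (\<integral>\<^sup>+(x::'a). 0 \<partial>lborel)"
  proof (intro nn_integral_dominated_convergence[where w="\<lambda>x. epow (T_inner q r v x) (p / q)"])
    show "AE x in lborel. epow (T_inner q r (e n) x) (p / q) \<le> epow (T_inner q r v x) (p / q)" for n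
      using p q by (intro AE_I2 epow_mono T_le) auto
    show "AE x in lborel. (\<lambda>n. epow (T_inner q r (e n) x) (p / q)) \<longlonglongrightarrow> 0"
      using ae by eventually_elim (use p q in \<open>auto intro!: tendsto_epow_0 2\<close>)
  qed (use fin' in auto)
  then show ?thesis
    unfolding T_fun_def using p by (intro tendsto_epow_0) auto
qed

lemma box_mean_add_le:
  fixes u v :: "real \<times> 'a::euclidean_space \<Rightarrow> ennreal"
  assumes [measurable]: "u \<in> borel_measurable borel" "v \<in> borel_measurable borel" "A \<in> sets borel"
    and le: "\<And>z. w z \<le> u z + v z" and r: "0 < r"
  shows "box_mean r w A t \<le> ennreal (2 * 2 powr (1/r)) * (box_mean r u A t + box_mean r v A t)"
proof -
  have "(\<integral>\<^sup>+z\<in>A. epow (w z) r \<partial>lborel) \<le> (\<integral>\<^sup>+z. ennreal (2 powr r) * (epow (u z) r * indicator A z + epow (v z) r * indicator A z) \<partial>lborel)"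
  proof (intro nn_integral_mono)
    fix z
    have "epow (w z) r \<le> epow (u z + v z) r" using r by (intro epow_mono le) auto
    also have "\<dots> \<le> ennreal (2 powr r) * (epow (u z) r + epow (v z) r)"
      by (rule epow_add_le[OF r])
    finally show "epow (w z) r * indicator A z \<le> ennreal (2 powr r) * (epow (u z) r * indicator A z + epow (v z) r * indicator A z)"
      by (auto simp: indicator_def)
  qed
  also have "\<dots> = ennreal (2 powr r) * ((\<integral>\<^sup>+z\<in>A. epow (u z) r \<partial>lborel) + (\<integral>\<^sup>+z\<in>A. epow (v z) r \<partial>lborel))"
    by (simp add: nn_integral_cmult nn_integral_add)
  finally have "box_mean r w A t \<le> epow ((ennreal (2 powr r) * ((\<integral>\<^sup>+z\<in>A. epow (u z) r \<partial>lborel) + (\<integral>\<^sup>+z\<in>A. epow (v z) r \<partial>lborel))) / ennreal (wvol TYPE('a) t)) (1/r)"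
    unfolding box_mean_def using r by (intro epow_mono divide_right_mono_ennreal) auto
  also have "\<dots> = ennreal 2 * epow ((\<integral>\<^sup>+z\<in>A. epow (u z) r \<partial>lborel) / ennreal (wvol TYPE('a) t) + (\<integral>\<^sup>+z\<in>A. epow (v z) r \<partial>lborel) / ennreal (wvol TYPE('a) t)) (1/r)"
  proof -
    have "epow (ennreal (2 powr r)) (1/r) = ennreal 2"
      using r by (simp add: epow_ennreal powr_powr)
    then show ?thesis
      using r epow_mult[of "1/r" "ennreal (2 powr r)"] by (simp add: add_divide_distrib_ennreal flip: ennreal_times_divide)
  qed
  also have "\<dots> \<le> ennreal 2 * (ennreal (2 powr (1/r)) * (box_mean r u A t + box_mean r v A t))"
    unfolding box_mean_def using r by (intro mult_left_mono epow_add_le) auto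
  also have "\<dots> = ennreal (2 * 2 powr (1/r)) * (box_mean r u A t + box_mean r v A t)"
    by (simp add: ennreal_mult mult.assoc)
  finally show ?thesis .
qed

text \<open>This gives closure of the tent space under addition. The exponents \<open>r\<close>,
  \<open>q\<close> and \<open>p / q\<close> each cost a constant factor through
  \<open>epow_add_le\<close>, whether or not they are below 1.\<close>

lemma T_fun_add_finite:
  fixes u v :: "real \<times> 'a::euclidean_space \<Rightarrow> ennreal"
  assumes [measurable]: "u \<in> borel_measurable borel" "v \<in> borel_measurable borel" "w \<in> borel_measurable borel"
    and le: "\<And>z. w z \<le> u z + v z" and p: "0 < p" and q: "0 < q" and r: "0 < r"
    and fin: "T_fun p q r u < top" "T_fun p q r v < top"
  shows "T_fun p q r w < top"
proof -
  define c where "c = 2 * 2 powr (1/r)"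
  define c' where "c' = c powr q * 2 powr q"
  have c: "0 < c" "0 < c'" by (auto simp: c_def c'_def)
  have 1: "T_inner q r w x \<le> ennreal c' * (T_inner q r u x + T_inner q r v x)" for x
  proof -
    have "T_inner q r w x \<le> (\<integral>\<^sup>+t. ennreal c' * (epow (box_mean r u (wbox t x) t) q / ennreal t * indicator {0<..} t
        + epow (box_mean r v (wbox t x) t) q / ennreal t * indicator {0<..} t) \<partial>lborel)"
      unfolding T_inner_def
    proof (intro nn_integral_mono)
      fix t
      have "epow (box_mean r w (wbox t x) t) q \<le> epow (ennreal c * (box_mean r u (wbox t x) t + box_mean r v (wbox t x) t)) q"
        unfolding c_def using q by (intro epow_mono box_mean_add_le le r) auto
      also have "\<dots> = ennreal (c powr q) * epow (box_mean r u (wbox t x) t + box_mean r v (wbox t x) t) q"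
        using q c by (simp add: epow_mult epow_ennreal)
      also have "\<dots> \<le> ennreal (c powr q) * (ennreal (2 powr q) * (epow (box_mean r u (wbox t x) t) q + epow (box_mean r v (wbox t x) t) q))"
        by (intro mult_left_mono epow_add_le q) auto
      also have "\<dots> = ennreal c' * (epow (box_mean r u (wbox t x) t) q + epow (box_mean r v (wbox t x) t) q)"
        by (simp add: c'_def ennreal_mult mult.assoc)
      finally have "epow (box_mean r w (wbox t x) t) q / ennreal t \<le> ennreal c' * (epow (box_mean r u (wbox t x) t) q + epow (box_mean r v (wbox t x) t) q) / ennreal t"
        by (rule divide_right_mono_ennreal)
      then show "epow (box_mean r w (wbox t x) t) q / ennreal t * indicator {0<..} t \<le>
        ennreal c' * (epow (box_mean r u (wbox t x) t) q / ennreal t * indicator {0<..} t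
        + epow (box_mean r v (wbox t x) t) q / ennreal t * indicator {0<..} t)"
        by (auto simp: indicator_def add_divide_distrib_ennreal simp flip: ennreal_times_divide)
    qed
    also have "\<dots> = ennreal c' * (T_inner q r u x + T_inner q r v x)"
      unfolding T_inner_def by (subst nn_integral_cmult; (subst nn_integral_add)?; simp)
    finally show ?thesis .
  qed
  define k where "k = c' powr (p/q) * 2 powr (p/q)"
  have "(\<integral>\<^sup>+x. epow (T_inner q r w x) (p / q) \<partial>lborel) \<le>
    (\<integral>\<^sup>+x. ennreal k * (epow (T_inner q r u x) (p / q) + epow (T_inner q r v x) (p / q)) \<partial>lborel)"
  proof (intro nn_integral_mono)
    fix x
    have "epow (T_inner q r w x) (p / q) \<le> epow (ennreal c' * (T_inner q r u x + T_inner q r v x)) (p / q)"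
      using p q by (intro epow_mono 1) auto
    also have "\<dots> = ennreal (c' powr (p/q)) * epow (T_inner q r u x + T_inner q r v x) (p / q)"
      using p q c by (simp add: epow_mult epow_ennreal)
    also have "\<dots> \<le> ennreal (c' powr (p/q)) * (ennreal (2 powr (p/q)) * (epow (T_inner q r u x) (p / q) + epow (T_inner q r v x) (p / q)))"
      using p q by (intro mult_left_mono epow_add_le) auto
    finally show "epow (T_inner q r w x) (p / q) \<le> ennreal k * (epow (T_inner q r u x) (p / q) + epow (T_inner q r v x) (p / q))"
      by (simp add: k_def ennreal_mult mult.assoc)
  qed
  also have "\<dots> = ennreal k * ((\<integral>\<^sup>+x. epow (T_inner q r u x) (p / q) \<partial>lborel) + (\<integral>\<^sup>+x. epow (T_inner q r v x) (p / q) \<partial>lborel))"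
    by (simp add: nn_integral_cmult nn_integral_add)
  also have "\<dots> < top"
    using fin by (simp add: T_fun_def epow_less_top_iff ennreal_mult_less_top)
  finally show ?thesis by (simp add: T_fun_def epow_less_top_iff)
qed

lemma T_fun_cmult:
  fixes v :: "real \<times> 'a::euclidean_space \<Rightarrow> ennreal"
  assumes [measurable]: "v \<in> borel_measurable borel" and p: "0 < p" and q: "0 < q" and r: "0 < r"
  shows "T_fun p q r (\<lambda>z. c * v z) = c * T_fun p q r v"
proof -
  have 1: "box_mean r (\<lambda>z. c * v z) (wbox t x) t = c * box_mean r v (wbox t x) t" for t x
  proof -
    have "(\<integral>\<^sup>+z\<in>wbox t x. epow (c * v z) r \<partial>lborel) = epow c r * (\<integral>\<^sup>+z\<in>wbox t x. epow (v z) r \<partial>lborel)"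
      using r by (simp add: epow_mult mult.assoc nn_integral_cmult)
    then show ?thesis
      using r by (simp add: box_mean_def epow_mult epow_epow flip: ennreal_times_divide)
  qed
  have 2: "T_inner q r (\<lambda>z. c * v z) x = epow c q * T_inner q r v x" for x
    unfolding T_inner_def 1 using q
    by (subst nn_integral_cmult[symmetric]) (auto simp: epow_mult mult.assoc simp flip: ennreal_times_divide)
  show ?thesis
    unfolding T_fun_def 2 using p q
    by (simp add: epow_mult epow_epow nn_integral_cmult)
qed

section \<open>The converse Hoelder inequality\<close>

text \<open>Since \<open>esssup\<close> is \<open>\<infinity>\<close> for nonmeasurable functions, an upper bound for \<open>Z_norm\<close> needs the measurability
  of the averages in both parameters.\<close>

lemma W_avg_measurable:
  fixes f :: "real \<times> 'a::euclidean_space \<Rightarrow> complex"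
  assumes [measurable]: "f \<in> borel_measurable borel" and r: "r = \<infinity> \<or> (\<exists>\<rho>>0. r = ennreal \<rho>)"
  shows "(\<lambda>w. if 0 < fst w then W_avg r \<gamma> f (fst w) (snd w) else 0) \<in> borel_measurable borel"
  using r
proof
  assume "\<exists>\<rho>>0. r = ennreal \<rho>"
  then obtain \<rho> where \<rho>: "0 < \<rho>" "r = ennreal \<rho>" by auto
  have "(\<lambda>w. if 0 < fst w then W_avg r \<gamma> f (fst w) (snd w) else 0) =
    (\<lambda>w. if 0 < fst w then box_mean \<rho> (weighted \<gamma> f) (wbox (fst w) (snd w)) (fst w) else 0)"
    unfolding \<rho>(2) by (auto simp: fun_eq_iff W_avg_eq \<rho>)
  also have "\<dots> \<in> borel_measurable borel" by measurable
  finally show ?thesis .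
next
  assume [simp]: "r = \<infinity>"
  show ?thesis
  proof (rule borel_measurableI_le)
    fix c
    \<comment> \<open>\<open>I w\<close> is the measure of the part of the box where the weighted
      modulus exceeds \<open>c\<close>. It vanishes exactly if the essential supremum over the box
      is at most \<open>c\<close>, and it depends measurably on the box.\<close>
    define I where "I w = (\<integral>\<^sup>+z\<in>wbox (fst w) (snd w). indicator {c<..} (weighted \<gamma> f z) \<partial>lborel)" for w :: "real \<times> 'a"
    have [measurable]: "I \<in> borel_measurable borel"
      unfolding I_def by (intro nn_integral_section_measurable pred_wbox) measurable
    have "W_avg \<infinity> \<gamma> f (fst w) (snd w) \<le> c \<longleftrightarrow> I w = 0" if "0 < fst w" for w
    proof -
      have "I w = 0 \<longleftrightarrow> (AE z in lborel. indicator {c<..} (weighted \<gamma> f z) * indicator (wbox (fst w) (snd w)) z = (0::ennreal))"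
        unfolding I_def by (rule nn_integral_0_iff_AE) measurable
      also have "\<dots> \<longleftrightarrow> (AE z in lborel. z \<in> wbox (fst w) (snd w) \<longrightarrow> weighted \<gamma> f z \<le> c)"
        by (intro AE_cong) (auto simp: indicator_def)
      finally show ?thesis
        using W_avg_top_le_iff[OF borel_measurable_hs[OF assms(1)] that] by simp
    qed
    then have "{w \<in> space borel. (if 0 < fst w then W_avg r \<gamma> f (fst w) (snd w) else 0) \<le> c} =
      {w \<in> space borel. fst w \<le> 0 \<or> I w = 0}"
      by auto
    also have "\<dots> \<in> sets borel" by measurable
    finally show "{w \<in> space borel. (if 0 < fst w then W_avg r \<gamma> f (fst w) (snd w) else 0) \<le> c} \<in> sets borel" .
  qed
qed

text \<open>A sublevel set of the essential supremum consists of the \<open>t\<close> at which the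
  set \<open>H > c\<close> has a null section; the measure of that section is a measurable function
  of \<open>t\<close>.\<close>

lemma esssup_section_measurable:
  fixes H :: "real \<times> 'a::euclidean_space \<Rightarrow> ennreal"
  assumes [measurable]: "H \<in> borel_measurable borel"
  shows "(\<lambda>t. esssup lebesgue (\<lambda>x. H (t, x))) \<in> borel_measurable borel"
proof (rule borel_measurableI_le)
  fix c
  have [measurable]: "(\<lambda>x. H (t, x)) \<in> borel_measurable borel" for t
  proof -
    from measurable_compose[OF Pair_borel_measurable(1) assms] show ?thesis .
  qed
  have "(\<lambda>w. indicator {c<..} (H (fst w, snd w)) :: ennreal) \<in> borel_measurable (borel \<Otimes>\<^sub>M lborel)"
  proof -
    have "(\<lambda>w. indicator {c<..} (H (fst w, snd w)) :: ennreal) \<in> borel_measurable borel" by simp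
    then show ?thesis by (simp add: borel_prod[symmetric])
  qed
  then have [measurable]: "(\<lambda>t. \<integral>\<^sup>+x. indicator {c<..} (H (t, x)) \<partial>lborel) \<in> borel_measurable borel"
    by (intro lborel.borel_measurable_nn_integral) (simp add: case_prod_unfold)
  have "esssup lebesgue (\<lambda>x. H (t, x)) \<le> c \<longleftrightarrow> (\<integral>\<^sup>+x. indicator {c<..} (H (t, x)) \<partial>lborel) = (0::ennreal)" for t
  proof -
    have m: "(\<lambda>x. H (t, x)) \<in> borel_measurable lebesgue"
      by (rule measurable_completion) simp
    have "esssup lebesgue (\<lambda>x. H (t, x)) \<le> c \<longleftrightarrow> (AE x in lebesgue. H (t, x) \<le> c)"
      using esssup_I[OF m, where c=c] esssup_AE[where M=lebesgue and f="\<lambda>x. H (t, x)"]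
      by (auto elim: eventually_mono order.trans)
    also have "\<dots> \<longleftrightarrow> (AE x in lborel. indicator {c<..} (H (t, x)) = (0::ennreal))"
      unfolding AE_completion_iff by (intro AE_cong) (auto simp: indicator_def)
    also have "\<dots> \<longleftrightarrow> (\<integral>\<^sup>+x. indicator {c<..} (H (t, x)) \<partial>lborel) = (0::ennreal)"
      by (intro nn_integral_0_iff_AE[symmetric]) measurable
    finally show ?thesis .
  qed
  then have "{t \<in> space borel. esssup lebesgue (\<lambda>x. H (t, x)) \<le> c} =
    {t \<in> space borel. (\<integral>\<^sup>+x. indicator {c<..} (H (t, x)) \<partial>lborel) = (0::ennreal)}" by auto
  also have "\<dots> \<in> sets borel" by measurable
  finally show "{t \<in> space borel. esssup lebesgue (\<lambda>x. H (t, x)) \<le> c} \<in> sets borel" .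
qed

lemma Z_norm_le:
  fixes f :: "real \<times> 'a::euclidean_space \<Rightarrow> complex"
  assumes f: "f \<in> borel_measurable borel" and r: "r = \<infinity> \<or> (\<exists>\<rho>>0. r = ennreal \<rho>)"
    and le: "\<And>t x. 0 < t \<Longrightarrow> W_avg r \<gamma> f t x \<le> c"
  shows "Z_norm r \<gamma> f \<le> c"
proof -
  \<comment> \<open>Extension by zero to \<open>t <= 0\<close> makes the averages a single Borel
    function of both parameters, from which the inner and the outer \<open>esssup\<close> obtain
    their measurability.\<close>
  define H where "H w = (if 0 < fst w then W_avg r \<gamma> f (fst w) (snd w) else 0)" for w
  have H[measurable]: "H \<in> borel_measurable borel"
    unfolding H_def by (rule W_avg_measurable[OF f r])
  have eq: "esssup lebesgue (\<lambda>x. W_avg r \<gamma> f t x) = esssup lebesgue (\<lambda>x. H (t, x))" if "0 < t" for t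
    using that by (simp add: H_def)
  have "(\<lambda>t. esssup lebesgue (\<lambda>x. H (t, x))) \<in> borel_measurable (lebesgue_on {0<..})"
    using esssup_section_measurable[OF H] by (intro measurable_restrict_space1 measurable_completion) simp
  then have m: "(\<lambda>t. esssup lebesgue (\<lambda>x. W_avg r \<gamma> f t x)) \<in> borel_measurable (lebesgue_on {0<..})"
    by (rule measurable_cong[THEN iffD1, rotated]) (simp add: eq)
  have "esssup lebesgue (\<lambda>x. W_avg r \<gamma> f t x) \<le> c" if t: "0 < t" for t
  proof -
    from measurable_compose[OF Pair_borel_measurable(1) H] have "(\<lambda>x. H (t, x)) \<in> borel_measurable lebesgue"
      by (intro measurable_completion) simp
    then show ?thesis unfolding eq[OF t]
      by (rule esssup_I) (simp add: H_def t le)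
  qed
  then show ?thesis
    unfolding Z_norm_def by (intro esssup_I[OF m] AE_I2) simp
qed

text \<open>The pairing as one integral over the product space; it agrees with
  \<open>L2_pairing\<close> as soon as the integrand is absolutely integrable.\<close>

definition pairing_int :: "(real \<times> 'a::euclidean_space \<Rightarrow> complex) \<Rightarrow> (real \<times> 'a \<Rightarrow> complex) \<Rightarrow> complex" where
  "pairing_int f g = (\<integral>z. indicator half_space z *\<^sub>R (f z * cnj (g z) / of_real (fst z)) \<partial>lborel)"

text \<open>The support condition has the shape required by \<open>T_fun_box_le\<close>. As
  \<open>s\<close> stays away from 0 and infinity, such functions lie in the tent space whatever the
  weight \<beta>.\<close>

definition test_fun :: "(real \<times> 'a::euclidean_space \<Rightarrow> complex) \<Rightarrow> bool" where
  "test_fun g \<longleftrightarrow> g \<in> borel_measurable borel \<and> (\<exists>B. \<forall>z. cmod (g z) \<le> B) \<and>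
    (\<exists>a b x0 \<rho>. 0 < a \<and> a \<le> b \<and> 0 \<le> \<rho> \<and> (\<forall>z. g z \<noteq> 0 \<longrightarrow> z \<in> {a<..b} \<times> ball x0 \<rho>))"

lemma powr_dyadic_ge:
  fixes s t e :: real
  assumes "0 < t" "t/2 < s" "s \<le> t"
  shows "(1/2) powr \<bar>e\<bar> * t powr e \<le> s powr e"
proof (cases "0 \<le> e")
  case True
  have "(1/2) powr \<bar>e\<bar> * t powr e = (t/2) powr e"
    using True by (simp add: powr_divide)
  also have "\<dots> \<le> s powr e" using assms True by (intro powr_mono2) auto
  finally show ?thesis .
next
  case False
  have "(1/2) powr \<bar>e\<bar> * t powr e \<le> 1 * t powr e"
    by (intro mult_right_mono powr_le1) auto
  also have "\<dots> \<le> s powr e" using assms False by (simp add: powr_mono2')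
  finally show ?thesis .
qed

lemma powr_dyadic_le:
  fixes s t e :: real
  assumes "0 < t" "t/2 < s" "s \<le> t"
  shows "s powr e \<le> 2 powr \<bar>e\<bar> * t powr e"
proof -
  have "(1/2) powr \<bar>e\<bar> * t powr (-e) \<le> s powr (-e)"
    using powr_dyadic_ge[OF assms, of "-e"] by simp
  then show ?thesis
    using assms by (simp add: powr_minus powr_divide field_simps)
qed

definition weighted_real :: "real \<Rightarrow> (real \<times> 'a::euclidean_space \<Rightarrow> complex) \<Rightarrow> real \<times> 'a \<Rightarrow> real" where
  "weighted_real \<beta> f z = fst z powr (-\<beta>) * cmod (f z)"

lemma weighted_real_measurable [measurable]:
  "f \<in> borel_measurable borel \<Longrightarrow> weighted_real \<beta> f \<in> borel_measurable borel"
  unfolding weighted_real_def by measurable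

lemma weighted_eq: "weighted \<beta> f z = ennreal (weighted_real \<beta> f z)"
  by (simp add: weighted_def weighted_real_def)

lemma weighted_real_nonneg [simp]: "0 \<le> weighted_real \<beta> f z"
  by (simp add: weighted_real_def)

text \<open>The condition on \<open>f z * cnj (g z)\<close> makes the integrand of
  \<open>pairing_int\<close> bounded with bounded support. For a Borel function \<open>f\<close>
  without any integrability the pairing is therefore a genuine integral and not the default value
  0.\<close>

definition pairing_bounded where
  "pairing_bounded p q r \<beta> M f \<longleftrightarrow> (\<forall>g. test_fun g \<longrightarrow> (\<exists>B. \<forall>z. cmod (f z * cnj (g z)) \<le> B) \<longrightarrow>
      ennreal (cmod (pairing_int f g)) \<le> ennreal M * T_norm p q r \<beta> g)"

text \<open>\<open>w\<close> is the weighted modulus of a test function on the box; phase and weight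
  are supplied in the proof. The bound \<open>n\<close> on the support of \<open>w\<close> secures
  what \<open>pairing_bounded\<close> asks for, and \<open>C\<close> depends on neither
  \<open>n\<close> nor \<open>B\<close>, so cutoffs can be removed later.\<close>

lemma pairing_bounded_box:
  fixes p q r \<beta> :: real
  assumes p: "0 < p" "p < 1" and q: "0 < q" and r: "1 \<le> r"
  obtains C where "0 < C"
    "\<And>(f :: real \<times> 'a::euclidean_space \<Rightarrow> complex) w M t x B n.
      f \<in> borel_measurable borel \<Longrightarrow> pairing_bounded p q r \<beta> M f \<Longrightarrow> 0 \<le> M \<Longrightarrow> 0 < t \<Longrightarrow>
      w \<in> borel_measurable borel \<Longrightarrow> (\<And>z. 0 \<le> w z) \<Longrightarrow> (\<And>z. w z \<le> B) \<Longrightarrow>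
      (\<And>z. w z \<noteq> 0 \<Longrightarrow> z \<in> wbox t x \<and> weighted_real (- \<beta> + real DIM('a) * (1 / p - 1)) f z \<le> n) \<Longrightarrow>
      (\<integral>\<^sup>+z. ennreal (weighted_real (- \<beta> + real DIM('a) * (1 / p - 1)) f z * w z) \<partial>lborel) \<le>
        ennreal (C * M * wvol TYPE('a) t) * epow ((\<integral>\<^sup>+z. epow (ennreal (w z)) r \<partial>lborel) / ennreal (wvol TYPE('a) t)) (1/r)"
proof -
  define d where "d = real DIM('a)"
  define \<alpha> where "\<alpha> = d * (1/p - 1)"
  define \<gamma> where "\<gamma> = - \<beta> + \<alpha>"
  define \<omega> where "\<omega> = unit_ball_vol d"
  have \<omega>: "0 < \<omega>" by (simp add: \<omega>_def d_def)
  define k where "k = (1/2) powr \<bar>\<alpha> - 1\<bar>"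
  have k: "0 < k" by (simp add: k_def)
  \<comment> \<open>The factors stem from \<open>T_fun_box_le\<close> with \<open>a = t/2\<close>,
    \<open>b = t\<close> and radius \<open>t\<close>: there \<open>2 * b / a = 4\<close>, the
    enlarged radius is \<open>3 * t\<close>, and \<open>wvol\<close> at \<open>t/2\<close> is
    smaller than at \<open>t\<close> by \<open>2 powr (d + 1)\<close>.\<close>
  define K where "K = 4 powr (1/q) * (\<omega> * 3 powr d) powr (1/p) * (2 powr (d + 1)) powr (1/r)"
  have K: "0 < K" using \<omega> by (simp add: K_def)
  define C where "C = K / k / (\<omega> / 2)"
  have C: "0 < C" using K k \<omega> by (simp add: C_def)
  have r0: "0 < r" using r by simp
  show thesis
  proof (rule that[OF C])
    fix f :: "real \<times> 'a \<Rightarrow> complex" and w :: "real \<times> 'a \<Rightarrow> real" and M t :: real and x :: 'a and B n :: real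
    assume f[measurable]: "f \<in> borel_measurable borel" and pb: "pairing_bounded p q r \<beta> M f" and M: "0 \<le> M"
      and t: "0 < t" and w[measurable]: "w \<in> borel_measurable borel" and w0: "\<And>z. 0 \<le> w z" and wB: "\<And>z. w z \<le> B"
      and supp': "\<And>z. w z \<noteq> 0 \<Longrightarrow> z \<in> wbox t x \<and> weighted_real (- \<beta> + real DIM('a) * (1 / p - 1)) f z \<le> n"
    let ?u = "weighted_real \<gamma> f"
    have supp: "z \<in> wbox t x" "?u z \<le> n" if "w z \<noteq> 0" for z
      using supp'[OF that] unfolding \<gamma>_def \<alpha>_def d_def by auto
    have s: "0 < fst z" "t/2 < fst z" "fst z \<le> t" if "w z \<noteq> 0" for z
      using supp(1)[OF that] t by (auto simp: wbox_def)
    have B: "0 \<le> B" using w0[of undefined] wB[of undefined] by linarith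
    \<comment> \<open>The phase \<open>sgn (f z)\<close> makes \<open>f z * cnj (g z)\<close> real
      and nonnegative, so the pairing has no cancellation. The factor
      \<open>fst z powr \<beta>\<close> cancels the weight of the tent space norm and leaves at most
      \<open>w\<close>.\<close>
    define g where "g z = complex_of_real (w z * fst z powr \<beta>) * sgn (f z)" for z
    have g_meas[measurable]: "g \<in> borel_measurable borel" unfolding g_def sgn_div_norm by measurable
    have norm_g: "cmod (g z) \<le> w z * fst z powr \<beta>" for z
      using w0 by (auto simp: g_def norm_mult norm_sgn)
    have fg: "f z * cnj (g z) = complex_of_real (w z * fst z powr \<beta> * cmod (f z))" for z
    proof -
      have "f z * cnj (sgn (f z)) = complex_of_real (cmod (f z))"
        by (cases "f z = 0") (simp_all add: sgn_div_norm scaleR_conv_of_real complex_norm_square[symmetric] power2_eq_square field_simps)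
      then show ?thesis by (simp add: g_def mult_ac)
    qed
    define h where "h z = fst z powr (\<alpha> - 1) * (?u z * w z)" for z
    have h0: "0 \<le> h z" for z using w0 by (simp add: h_def)
    have [measurable]: "h \<in> borel_measurable borel" unfolding h_def by measurable
    have h_eq: "indicator half_space z *\<^sub>R (f z * cnj (g z) / of_real (fst z)) = complex_of_real (h z)" for z
    proof (cases "w z = 0")
      case True
      then show ?thesis by (simp add: h_def g_def)
    next
      case False
      have "fst z powr \<beta> = fst z powr (\<alpha> - 1) * fst z powr (-\<gamma>) * fst z"
      proof -
        have "fst z powr \<beta> = fst z powr ((\<alpha> - 1) + (-\<gamma>) + 1)"
          by (simp add: \<gamma>_def)
        then show ?thesis using s[OF False] by (simp only: powr_add powr_one)
      qed
      then have "w z * fst z powr \<beta> * cmod (f z) / fst z = h z"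
        using s[OF False] by (simp add: h_def weighted_real_def)
      then have *: "complex_of_real (w z * fst z powr \<beta> * cmod (f z)) / of_real (fst z) = of_real (h z)"
        by (simp only: of_real_divide[symmetric])
      show ?thesis unfolding fg * using s[OF False] by simp
    qed
    have test: "test_fun g"
      unfolding test_fun_def
    proof (intro conjI)
      have "cmod (g z) \<le> B * (2 powr \<bar>\<beta>\<bar> * t powr \<beta>)" for z
      proof (cases "w z = 0")
        case True
        then show ?thesis using B by (simp add: g_def)
      next
        case False
        have "cmod (g z) \<le> w z * fst z powr \<beta>" by (rule norm_g)
        also have "\<dots> \<le> B * (2 powr \<bar>\<beta>\<bar> * t powr \<beta>)"
          using B w0 wB s[OF False] t by (intro mult_mono powr_dyadic_le) auto
        finally show ?thesis .
      qed
      then show "\<exists>B. \<forall>z. cmod (g z) \<le> B" by blast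
      show "\<exists>a b x0 \<rho>. 0 < a \<and> a \<le> b \<and> 0 \<le> \<rho> \<and> (\<forall>z. g z \<noteq> 0 \<longrightarrow> z \<in> {a<..b} \<times> ball x0 \<rho>)"
        using t supp(1) unfolding wbox_def
        by (intro exI[of _ "t/2"] exI[of _ t] exI[of _ x]) (auto simp: g_def)
    qed fact
    have h_le: "h z \<le> (2 powr \<bar>\<alpha> - 1\<bar> * t powr (\<alpha> - 1) * (\<bar>n\<bar> * B)) * indicator (wbox t x) z" for z
    proof (cases "w z = 0")
      case True
      then show ?thesis using B by (simp add: h_def)
    next
      case False
      have "h z \<le> 2 powr \<bar>\<alpha> - 1\<bar> * t powr (\<alpha> - 1) * (\<bar>n\<bar> * B)"
        unfolding h_def using B w0 wB s[OF False] t supp(2)[OF False]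
        by (intro mult_mono powr_dyadic_le) auto
      then show ?thesis using supp(1)[OF False] by simp
    qed
    have fgb: "\<exists>B. \<forall>z. cmod (f z * cnj (g z)) \<le> B"
    proof (intro exI allI)
      fix z
      show "cmod (f z * cnj (g z)) \<le> (2 powr \<bar>\<alpha>\<bar> * t powr \<alpha>) * (\<bar>n\<bar> * B)"
      proof (cases "w z = 0")
        case True
        then show ?thesis using B by (simp add: g_def)
      next
        case False
        have "fst z powr \<beta> = fst z powr \<alpha> * fst z powr (-\<gamma>)"
          by (simp add: \<gamma>_def flip: powr_add)
        then have "cmod (f z * cnj (g z)) = fst z powr \<alpha> * (?u z * w z)"
          unfolding fg norm_of_real using w0 by (simp add: weighted_real_def mult_ac)
        also have "\<dots> \<le> (2 powr \<bar>\<alpha>\<bar> * t powr \<alpha>) * (\<bar>n\<bar> * B)"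
          using B w0 wB s[OF False] t supp(2)[OF False]
          by (intro mult_mono powr_dyadic_le) auto
        finally show ?thesis .
      qed
    qed
    have int: "integrable lborel h"
    proof (rule integrableI_nonneg)
      have "(\<integral>\<^sup>+z. ennreal (h z) \<partial>lborel) \<le> (\<integral>\<^sup>+z. ennreal (2 powr \<bar>\<alpha> - 1\<bar> * t powr (\<alpha> - 1) * (\<bar>n\<bar> * B)) * indicator (wbox t x) z \<partial>lborel)"
      proof (intro nn_integral_mono)
        fix z
        show "ennreal (h z) \<le> ennreal (2 powr \<bar>\<alpha> - 1\<bar> * t powr (\<alpha> - 1) * (\<bar>n\<bar> * B)) * indicator (wbox t x) z"
          using h_le[of z] by (cases "z \<in> wbox t x") (auto intro: ennreal_leI simp: ennreal_neg)
      qed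
      also have "\<dots> = ennreal (2 powr \<bar>\<alpha> - 1\<bar> * t powr (\<alpha> - 1) * (\<bar>n\<bar> * B)) * emeasure lborel (wbox t x)"
        by (rule nn_integral_cmult_indicator) simp
      also have "\<dots> < \<infinity>"
        using emeasure_wbox_finite[of t x] by (auto simp: ennreal_mult_less_top)
      finally show "(\<integral>\<^sup>+z. ennreal (h z) \<partial>lborel) < \<infinity>" .
    qed (use h0 in auto)
    have PI: "ennreal (cmod (pairing_int f g)) = (\<integral>\<^sup>+z. ennreal (h z) \<partial>lborel)"
    proof -
      have "pairing_int f g = complex_of_real (\<integral>z. h z \<partial>lborel)"
        unfolding pairing_int_def h_eq by (rule integral_of_real) (rule int)
      then show ?thesis
        using nn_integral_eq_integral[OF int] h0 by simp
    qed
    define S where "S = (\<integral>\<^sup>+z. epow (ennreal (w z)) r \<partial>lborel)"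
    define T where "T = t powr (\<alpha> - 1)"
    have T: "0 < T" using t by (simp add: T_def)
    let ?V = "wvol TYPE('a) t"
    have V: "0 < ?V" by (rule wvol_pos[OF t])
    have low: "ennreal (k * T) * (\<integral>\<^sup>+z. ennreal (?u z * w z) \<partial>lborel) \<le> (\<integral>\<^sup>+z. ennreal (h z) \<partial>lborel)"
    proof -
      have "ennreal (k * T) * (\<integral>\<^sup>+z. ennreal (?u z * w z) \<partial>lborel) = (\<integral>\<^sup>+z. ennreal (k * T) * ennreal (?u z * w z) \<partial>lborel)"
        by (rule nn_integral_cmult[symmetric]) measurable
      also have "\<dots> \<le> (\<integral>\<^sup>+z. ennreal (h z) \<partial>lborel)"
      proof (intro nn_integral_mono)
        fix z
        have "k * T * (?u z * w z) \<le> h z"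
        proof (cases "w z = 0")
          case False
          then show ?thesis
            unfolding h_def k_def T_def using w0 s[OF False] t by (intro mult_right_mono powr_dyadic_ge) auto
        qed (simp add: h_def)
        then show "ennreal (k * T) * ennreal (?u z * w z) \<le> ennreal (h z)"
          using k T w0 by (simp add: ennreal_leI flip: ennreal_mult)
      qed
      finally show ?thesis .
    qed
    have up: "T_norm p q r \<beta> g \<le> ennreal (K * t powr (d / p)) * epow (S / ennreal ?V) (1/r)"
    proof -
      have "weighted \<beta> g z \<le> ennreal (w z)" for z
      proof -
        have "fst z powr (-\<beta>) * cmod (g z) \<le> fst z powr (-\<beta>) * (w z * fst z powr \<beta>)"
          by (intro mult_left_mono norm_g) auto
        also have "\<dots> \<le> w z"
        proof (cases "w z = 0")
          case False
          then have "fst z powr (-\<beta>) * fst z powr \<beta> = 1"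
            using s(1)[OF False] by (simp flip: powr_add)
          then show ?thesis by (simp add: mult.left_commute[of _ "w z"])
        qed simp
        finally show ?thesis unfolding weighted_def by (rule ennreal_leI)
      qed
      then have "(\<integral>\<^sup>+z. epow (weighted \<beta> g z) r \<partial>lborel) \<le> S"
        unfolding S_def using r by (intro nn_integral_mono epow_mono) auto
      moreover have "T_fun p q r (weighted \<beta> g) \<le>
        ennreal ((2*t/(t/2)) powr (1/q) * (unit_ball_vol (real DIM('a)) * (t + 2*t) ^ DIM('a)) powr (1/p))
        * epow ((\<integral>\<^sup>+z. epow (weighted \<beta> g z) r \<partial>lborel) / ennreal (wvol TYPE('a) (t/2))) (1/r)"
        using t p q r0
      proof (intro T_fun_box_le[where ?x0.0 = x])
        show "weighted \<beta> g z = 0" if "z \<notin> {t/2<..t} \<times> ball x t" for z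
          using that supp(1)[of z] unfolding wbox_def by (cases "w z = 0") (auto simp: weighted_def g_def)
      qed auto
      ultimately have "T_norm p q r \<beta> g \<le> ennreal ((2*t/(t/2)) powr (1/q) * (unit_ball_vol (real DIM('a)) * (t + 2*t) ^ DIM('a)) powr (1/p))
        * epow (S / ennreal (wvol TYPE('a) (t/2))) (1/r)"
        unfolding T_norm_eq[OF g_meas r0] T_fun_def[symmetric] using r0
        by (elim order.trans) (intro mult_left_mono epow_mono divide_right_mono_ennreal, auto)
      also have "S / ennreal (wvol TYPE('a) (t/2)) = ennreal (2 powr (d+1)) * (S / ennreal ?V)"
      proof -
        have e: "1 / wvol TYPE('a) (t/2) = 2 powr (d + 1) * (1 / ?V)"
          using wvol_scale[of t "1/2", where 'a='a] t V by (simp add: d_def powr_divide)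
        have V': "0 < wvol TYPE('a) (t/2)" using t by (intro wvol_pos) simp
        show ?thesis
          unfolding ennreal_divide_eq[OF V] ennreal_divide_eq[OF V'] e ennreal_mult'[OF powr_ge_zero]
          by (simp only: mult_ac)
      qed
      also have "epow (ennreal (2 powr (d+1)) * (S / ennreal ?V)) (1/r) = ennreal ((2 powr (d+1)) powr (1/r)) * epow (S / ennreal ?V) (1/r)"
        using r0 by (simp only: epow_mult epow_ennreal powr_ge_zero zero_less_divide_1_iff)
      also have "(2*t/(t/2)) powr (1/q) * (unit_ball_vol (real DIM('a)) * (t + 2*t) ^ DIM('a)) powr (1/p) =
        4 powr (1/q) * (\<omega> * 3 powr d) powr (1/p) * t powr (d/p)"
      proof -
        have "(t + 2*t) ^ DIM('a) = 3 powr d * t powr d"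
          using t by (simp add: d_def powr_realpow power_mult_distrib)
        then have "unit_ball_vol (real DIM('a)) * (t + 2*t) ^ DIM('a) = (\<omega> * 3 powr d) * t powr d"
          by (simp add: \<omega>_def d_def)
        then show ?thesis using t \<omega> by (simp add: powr_mult powr_powr)
      qed
      also have "ennreal (4 powr (1/q) * (\<omega> * 3 powr d) powr (1/p) * t powr (d/p)) * (ennreal ((2 powr (d+1)) powr (1/r)) * epow (S / ennreal ?V) (1/r))
        = ennreal (K * t powr (d / p)) * epow (S / ennreal ?V) (1/r)"
      proof -
        have e: "K * t powr (d/p) = (4 powr (1/q) * (\<omega> * 3 powr d) powr (1/p) * t powr (d/p)) * (2 powr (d+1)) powr (1/r)"
          unfolding K_def by (simp only: mult_ac)
        show ?thesis
          unfolding e by (subst (2) ennreal_mult'') (simp_all add: mult.assoc)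
      qed
      finally show ?thesis .
    qed
    have "ennreal (k * T) * (\<integral>\<^sup>+z. ennreal (?u z * w z) \<partial>lborel) \<le> ennreal M * (ennreal (K * t powr (d / p)) * epow (S / ennreal ?V) (1/r))"
    proof -
      have "ennreal (cmod (pairing_int f g)) \<le> ennreal M * T_norm p q r \<beta> g"
        using pb test fgb unfolding pairing_bounded_def by blast
      also have "\<dots> \<le> ennreal M * (ennreal (K * t powr (d / p)) * epow (S / ennreal ?V) (1/r))"
        by (intro mult_left_mono up) auto
      finally show ?thesis using low PI by simp
    qed
    then have "ennreal (1 / (k * T)) * (ennreal (k * T) * (\<integral>\<^sup>+z. ennreal (?u z * w z) \<partial>lborel)) \<le>
      ennreal (1 / (k * T)) * (ennreal M * (ennreal (K * t powr (d / p)) * epow (S / ennreal ?V) (1/r)))"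
      by (intro mult_left_mono) auto
    also have "ennreal (1 / (k * T)) * (ennreal (k * T) * (\<integral>\<^sup>+z. ennreal (?u z * w z) \<partial>lborel)) = (\<integral>\<^sup>+z. ennreal (?u z * w z) \<partial>lborel)"
      using k T by (simp add: mult.assoc[symmetric] flip: ennreal_mult)
    also have "ennreal (1 / (k * T)) * (ennreal M * (ennreal (K * t powr (d / p)) * epow (S / ennreal ?V) (1/r))) =
      ennreal (1 / (k * T) * (M * (K * t powr (d / p)))) * epow (S / ennreal ?V) (1/r)"
    proof -
      have a: "0 \<le> 1 / (k * T)" using k T by simp
      show ?thesis
        unfolding ennreal_mult'[OF a] ennreal_mult'[OF M] by (simp only: mult.assoc)
    qed
    also have "1 / (k * T) * (M * (K * t powr (d / p))) = C * M * ?V"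
    proof -
      \<comment> \<open>Here \<open>d/p - (\<alpha> - 1) = d + 1\<close>: division by
        \<open>T\<close> leaves a multiple of the volume of the box, so the constant
        \<open>C\<close> is free of \<open>t\<close>.\<close>
      have e1: "t powr (d/p) = T * t powr (d + 1)"
        using p by (simp add: T_def \<alpha>_def right_diff_distrib flip: powr_add)
      have e2: "?V = \<omega> / 2 * t powr (d+1)" by (simp add: wvol_def \<omega>_def d_def)
      show ?thesis unfolding e1 e2 C_def using k T \<omega> by simp
    qed
    finally show "(\<integral>\<^sup>+z. ennreal (weighted_real (- \<beta> + real DIM('a) * (1 / p - 1)) f z * w z) \<partial>lborel) \<le>
        ennreal (C * M * wvol TYPE('a) t) * epow ((\<integral>\<^sup>+z. epow (ennreal (w z)) r \<partial>lborel) / ennreal (wvol TYPE('a) t)) (1/r)"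
      unfolding S_def \<gamma>_def \<alpha>_def d_def .
  qed
qed


text \<open>The premise tests with the power \<open>r' - 1\<close> of \<open>u\<close>, cut off at
  \<open>u z <= n\<close>, where \<open>r' = r / (r - 1)\<close>. As
  \<open>(r' - 1) * r = r'\<close>, the same integral \<open>X n\<close> appears on both sides.
  Cancelling its power \<open>1/r\<close> bounds it by \<open>D powr r'\<close> times the volume,
  uniformly in \<open>n\<close>, and monotone convergence removes the cutoff.\<close>

lemma box_mean_le_of_self_bound:
  fixes u :: "real \<times> 'a::euclidean_space \<Rightarrow> real"
  assumes u[measurable]: "u \<in> borel_measurable borel" and u0: "\<And>z. 0 \<le> u z" and r: "1 < r" and t: "0 < t" and D: "0 \<le> D"
    and self: "\<And>n::nat. (\<integral>\<^sup>+z. ennreal (u z * (u z powr (r/(r-1) - 1) * indicator {z \<in> wbox t x. u z \<le> n} z)) \<partial>lborel) \<le>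
      ennreal (D * wvol TYPE('a) t) * epow ((\<integral>\<^sup>+z. epow (ennreal (u z powr (r/(r-1) - 1) * indicator {z \<in> wbox t x. u z \<le> n} z)) r \<partial>lborel) / ennreal (wvol TYPE('a) t)) (1/r)"
  shows "box_mean (r/(r-1)) (\<lambda>z. ennreal (u z)) (wbox t x) t \<le> ennreal D"
proof -
  define r' where "r' = r / (r - 1)"
  have r': "1 < r'" "r' = (r' - 1) * r" "1 - 1/r = 1/r'" using r by (auto simp: r'_def field_simps)
  let ?V = "wvol TYPE('a) t"
  have V: "0 < ?V" by (rule wvol_pos[OF t])
  define A where "A n = {z \<in> wbox t x. u z \<le> real n}" for n
  have [measurable]: "A n \<in> sets borel" for n unfolding A_def by measurable
  define X where "X n = (\<integral>\<^sup>+z. ennreal (u z powr r') * indicator (A n) z \<partial>lborel)" for n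
  have X1: "(\<integral>\<^sup>+z. ennreal (u z * (u z powr (r' - 1) * indicator (A n) z)) \<partial>lborel) = X n" for n
    unfolding X_def
  proof (intro nn_integral_cong)
    fix z
    have "u z * u z powr (r' - 1) = u z powr r'"
      using u0[of z] powr_mult_base[of "u z" "r' - 1"] by simp
    then show "ennreal (u z * (u z powr (r' - 1) * indicator (A n) z)) = ennreal (u z powr r') * indicator (A n) z"
      by (auto simp: indicator_def)
  qed
  have X2: "(\<integral>\<^sup>+z. epow (ennreal (u z powr (r' - 1) * indicator (A n) z)) r \<partial>lborel) = X n" for n
    unfolding X_def
  proof (intro nn_integral_cong)
    fix z
    have "(u z powr (r' - 1)) powr r = u z powr r'"
      using r'(2) by (simp add: powr_powr)
    then show "epow (ennreal (u z powr (r' - 1) * indicator (A n) z)) r = ennreal (u z powr r') * indicator (A n) z"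
      by (auto simp: indicator_def epow_ennreal)
  qed
  have self': "X n \<le> ennreal (D * ?V) * epow (X n / ennreal ?V) (1/r)" for n
    using self[of n] unfolding r'_def[symmetric] A_def[symmetric] X1 X2 .
  \<comment> \<open>The cutoff and the bounded box make \<open>X n\<close> finite; otherwise the
    inequality could read infinity on both sides and nothing could be cancelled.\<close>
  have fin: "X n < top" for n
  proof -
    have "X n \<le> (\<integral>\<^sup>+z. ennreal (real n powr r') * indicator (wbox t x) z \<partial>lborel)"
      unfolding X_def using u0 r' by (intro nn_integral_mono) (auto simp: A_def indicator_def intro!: ennreal_leI powr_mono2)
    also have "\<dots> = ennreal (real n powr r') * emeasure lborel (wbox t x)"
      by (rule nn_integral_cmult_indicator) simp
    also have "\<dots> < top"
      using emeasure_wbox_finite[of t x] by (auto simp: ennreal_mult_less_top)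
    finally show ?thesis .
  qed
  have key: "a \<le> D powr r'" if a: "0 < a" "a \<le> D * a powr (1/r)" for a
  proof -
    have "a * a powr (-1/r) \<le> D * a powr (1/r) * a powr (-1/r)"
      using a by (intro mult_right_mono) auto
    also have "D * a powr (1/r) * a powr (-1/r) = D"
      using a by (simp add: mult.assoc flip: powr_add)
    also have "a * a powr (-1/r) = a powr (1/r')"
      using a r'(3) powr_mult_base[of a "-1/r"] by simp
    finally have "(a powr (1/r')) powr r' \<le> D powr r'"
      using r' by (intro powr_mono2) auto
    then show ?thesis using a r' by (simp add: powr_powr)
  qed
  have "X n \<le> ennreal (D powr r' * ?V)" for n
  proof -
    obtain y where y: "X n = ennreal y" "0 \<le> y" using fin[of n] by (cases "X n") auto
    show ?thesis
    proof (cases "y = 0")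
      case True
      then show ?thesis using y by simp
    next
      case False
      then have y0: "0 < y / ?V" using y V by simp
      have e: "X n / ennreal ?V = ennreal (y / ?V)" using y V by (simp add: divide_ennreal)
      have "ennreal y \<le> ennreal (D * ?V) * epow (ennreal (y / ?V)) (1/r)"
        using self'[of n] e y by simp
      also have "\<dots> = ennreal (D * ?V * (y / ?V) powr (1/r))"
        using y0 D V by (simp only: epow_ennreal[OF less_imp_le] ennreal_mult''[OF powr_ge_zero])
      finally have "y \<le> D * ?V * (y / ?V) powr (1/r)"
        using D V by (subst (asm) ennreal_le_iff) auto
      then have "(y / ?V) \<le> D * (y / ?V) powr (1/r)"
        using V by (simp add: field_simps)
      then have "y / ?V \<le> D powr r'" using y0 by (intro key)
      then have "y \<le> D powr r' * ?V" using V by (simp add: field_simps)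
      then show ?thesis using y by (simp add: ennreal_leI)
    qed
  qed
  then have "(SUP n. X n) \<le> ennreal (D powr r' * ?V)" by (rule SUP_least)
  moreover have "(SUP n. X n) = (\<integral>\<^sup>+z. (SUP n. ennreal (u z powr r') * indicator (A n) z) \<partial>lborel)"
    unfolding X_def
    by (rule nn_integral_monotone_convergence_SUP[symmetric])
       (auto simp: incseq_def le_fun_def A_def indicator_def)
  moreover have "(SUP n. ennreal (u z powr r') * indicator (A n) z) = epow (ennreal (u z)) r' * indicator (wbox t x) z" for z
  proof (rule antisym)
    show "(SUP n. ennreal (u z powr r') * indicator (A n) z) \<le> epow (ennreal (u z)) r' * indicator (wbox t x) z"
      using u0 by (intro SUP_least) (auto simp: A_def indicator_def epow_ennreal)
    obtain n :: nat where "u z \<le> real n" using real_arch_simple by blast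
    then have "epow (ennreal (u z)) r' * indicator (wbox t x) z \<le> ennreal (u z powr r') * indicator (A n) z"
      using u0 by (auto simp: A_def indicator_def epow_ennreal)
    also have "\<dots> \<le> (SUP n. ennreal (u z powr r') * indicator (A n) z)"
      by (rule SUP_upper) simp
    finally show "epow (ennreal (u z)) r' * indicator (wbox t x) z \<le> (SUP n. ennreal (u z powr r') * indicator (A n) z)" .
  qed
  ultimately have "(\<integral>\<^sup>+z\<in>wbox t x. epow (ennreal (u z)) r' \<partial>lborel) \<le> ennreal (D powr r' * ?V)"
    by simp
  then have "(\<integral>\<^sup>+z\<in>wbox t x. epow (ennreal (u z)) r' \<partial>lborel) / ennreal ?V \<le> ennreal (D powr r' * ?V) / ennreal ?V"
    by (rule divide_right_mono_ennreal)
  also have "\<dots> = ennreal (D powr r')" using V by (simp add: divide_ennreal)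
  finally have "box_mean r' (\<lambda>z. ennreal (u z)) (wbox t x) t \<le> epow (ennreal (D powr r')) (1/r')"
    unfolding box_mean_def using r' by (intro epow_mono) auto
  also have "\<dots> = ennreal D" using D r' by (simp add: epow_ennreal powr_powr)
  finally show ?thesis unfolding r'_def .
qed

text \<open>The converse Hoelder inequality for the dual exponent infinity. If \<open>u\<close>
  exceeded \<open>D\<close> by a fixed margin on a subset of the box of positive measure, the
  indicator of that subset would violate the premise.\<close>

lemma AE_le_of_self_bound:
  fixes u :: "real \<times> 'a::euclidean_space \<Rightarrow> real"
  assumes u[measurable]: "u \<in> borel_measurable borel" and t: "0 < t" and D: "0 \<le> D"
    and self: "\<And>(n::nat) A. A \<in> sets borel \<Longrightarrow> A \<subseteq> {z \<in> wbox t x. u z \<le> n} \<Longrightarrow>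
      (\<integral>\<^sup>+z. ennreal (u z) * indicator A z \<partial>lborel) \<le> ennreal D * emeasure lborel A"
  shows "AE z in lborel. z \<in> wbox t x \<longrightarrow> u z \<le> D"
proof -
  define A where "A n = {z \<in> wbox t x. D + 1 / Suc n \<le> u z \<and> u z \<le> real n}" for n
  have A[measurable]: "A n \<in> sets borel" for n unfolding A_def by measurable
  have null: "A n \<in> null_sets lborel" for n
  proof -
    have "bounded (A n)" by (rule bounded_subset[OF wbox_bounded[of t x]]) (auto simp: A_def)
    then have "emeasure lborel (A n) < \<infinity>" by (rule emeasure_bounded_finite)
    then obtain m where m: "emeasure lborel (A n) = ennreal m" "0 \<le> m"
      by (cases "emeasure lborel (A n)") auto
    have "ennreal (D + 1 / Suc n) * emeasure lborel (A n) = (\<integral>\<^sup>+z. ennreal (D + 1 / Suc n) * indicator (A n) z \<partial>lborel)"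
      by (rule nn_integral_cmult_indicator[symmetric]) simp
    also have "\<dots> \<le> (\<integral>\<^sup>+z. ennreal (u z) * indicator (A n) z \<partial>lborel)"
      by (intro nn_integral_mono) (auto simp: A_def indicator_def intro!: ennreal_leI)
    also have "\<dots> \<le> ennreal D * emeasure lborel (A n)"
      by (rule self[of _ n]) (auto simp: A_def)
    finally have "ennreal ((D + 1 / Suc n) * m) \<le> ennreal (D * m)"
      unfolding m(1) using ennreal_mult[of "D + 1 / Suc n" m] ennreal_mult[of D m] m D by simp
    then have "(D + 1 / Suc n) * m \<le> D * m"
      using m D by (subst (asm) ennreal_le_iff) auto
    then have "m = 0" using m by (simp add: algebra_simps divide_le_0_iff)
    then show ?thesis using m by (simp add: null_sets_def)
  qed
  have "AE z in lborel. \<forall>n. z \<notin> A n"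
    unfolding AE_all_countable using null by (auto intro: AE_not_in)
  then show ?thesis
  proof eventually_elim
    case (elim z)
    show ?case
    proof (intro impI, rule ccontr)
      assume z: "z \<in> wbox t x" "\<not> u z \<le> D"
      then obtain k where k: "1 / Suc k < u z - D"
        using nat_approx_posE[of "u z - D"] by auto
      obtain l :: nat where l: "u z \<le> real l" using real_arch_simple by blast
      \<comment> \<open>One index serves both as margin \<open>1 / Suc n\<close> and as cutoff,
        hence the maximum.\<close>
      define n where "n = max k l"
      have "1 / Suc n \<le> 1 / Suc k" by (simp add: n_def frac_le)
      then have "D + 1 / Suc n \<le> u z" "u z \<le> real n" using k l by (auto simp: n_def)
      then show False using elim z by (auto simp: A_def)
    qed
  qed
qed

text \<open>Every box is tested: with indicators if \<open>r = 1\<close>, and otherwise with a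
  truncated power of the weighted modulus of \<open>f\<close> itself. \<open>Z_norm_le\<close> then
  passes from the boxes to the essential suprema.\<close>

lemma Z_norm_le_of_pairing_bounded:
  fixes p q r \<beta> :: real
  assumes p: "0 < p" "p < 1" and q: "0 < q" and r: "1 \<le> r"
  obtains C where "0 < C"
    "\<And>(f :: real \<times> 'a::euclidean_space \<Rightarrow> complex) M. f \<in> borel_measurable borel \<Longrightarrow> pairing_bounded p q r \<beta> M f \<Longrightarrow> 0 \<le> M \<Longrightarrow>
      Z_norm (conj_exponent r) (- \<beta> + real DIM('a) * (1 / p - 1)) f \<le> ennreal (C * M)"
proof -
  let ?\<gamma> = "- \<beta> + real DIM('a) * (1 / p - 1)"
  show thesis
  proof (rule pairing_bounded_box[OF p q r, where 'a='a and \<beta>=\<beta>], goal_cases)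
    case C: (1 C)
    show ?case
    proof (rule that[OF C(1)])
    fix f :: "real \<times> 'a \<Rightarrow> complex" and M :: real
    assume f[measurable]: "f \<in> borel_measurable borel" and pb: "pairing_bounded p q r \<beta> M f" and M: "0 \<le> M"
    let ?u = "weighted_real ?\<gamma> f"
    have CM: "0 \<le> C * M" using C(1) M by simp
    have "Z_norm (conj_exponent r) ?\<gamma> f \<le> ennreal (C * M)"
    proof (rule Z_norm_le[OF f])
      show "conj_exponent r = \<infinity> \<or> (\<exists>\<rho>>0. conj_exponent r = ennreal \<rho>)"
        using r by (cases "r = 1") (auto simp: conj_exponent_def intro!: exI[of _ "r / (r - 1)"])
      fix t :: real and x :: 'a assume t: "0 < t"
      show "W_avg (conj_exponent r) ?\<gamma> f t x \<le> ennreal (C * M)"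
      proof (cases "r = 1")
        case True
        have "AE z in lborel. z \<in> wbox t x \<longrightarrow> ?u z \<le> C * M"
        proof (rule AE_le_of_self_bound[OF _ t CM])
          fix n :: nat and A assume A[measurable]: "A \<in> sets borel" and sub: "A \<subseteq> {z \<in> wbox t x. ?u z \<le> real n}"
          have "(\<integral>\<^sup>+z. ennreal (?u z) * indicator A z \<partial>lborel) = (\<integral>\<^sup>+z. ennreal (?u z * indicator A z) \<partial>lborel)"
            by (intro nn_integral_cong) (auto simp: indicator_def)
          also have "\<dots> \<le> ennreal (C * M * wvol TYPE('a) t) * epow ((\<integral>\<^sup>+z. epow (ennreal (indicator A z)) r \<partial>lborel) / ennreal (wvol TYPE('a) t)) (1/r)"
            by (rule C(2)[OF f pb M t, where B=1 and n="real n"]) (use sub in \<open>auto simp: indicator_def split: if_splits\<close>)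
          also have "(\<integral>\<^sup>+z. epow (ennreal (indicator A z)) r \<partial>lborel) = emeasure lborel A"
            using True by (simp add: ennreal_indicator)
          also have "ennreal (C * M * wvol TYPE('a) t) * epow (emeasure lborel A / ennreal (wvol TYPE('a) t)) (1/r)
            = ennreal (C * M) * (ennreal (wvol TYPE('a) t) * (emeasure lborel A / ennreal (wvol TYPE('a) t)))"
            unfolding ennreal_mult'[OF CM] True div_by_1 epow_1 by (rule mult.assoc)
          also have "\<dots> = ennreal (C * M) * emeasure lborel A"
            by (simp only: ennreal_mult_divide_cancel[OF wvol_pos[OF t]])
          finally show "(\<integral>\<^sup>+z. ennreal (?u z) * indicator A z \<partial>lborel) \<le> ennreal (C * M) * emeasure lborel A" .
        qed measurable
        then have "AE z in lborel. z \<in> wbox t x \<longrightarrow> weighted ?\<gamma> f z \<le> ennreal (C * M)"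
          unfolding weighted_eq by (auto elim!: eventually_mono intro: ennreal_leI)
        then show ?thesis
          using True W_avg_top_le_iff[OF borel_measurable_hs[OF f] t] by (simp add: conj_exponent_def)
      next
        case False
        then have r1: "1 < r" using r by simp
        then have r': "0 < r / (r - 1)" "0 < r / (r - 1) - 1" by (auto simp: field_simps)
        have "box_mean (r/(r-1)) (\<lambda>z. ennreal (?u z)) (wbox t x) t \<le> ennreal (C * M)"
        proof (rule box_mean_le_of_self_bound[OF _ _ r1 t CM])
          fix n :: nat
          let ?A = "{z \<in> wbox t x. ?u z \<le> real n}"
          have "?A \<in> sets borel" by measurable
          then have m: "(\<lambda>z. ?u z powr (r/(r-1) - 1) * indicator ?A z) \<in> borel_measurable borel" by simp
          show "(\<integral>\<^sup>+z. ennreal (?u z * (?u z powr (r/(r-1) - 1) * indicator ?A z)) \<partial>lborel) \<le>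
            ennreal (C * M * wvol TYPE('a) t) * epow ((\<integral>\<^sup>+z. epow (ennreal (?u z powr (r/(r-1) - 1) * indicator ?A z)) r \<partial>lborel) / ennreal (wvol TYPE('a) t)) (1/r)"
          proof (rule C(2)[OF f pb M t m, where B="real n powr (r/(r-1) - 1)" and n="real n"])
            show "?u z powr (r/(r-1) - 1) * indicator ?A z \<le> real n powr (r/(r-1) - 1)" for z
              using r' by (auto simp: indicator_def intro!: powr_mono2)
          qed (auto simp: indicator_def split: if_splits)
        qed auto
        then show ?thesis
          using r1 r' t False by (simp add: conj_exponent_def W_avg_eq weighted_eq[abs_def])
      qed
    qed
    then show "Z_norm (conj_exponent r) ?\<gamma> f \<le> ennreal (C * M)" .
    qed
  qed
qed

section \<open>Densities of signed set functions\<close>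

lemma additive_sum:
  fixes \<nu> :: "'a set \<Rightarrow> real" and A :: "nat \<Rightarrow> 'a set" and n :: nat
  assumes add: "\<And>A B. A \<in> sets M \<Longrightarrow> B \<in> sets M \<Longrightarrow> A \<inter> B = {} \<Longrightarrow> \<nu> (A \<union> B) = \<nu> A + \<nu> B"
    and A: "\<And>i. A i \<in> sets M" "disjoint_family A"
  shows "\<nu> (\<Union>i<n. A i) = (\<Sum>i<n. \<nu> (A i))"
proof (induction n)
  case 0
  show ?case using add[of "{}" "{}"] by simp
next
  case (Suc n)
  have "A i \<inter> A n = {}" if "i < n" for i
    using A(2) that by (simp add: disjoint_family_on_def)
  then have "(\<Union>i<n. A i) \<inter> A n = {}" by blast
  then have "\<nu> ((\<Union>i<n. A i) \<union> A n) = \<nu> (\<Union>i<n. A i) + \<nu> (A n)"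
    using A(1) by (intro add) auto
  also have "(\<Union>i<n. A i) \<union> A n = (\<Union>i<Suc n. A i)"
    by (auto simp: lessThan_Suc)
  finally show ?case using Suc by simp
qed

text \<open>The power bound is used twice. The tails \<open>R n\<close> of a disjoint union have
  measure tending to 0, so \<open>\<nu> (R n)\<close> tends to 0 and finite additivity becomes
  countable; and \<open>\<nu>\<close> vanishes on null sets, which is absolute continuity.\<close>

lemma Radon_Nikodym_power_bound_nonneg:
  fixes \<nu> :: "'a set \<Rightarrow> real"
  assumes M: "finite_measure M"
    and add: "\<And>A B. A \<in> sets M \<Longrightarrow> B \<in> sets M \<Longrightarrow> A \<inter> B = {} \<Longrightarrow> \<nu> (A \<union> B) = \<nu> A + \<nu> B"
    and nonneg: "\<And>A. A \<in> sets M \<Longrightarrow> 0 \<le> \<nu> A"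
    and bound: "\<And>A. A \<in> sets M \<Longrightarrow> \<nu> A \<le> c * measure M A powr a" and a: "0 < a"
  obtains f :: "'a \<Rightarrow> real" where "integrable M f" "\<And>A. A \<in> sets M \<Longrightarrow> \<nu> A = (\<integral>x. indicator A x * f x \<partial>M)"
proof -
  interpret finite_measure M by fact
  have empty: "\<nu> {} = 0" using add[of "{}" "{}"] by simp
  have ca: "countably_additive (sets M) (\<lambda>A. ennreal (\<nu> A))"
  proof (unfold countably_additive_def, intro allI impI)
    fix A :: "nat \<Rightarrow> 'a set"
    assume A: "range A \<subseteq> sets M" "disjoint_family A" "\<Union> (range A) \<in> sets M"
    then have [measurable]: "A i \<in> sets M" for i by auto
    define R where "R n = (\<Union>i. A i) - (\<Union>i<n. A i)" for n
    have [measurable]: "R n \<in> sets M" for n unfolding R_def by measurable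
    have split: "\<nu> (\<Union>i. A i) = (\<Sum>i<n. \<nu> (A i)) + \<nu> (R n)" for n
    proof -
      have "(\<Union>i<n. A i) \<union> R n = (\<Union>i. A i)" by (auto simp: R_def)
      moreover have "\<nu> ((\<Union>i<n. A i) \<union> R n) = \<nu> (\<Union>i<n. A i) + \<nu> (R n)"
        by (intro add) (auto simp: R_def)
      moreover have "\<nu> (\<Union>i<n. A i) = (\<Sum>i<n. \<nu> (A i))"
        by (rule additive_sum[OF add]) (use A(2) in auto)
      ultimately show ?thesis by simp
    qed
    have "(\<lambda>n. measure M (R n)) \<longlonglongrightarrow> measure M (\<Inter>n. R n)"
      by (rule finite_Lim_measure_decseq) (auto simp: R_def decseq_def)
    moreover have "(\<Inter>n. R n) = {}" by (auto simp: R_def)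
    ultimately have "(\<lambda>n. measure M (R n)) \<longlonglongrightarrow> 0" by simp
    then have "(\<lambda>n. c * measure M (R n) powr a) \<longlonglongrightarrow> c * 0 powr a"
      using a by (intro tendsto_intros tendsto_powr') auto
    then have "(\<lambda>n. \<nu> (R n)) \<longlonglongrightarrow> 0"
      using a by (intro tendsto_sandwich[of "\<lambda>_. 0" "\<lambda>n. \<nu> (R n)" sequentially "\<lambda>n. c * measure M (R n) powr a" 0])
        (auto intro!: always_eventually nonneg bound)
    then have *: "(\<lambda>n. \<nu> (\<Union>i. A i) - \<nu> (R n)) \<longlonglongrightarrow> \<nu> (\<Union>i. A i) - 0"
      by (intro tendsto_intros)
    have "(\<lambda>i. \<nu> (A i)) sums \<nu> (\<Union>i. A i)"
    proof -
      have "(\<Sum>i<n. \<nu> (A i)) = \<nu> (\<Union>i. A i) - \<nu> (R n)" for n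
        using split[of n] by simp
      then show ?thesis unfolding sums_def using * by simp
    qed
    then show "(\<Sum>i. ennreal (\<nu> (A i))) = ennreal (\<nu> (\<Union> (range A)))"
      using nonneg by (intro suminf_ennreal_eq) auto
  qed
  define N where "N = measure_of (space M) (sets M) (\<lambda>A. ennreal (\<nu> A))"
  have sN [simp]: "sets N = sets M" by (simp add: N_def sets.space_closed)
  have eN: "emeasure N A = ennreal (\<nu> A)" if "A \<in> sets M" for A
    unfolding N_def
    by (rule emeasure_measure_of_sigma[OF sets.sigma_algebra_axioms _ ca that])
       (simp add: positive_def empty)
  have ac: "absolutely_continuous M N"
    unfolding absolutely_continuous_def
  proof
    fix A assume A: "A \<in> null_sets M"
    then have "measure M A = 0" by (simp add: measure_def null_setsD1)
    then have "\<nu> A = 0" using A bound[of A] nonneg[of A] by auto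
    then show "A \<in> null_sets N" using A by (auto simp: null_sets_def eN)
  qed
  obtain f where f[measurable]: "f \<in> borel_measurable M" and fN: "density M f = N"
    using Radon_Nikodym[OF ac] by auto
  have int: "(\<integral>\<^sup>+x\<in>A. f x \<partial>M) = ennreal (\<nu> A)" if "A \<in> sets M" for A
    using that eN[OF that] emeasure_density[OF f that] unfolding fN by simp
  have fin: "(\<integral>\<^sup>+x. f x \<partial>M) < top"
  proof -
    have "(\<integral>\<^sup>+x. f x \<partial>M) = (\<integral>\<^sup>+x\<in>space M. f x \<partial>M)"
      by (intro nn_integral_cong) auto
    then show ?thesis using int[of "space M"] by simp
  qed
  have "AE x in M. f x \<noteq> \<infinity>"
    using fin by (intro nn_integral_PInf_AE) auto
  then have ae: "AE x in M. ennreal (enn2real (f x)) = f x"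
    by eventually_elim (auto simp: less_top)
  have "integrable M (\<lambda>x. enn2real (f x))"
  proof (rule integrableI_nonneg)
    have "(\<integral>\<^sup>+x. ennreal (enn2real (f x)) \<partial>M) = (\<integral>\<^sup>+x. f x \<partial>M)"
      using ae by (rule nn_integral_cong_AE)
    then show "(\<integral>\<^sup>+x. ennreal (enn2real (f x)) \<partial>M) < \<infinity>" using fin by simp
  qed auto
  moreover have "\<nu> A = (\<integral>x. indicator A x * enn2real (f x) \<partial>M)" if A: "A \<in> sets M" for A
  proof -
    have "(\<integral>\<^sup>+x. ennreal (indicator A x * enn2real (f x)) \<partial>M) = (\<integral>\<^sup>+x\<in>A. f x \<partial>M)"
    proof (rule nn_integral_cong_AE)
      show "AE x in M. ennreal (indicator A x * enn2real (f x)) = f x * indicator A x"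
        using ae by eventually_elim (auto simp: indicator_def)
    qed
    also have "\<dots> = ennreal (\<nu> A)" by (rule int[OF A])
    finally have "(\<integral>\<^sup>+x. ennreal (indicator A x * enn2real (f x)) \<partial>M) = ennreal (\<nu> A)" .
    then show ?thesis
      using A nonneg[OF A] by (subst integral_eq_nn_integral) auto
  qed
  ultimately show thesis by (rule that)
qed

text \<open>The positive part of the set function in Jordan's decomposition inherits additivity and the power
  bound, and the power bound yields countable additivity.\<close>

lemma Radon_Nikodym_power_bound:
  fixes \<nu> :: "'a set \<Rightarrow> real"
  assumes M: "finite_measure M"
    and add: "\<And>A B. A \<in> sets M \<Longrightarrow> B \<in> sets M \<Longrightarrow> A \<inter> B = {} \<Longrightarrow> \<nu> (A \<union> B) = \<nu> A + \<nu> B"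
    and bound: "\<And>A. A \<in> sets M \<Longrightarrow> \<bar>\<nu> A\<bar> \<le> c * measure M A powr a" and a: "0 < a" and c: "0 \<le> c"
  obtains f :: "'a \<Rightarrow> real" where "integrable M f" "\<And>A. A \<in> sets M \<Longrightarrow> \<nu> A = (\<integral>x. indicator A x * f x \<partial>M)"
proof -
  interpret finite_measure M by fact
  have empty: "\<nu> {} = 0" using add[of "{}" "{}"] by simp
  \<comment> \<open>\<open>P A\<close> is the supremum of \<open>\<nu>\<close> over the measurable
    subsets of \<open>A\<close>. Then \<open>P - \<nu>\<close> is the negative part, and both parts
    fall under the nonnegative case.\<close>
  define S where "S A = \<nu> ` {B \<in> sets M. B \<subseteq> A}" for A
  define P where "P A = Sup (S A)" for A
  have le: "\<nu> B \<le> c * measure M A powr a" if "A \<in> sets M" "B \<in> sets M" "B \<subseteq> A" for A B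
  proof -
    have "\<nu> B \<le> c * measure M B powr a" using bound[OF that(2)] by simp
    also have "\<dots> \<le> c * measure M A powr a"
      using that a c by (intro mult_left_mono powr_mono2 finite_measure_mono) auto
    finally show ?thesis .
  qed
  have ne: "S A \<noteq> {}" for A by (auto simp: S_def)
  have bdd: "bdd_above (S A)" if "A \<in> sets M" for A
    using le[OF that] by (auto simp: S_def bdd_above_def)
  have upper: "\<nu> B \<le> P A" if "A \<in> sets M" "B \<in> sets M" "B \<subseteq> A" for A B
    unfolding P_def using that by (intro cSup_upper bdd) (auto simp: S_def)
  have P0: "0 \<le> P A" if "A \<in> sets M" for A
    using upper[OF that, of "{}"] empty by simp
  have Pb: "P A \<le> c * measure M A powr a" if "A \<in> sets M" for A
    unfolding P_def using le[OF that] by (intro cSup_least ne) (auto simp: S_def)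
  have Padd: "P (A \<union> B) = P A + P B" if A: "A \<in> sets M" and B: "B \<in> sets M" and AB: "A \<inter> B = {}" for A B
  proof (rule antisym)
    show "P (A \<union> B) \<le> P A + P B"
      unfolding P_def[of "A \<union> B"]
    proof (intro cSup_least ne)
      fix y assume "y \<in> S (A \<union> B)"
      then obtain E where E: "E \<in> sets M" "E \<subseteq> A \<union> B" "y = \<nu> E" by (auto simp: S_def)
      then have "E = (E \<inter> A) \<union> (E \<inter> B)" by auto
      then have "\<nu> E = \<nu> (E \<inter> A) + \<nu> (E \<inter> B)"
        using E(1) A B AB add[of "E \<inter> A" "E \<inter> B"] by auto
      also have "\<dots> \<le> P A + P B"
        using E A B by (intro add_mono upper) auto
      finally show "y \<le> P A + P B" using E by simp
    qed
    have "P A \<le> P (A \<union> B) - P B"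
      unfolding P_def[of A]
    proof (intro cSup_least ne)
      fix y assume "y \<in> S A"
      then obtain E where E: "E \<in> sets M" "E \<subseteq> A" "y = \<nu> E" by (auto simp: S_def)
      have "P B \<le> P (A \<union> B) - y"
        unfolding P_def[of B]
      proof (intro cSup_least ne)
        fix y' assume "y' \<in> S B"
        then obtain E' where E': "E' \<in> sets M" "E' \<subseteq> B" "y' = \<nu> E'" by (auto simp: S_def)
        have "\<nu> (E \<union> E') = \<nu> E + \<nu> E'"
          using E E' AB by (intro add) auto
        moreover have "\<nu> (E \<union> E') \<le> P (A \<union> B)"
          using E E' A B by (intro upper) auto
        ultimately show "y' \<le> P (A \<union> B) - y" using E E' by simp
      qed
      then show "y \<le> P (A \<union> B) - P B" by simp
    qed
    then show "P A + P B \<le> P (A \<union> B)" by simp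
  qed
  obtain f1 where f1: "integrable M f1" "\<And>A. A \<in> sets M \<Longrightarrow> P A = (\<integral>x. indicator A x * f1 x \<partial>M)"
    by (rule Radon_Nikodym_power_bound_nonneg[OF M Padd P0 Pb a]) auto
  have 2: "P A - \<nu> A \<le> (2 * c) * measure M A powr a" if "A \<in> sets M" for A
    using Pb[OF that] bound[OF that] by simp
  have 3: "P (A \<union> B) - \<nu> (A \<union> B) = (P A - \<nu> A) + (P B - \<nu> B)"
    if "A \<in> sets M" "B \<in> sets M" "A \<inter> B = {}" for A B
    using Padd[OF that] add[OF that] by simp
  have 4: "0 \<le> P A - \<nu> A" if "A \<in> sets M" for A
    using upper[OF that that] by simp
  obtain f2 where f2: "integrable M f2" "\<And>A. A \<in> sets M \<Longrightarrow> P A - \<nu> A = (\<integral>x. indicator A x * f2 x \<partial>M)"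
    by (rule Radon_Nikodym_power_bound_nonneg[OF M 3 4 2 a]) auto
  show thesis
  proof
    show "integrable M (\<lambda>x. f1 x - f2 x)" using f1 f2 by simp
    fix A assume A: "A \<in> sets M"
    have "integrable M (\<lambda>x. indicator A x * f1 x)" "integrable M (\<lambda>x. indicator A x * f2 x)"
      using integrable_mult_indicator[OF A f1(1)] integrable_mult_indicator[OF A f2(1)] by simp_all
    then show "\<nu> A = (\<integral>x. indicator A x * (f1 x - f2 x) \<partial>M)"
      using f1(2)[OF A] f2(2)[OF A] by (simp add: right_diff_distrib)
  qed
qed

section \<open>The pairing as an integral over the half-space\<close>

lemma borel_measurable_lebesgue_AE_cong:
  fixes u v :: "'c::euclidean_space \<Rightarrow> 'b::topological_space"
  assumes v: "v \<in> borel_measurable lborel" and ae: "AE x in lborel. u x = v x"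
  shows "u \<in> borel_measurable lebesgue"
proof (rule measurableI)
  fix A :: "'b set" assume A: "A \<in> sets borel"
  show "u -` A \<inter> space lebesgue \<in> sets lebesgue"
  proof (rule completion.in_sets_AE)
    show "AE x in lebesgue. x \<in> v -` A \<inter> space lebesgue \<longleftrightarrow> x \<in> u -` A \<inter> space lebesgue"
      using ae unfolding AE_completion_iff by eventually_elim auto
    show "v -` A \<inter> space lebesgue \<in> sets lebesgue"
      using measurable_completion[OF v] A by (rule measurable_sets)
  qed auto
qed simp

lemma integral_lebesgue_AE_eq:
  fixes u v :: "'c::euclidean_space \<Rightarrow> 'b::{banach, second_countable_topology}"
  assumes v: "v \<in> borel_measurable lborel" and ae: "AE x in lborel. u x = v x"
  shows "integral\<^sup>L lebesgue u = integral\<^sup>L lborel v"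
proof -
  have "integral\<^sup>L lebesgue u = integral\<^sup>L lebesgue v"
    using borel_measurable_lebesgue_AE_cong[OF v ae] measurable_completion[OF v] ae
    by (intro integral_cong_AE) (auto simp: AE_completion_iff)
  then show ?thesis using v by (simp add: integral_completion)
qed

definition pairing_nn :: "(real \<times> 'a::euclidean_space \<Rightarrow> complex) \<Rightarrow> (real \<times> 'a \<Rightarrow> complex) \<Rightarrow> ennreal" where
  "pairing_nn f g = (\<integral>\<^sup>+z\<in>half_space. (ennreal (cmod (f z) * cmod (g z)) / ennreal (fst z)) \<partial>lborel)"

lemma pairing_integrand_measurable:
  assumes [measurable]: "f \<in> borel_measurable borel" "g \<in> borel_measurable borel"
  shows "(\<lambda>z. indicator half_space z *\<^sub>R (f z * cnj (g z) / of_real (fst z))) \<in> borel_measurable borel"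
  by measurable

lemma pairing_integrable:
  assumes f: "f \<in> borel_measurable borel" and g: "g \<in> borel_measurable borel" and fin: "pairing_nn f g < top"
  shows "integrable lborel (\<lambda>z. indicator half_space z *\<^sub>R (f z * cnj (g z) / of_real (fst z)))"
proof (rule integrableI_bounded)
  have "(\<integral>\<^sup>+z. ennreal (norm (indicator half_space z *\<^sub>R (f z * cnj (g z) / of_real (fst z)))) \<partial>lborel) = pairing_nn f g"
    unfolding pairing_nn_def
    by (intro nn_integral_cong) (auto simp: indicator_def norm_mult norm_divide divide_ennreal)
  then show "(\<integral>\<^sup>+z. ennreal (norm (indicator half_space z *\<^sub>R (f z * cnj (g z) / of_real (fst z)))) \<partial>lborel) < \<infinity>"
    using fin by simp
qed (use pairing_integrand_measurable[OF f g] in simp)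

lemma norm_pairing_int_le:
  assumes f: "f \<in> borel_measurable borel" and g: "g \<in> borel_measurable borel"
  shows "ennreal (cmod (pairing_int f g)) \<le> pairing_nn f g"
proof (cases "pairing_nn f g < top")
  case True
  have "ennreal (cmod (pairing_int f g)) \<le>
    (\<integral>\<^sup>+z. ennreal (norm (indicator half_space z *\<^sub>R (f z * cnj (g z) / of_real (fst z)))) \<partial>lborel)"
    unfolding pairing_int_def by (rule integral_norm_bound_ennreal[OF pairing_integrable[OF f g True]])
  also have "\<dots> = pairing_nn f g"
    unfolding pairing_nn_def
    by (intro nn_integral_cong) (auto simp: indicator_def norm_mult norm_divide divide_ennreal)
  finally show ?thesis .
next
  case False
  then show ?thesis using top.not_eq_extremum by fastforce
qed

text \<open>Fubini's theorem for the representatives, whose absolute integrability is the finiteness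
  of \<open>pairing_nn\<close>. The functions \<open>f\<close> and \<open>g\<close> are only known
  to agree with them on almost every section, which is enough for both Lebesgue integrals.\<close>

lemma L2_pairing_eq:
  fixes f g f' g' :: "real \<times> 'a::euclidean_space \<Rightarrow> complex"
  assumes f': "f' \<in> borel_measurable borel" "hs_eq f f'" and g': "g' \<in> borel_measurable borel" "hs_eq g g'"
    and fin: "pairing_nn f' g' < top"
  shows "L2_pairing f g = pairing_int f' g'"
proof -
  define k where "k z = indicator half_space z *\<^sub>R (f' z * cnj (g' z) / of_real (fst z))" for z
  have km[measurable]: "k \<in> borel_measurable borel"
    unfolding k_def by (rule pairing_integrand_measurable[OF f'(1) g'(1)])
  have ki: "integrable lborel k"
    unfolding k_def by (rule pairing_integrable[OF f'(1) g'(1) fin])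
  then have ki': "integrable (lborel \<Otimes>\<^sub>M lborel) (\<lambda>(s, y). k (s, y))"
    by (simp add: lborel_prod)
  have "AE z in lborel. (0 < fst z \<longrightarrow> f z = f' z) \<and> (0 < fst z \<longrightarrow> g z = g' z)"
    using f'(2) g'(2) unfolding hs_eq_def by eventually_elim simp
  from AE_lborel_pair[OF this]
  have ae: "AE s in lborel. AE y in lborel. 0 < s \<longrightarrow> f (s, y) = f' (s, y) \<and> g (s, y) = g' (s, y)"
    by (elim eventually_mono) auto
  have sec: "(\<lambda>y. k (s, y)) \<in> borel_measurable lborel" for s
  proof -
    from measurable_compose[OF Pair_borel_measurable(1) km] show ?thesis by simp
  qed
  have "AE s in lborel. indicator {0<..} s *\<^sub>R ((\<integral>y. f (s, y) * cnj (g (s, y)) \<partial>lebesgue) / complex_of_real s) = (\<integral>y. k (s, y) \<partial>lborel)"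
    using ae
  proof eventually_elim
    case (elim s)
    show ?case
    proof (cases "0 < s")
      case True
      have "(\<integral>y. f (s, y) * cnj (g (s, y)) \<partial>lebesgue) = (\<integral>y. of_real s * k (s, y) \<partial>lborel)"
      proof (rule integral_lebesgue_AE_eq)
        show "AE y in lborel. f (s, y) * cnj (g (s, y)) = of_real s * k (s, y)"
          using elim by (rule eventually_mono) (use True in \<open>auto simp: k_def\<close>)
        show "(\<lambda>y. of_real s * k (s, y)) \<in> borel_measurable lborel"
          using sec by measurable
      qed
      then show ?thesis using True by simp
    qed (simp add: k_def)
  qed
  then have "L2_pairing f g = (\<integral>s. \<integral>y. k (s, y) \<partial>lborel \<partial>lborel)"
    unfolding L2_pairing_def set_lebesgue_integral_def
  proof (rule integral_lebesgue_AE_eq[rotated])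
    have "case_prod (\<lambda>s y. k (s, y)) \<in> borel_measurable (lborel \<Otimes>\<^sub>M lborel)"
      by (simp add: lborel_prod)
    then show "(\<lambda>s. \<integral>y. k (s, y) \<partial>lborel) \<in> borel_measurable lborel"
      by (rule lborel.borel_measurable_lebesgue_integral)
  qed
  also have "\<dots> = (\<integral>z. k z \<partial>lborel)"
    using lborel_pair.integral_fst'[OF ki'[unfolded split_def prod.collapse]] by (simp add: lborel_prod)
  finally show ?thesis unfolding pairing_int_def k_def .
qed

text \<open>The counterpart of \<open>L2_pairing_eq\<close> by Tonelli's theorem; with a nonnegative
  integrand no finiteness is involved.\<close>

lemma pairing_lhs_eq:
  fixes f g f' g' :: "real \<times> 'a::euclidean_space \<Rightarrow> complex"
  assumes f': "f' \<in> borel_measurable borel" "hs_eq f f'" and g': "g' \<in> borel_measurable borel" "hs_eq g g'"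
  shows "(\<integral>\<^sup>+s\<in>{0<..}. ((\<integral>\<^sup>+y. ennreal (cmod (f (s, y)) * cmod (g (s, y))) \<partial>lebesgue) / ennreal s) \<partial>lebesgue)
    = pairing_nn f' g'"
proof -
  note [measurable] = f'(1) g'(1)
  let ?h = "\<lambda>z. ennreal (cmod (f' z) * cmod (g' z)) / ennreal (fst z) * indicator half_space z"
  have "AE z in lborel. (0 < fst z \<longrightarrow> f z = f' z) \<and> (0 < fst z \<longrightarrow> g z = g' z)"
    using f'(2) g'(2) unfolding hs_eq_def by eventually_elim simp
  from AE_lborel_pair[OF this]
  have ae: "AE s in lborel. AE y in lborel. 0 < s \<longrightarrow> f (s, y) = f' (s, y) \<and> g (s, y) = g' (s, y)"
    by (elim eventually_mono) auto
  have "(\<integral>\<^sup>+s\<in>{0<..}. ((\<integral>\<^sup>+y. ennreal (cmod (f (s, y)) * cmod (g (s, y))) \<partial>lebesgue) / ennreal s) \<partial>lebesgue)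
    = (\<integral>\<^sup>+s. (\<integral>\<^sup>+y. ?h (s, y) \<partial>lborel) \<partial>lborel)"
    unfolding nn_integral_completion
  proof (rule nn_integral_cong_AE)
    show "AE s in lborel. (\<integral>\<^sup>+y. ennreal (cmod (f (s, y)) * cmod (g (s, y))) \<partial>lborel) / ennreal s * indicator {0<..} s
      = (\<integral>\<^sup>+y. ?h (s, y) \<partial>lborel)"
      using ae
    proof eventually_elim
      case (elim s)
      show ?case
      proof (cases "0 < s")
        case True
        have "(\<integral>\<^sup>+y. ennreal (cmod (f (s, y)) * cmod (g (s, y))) \<partial>lborel) = (\<integral>\<^sup>+y. ennreal (cmod (f' (s, y)) * cmod (g' (s, y))) \<partial>lborel)"
          by (rule nn_integral_cong_AE) (rule eventually_mono[OF elim], use True in simp)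
        moreover have "(\<lambda>y. (s, y)) \<in> borel \<rightarrow>\<^sub>M borel"
          by (intro borel_measurable_continuous_onI continuous_intros)
        then have "(\<lambda>y. ennreal (cmod (f' (s, y)) * cmod (g' (s, y)))) \<in> borel_measurable borel"
          by measurable
        ultimately show ?thesis
          using True by (simp add: nn_integral_divide)
      qed simp
    qed
  qed
  also have "\<dots> = pairing_nn f' g'"
    unfolding pairing_nn_def by (rule nn_integral_lborel_Pair) measurable
  finally show ?thesis .
qed

section \<open>Linear structure of the tent space and its test functions\<close>

lemma hs_eq_refl [simp]: "hs_eq f f"
  by (simp add: hs_eq_def)

lemma hs_eq_add:
  assumes "hs_eq f f'" "hs_eq g g'"
  shows "hs_eq (\<lambda>z. f z + g z) (\<lambda>z. f' z + g' z)"
  using assms unfolding hs_eq_def by eventually_elim simp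

lemma measurable_hs_add: "measurable_hs f \<Longrightarrow> measurable_hs g \<Longrightarrow> measurable_hs (\<lambda>z. f z + g z)"
  by (rule borel_measurable_add)

lemma measurable_hs_cmult: "measurable_hs g \<Longrightarrow> measurable_hs (\<lambda>z. c * g z)"
  by (intro borel_measurable_times borel_measurable_const)

lemma hs_eq_cmult: "hs_eq f f' \<Longrightarrow> hs_eq (\<lambda>z. c * f z) (\<lambda>z. c * f' z)"
  unfolding hs_eq_def by (rule eventually_mono) auto

lemma T_norm_eq_T_fun:
  "f \<in> borel_measurable borel \<Longrightarrow> 0 < r \<Longrightarrow> T_norm p q r \<beta> f = T_fun p q r (weighted \<beta> f)"
  unfolding T_fun_def by (rule T_norm_eq)

lemma T_norm_cmult:
  assumes g: "measurable_hs g" and p: "0 < p" and q: "0 < q" and r: "0 < r"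
  shows "T_norm p q r \<beta> (\<lambda>z. c * g z) = ennreal (cmod c) * T_norm p q r \<beta> g"
proof -
  obtain g' where g': "g' \<in> borel_measurable borel" "hs_eq g g'"
    using measurable_hs_borel_rep[OF g] .
  note [measurable] = g'(1)
  have cg': "(\<lambda>z. c * g' z) \<in> borel_measurable borel" by measurable
  have w: "weighted \<beta> (\<lambda>z. c * g' z) = (\<lambda>z. ennreal (cmod c) * weighted \<beta> g' z)"
    by (auto simp: weighted_def fun_eq_iff norm_mult mult_ac simp flip: ennreal_mult)
  have "T_norm p q r \<beta> (\<lambda>z. c * g z) = T_norm p q r \<beta> (\<lambda>z. c * g' z)"
    by (intro T_norm_cong hs_eq_cmult g' borel_measurable_hs cg' measurable_hs_cmult g)
  also have "\<dots> = ennreal (cmod c) * T_norm p q r \<beta> g'"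
    unfolding T_norm_eq_T_fun[OF cg' r] T_norm_eq_T_fun[OF g'(1) r] w by (intro T_fun_cmult p q r) measurable
  also have "T_norm p q r \<beta> g' = T_norm p q r \<beta> g"
    by (intro T_norm_cong[symmetric] g' g borel_measurable_hs)
  finally show ?thesis .
qed

lemma T_norm_add_finite:
  assumes f: "measurable_hs f" and g: "measurable_hs g" and p: "0 < p" and q: "0 < q" and r: "0 < r"
    and fin: "T_norm p q r \<beta> f < top" "T_norm p q r \<beta> g < top"
  shows "T_norm p q r \<beta> (\<lambda>z. f z + g z) < top"
proof -
  obtain f' where f': "f' \<in> borel_measurable borel" "hs_eq f f'"
    using measurable_hs_borel_rep[OF f] .
  obtain g' where g': "g' \<in> borel_measurable borel" "hs_eq g g'"
    using measurable_hs_borel_rep[OF g] .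
  note [measurable] = f'(1) g'(1)
  have fg': "(\<lambda>z. f' z + g' z) \<in> borel_measurable borel" by measurable
  have eq: "T_norm p q r \<beta> f = T_norm p q r \<beta> f'" "T_norm p q r \<beta> g = T_norm p q r \<beta> g'"
    by (intro T_norm_cong f' g' f g borel_measurable_hs)+
  have "T_norm p q r \<beta> (\<lambda>z. f z + g z) = T_norm p q r \<beta> (\<lambda>z. f' z + g' z)"
    by (intro T_norm_cong hs_eq_add f' g' borel_measurable_hs fg' measurable_hs_add f g)
  also have "\<dots> < top"
    unfolding T_norm_eq_T_fun[OF fg' r]
  proof (rule T_fun_add_finite[where u="weighted \<beta> f'" and v="weighted \<beta> g'"])
    show "weighted \<beta> (\<lambda>z. f' z + g' z) z \<le> weighted \<beta> f' z + weighted \<beta> g' z" for z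
      unfolding weighted_def
      by (auto simp: norm_triangle_ineq mult_left_mono simp flip: ennreal_plus distrib_left intro!: ennreal_leI)
    show "T_fun p q r (weighted \<beta> f') < top" "T_fun p q r (weighted \<beta> g') < top"
      using fin unfolding eq T_norm_eq_T_fun[OF f'(1) r] T_norm_eq_T_fun[OF g'(1) r] by auto
  qed (use p q r in \<open>auto simp: fg'\<close>)
  finally show ?thesis .
qed

lemma T_space_add:
  assumes "f \<in> T_space p q r \<beta>" "g \<in> T_space p q r \<beta>" and p: "0 < p" and q: "0 < q" and r: "0 < r"
  shows "(\<lambda>z. f z + g z) \<in> T_space p q r \<beta>"
  using assms T_norm_add_finite[OF _ _ p q r, of f g \<beta>] by (simp add: T_space_def measurable_hs_add)

lemma T_space_cmult:
  assumes "g \<in> T_space p q r \<beta>" and p: "0 < p" and q: "0 < q" and r: "0 < r"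
  shows "(\<lambda>z. c * g z) \<in> T_space p q r \<beta>"
  using assms T_norm_cmult[OF _ p q r, of g \<beta> c] by (simp add: T_space_def ennreal_mult_less_top measurable_hs_cmult)

text \<open>For indicators the quasi-norm is controlled by the power \<open>1/r\<close> of the
  measure, as demanded of the set function in \<open>Radon_Nikodym_power_bound\<close>. The constant
  depends only on the exponents and the enclosing box.\<close>

lemma T_norm_bounded_support:
  assumes p: "0 < p" and q: "0 < q" and r: "0 < r" and a: "0 < a" "a \<le> b" and \<rho>: "0 \<le> \<rho>"
  obtains L where "0 \<le> L"
    "\<And>(g :: real \<times> 'a::euclidean_space \<Rightarrow> complex) c B. g \<in> borel_measurable borel \<Longrightarrow> B \<in> sets borel \<Longrightarrow>
      B \<subseteq> {a<..b} \<times> ball x0 \<rho> \<Longrightarrow> 0 \<le> c \<Longrightarrow> (\<And>z. cmod (g z) \<le> c * indicator B z) \<Longrightarrow>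
      T_norm p q r \<beta> g \<le> ennreal (L * c * measure lborel B powr (1/r))"
proof -
  define L1 where "L1 = (2*b/a) powr (1/q) * (unit_ball_vol (real DIM('a)) * (\<rho> + 2*b) ^ DIM('a)) powr (1/p)"
  define W where "W = wvol TYPE('a) a"
  have W: "0 < W" unfolding W_def by (rule wvol_pos[OF a(1)])
  \<comment> \<open>The sum covers both signs of \<beta>: on the box the weight
    \<open>fst z powr (-\<beta>)\<close> is bounded by its value at \<open>b\<close> or by that at
    \<open>a\<close>.\<close>
  define m where "m = a powr (-\<beta>) + b powr (-\<beta>)"
  have m: "0 \<le> m" by (simp add: m_def)
  define L where "L = L1 * (m powr r / W) powr (1/r)"
  have L1: "0 \<le> L1" by (simp add: L1_def)
  have L: "0 \<le> L" using L1 by (simp add: L_def)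
  show thesis
  proof (rule that[OF L])
    fix g :: "real \<times> 'a \<Rightarrow> complex" and c and B :: "(real \<times> 'a) set"
    assume g[measurable]: "g \<in> borel_measurable borel" and B[measurable]: "B \<in> sets borel" and sub: "B \<subseteq> {a<..b} \<times> ball x0 \<rho>"
      and c: "0 \<le> c" and le: "\<And>z. cmod (g z) \<le> c * indicator B z"
    have "bounded B"
      by (rule bounded_subset[OF _ sub]) (intro bounded_Times, auto)
    then have "emeasure lborel B < \<infinity>" by (rule emeasure_bounded_finite)
    then have eB: "emeasure lborel B = ennreal (measure lborel B)" by (simp add: emeasure_eq_ennreal_measure)
    have w: "weighted \<beta> g z \<le> ennreal (m * c) * indicator B z" for z
    proof (cases "z \<in> B")
      case True
      then have s: "a < fst z" "fst z \<le> b" using sub by auto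
      have "fst z powr (-\<beta>) \<le> m"
      proof (cases "0 \<le> -\<beta>")
        case True
        then have "fst z powr (-\<beta>) \<le> b powr (-\<beta>)" using s a by (intro powr_mono2) auto
        then show ?thesis by (simp add: m_def add_increasing)
      next
        case False
        then have "fst z powr (-\<beta>) \<le> a powr (-\<beta>)" using s a by (intro powr_mono2') auto
        then show ?thesis by (simp add: m_def add_increasing2)
      qed
      then have "fst z powr (-\<beta>) * cmod (g z) \<le> m * c"
        using le[of z] True c m by (intro mult_mono) auto
      then show ?thesis using True by (simp add: weighted_def ennreal_leI)
    next
      case False
      then show ?thesis using le[of z] by (simp add: weighted_def)
    qed
    have "T_norm p q r \<beta> g \<le> ennreal L1 * epow ((\<integral>\<^sup>+z. epow (weighted \<beta> g z) r \<partial>lborel) / ennreal W) (1/r)"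
      unfolding T_norm_eq_T_fun[OF g r] L1_def W_def
    proof (rule T_fun_box_le[where ?x0.0=x0])
      show "weighted \<beta> g z = 0" if "z \<notin> {a<..b} \<times> ball x0 \<rho>" for z
      proof -
        have "z \<notin> B" using that sub by blast
        then show ?thesis using w[of z] by simp
      qed
    qed (use a \<rho> p q r in auto)
    also have "\<dots> \<le> ennreal L1 * epow (ennreal ((m * c) powr r * measure lborel B / W)) (1/r)"
    proof (intro mult_left_mono epow_mono)
      have "(\<integral>\<^sup>+z. epow (weighted \<beta> g z) r \<partial>lborel) \<le> (\<integral>\<^sup>+z. ennreal ((m * c) powr r) * indicator B z \<partial>lborel)"
      proof (intro nn_integral_mono)
        fix z
        have "epow (weighted \<beta> g z) r \<le> epow (ennreal (m * c) * indicator B z) r"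
          using r by (intro epow_mono w) auto
        also have "\<dots> = ennreal ((m * c) powr r) * indicator B z"
          using m c by (auto simp: indicator_def epow_ennreal)
        finally show "epow (weighted \<beta> g z) r \<le> ennreal ((m * c) powr r) * indicator B z" .
      qed
      also have "\<dots> = ennreal ((m * c) powr r * measure lborel B)"
        by (simp add: nn_integral_cmult_indicator eB ennreal_mult)
      finally have "(\<integral>\<^sup>+z. epow (weighted \<beta> g z) r \<partial>lborel) / ennreal W \<le> ennreal ((m * c) powr r * measure lborel B) / ennreal W"
        by (rule divide_right_mono_ennreal)
      also have "\<dots> = ennreal ((m * c) powr r * measure lborel B / W)"
        using W by (simp add: divide_ennreal)
      finally show "(\<integral>\<^sup>+z. epow (weighted \<beta> g z) r \<partial>lborel) / ennreal W \<le> ennreal ((m * c) powr r * measure lborel B / W)" .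
    qed (use r in auto)
    also have "\<dots> = ennreal (L1 * ((m * c) powr r * measure lborel B / W) powr (1/r))"
      using W L1 by (simp add: epow_ennreal ennreal_mult)
    also have "L1 * ((m * c) powr r * measure lborel B / W) powr (1/r) = L * c * measure lborel B powr (1/r)"
    proof -
      have "(m * c) powr r * measure lborel B / W = (m powr r / W) * (c powr r * measure lborel B)"
        by (simp add: powr_mult)
      then have "((m * c) powr r * measure lborel B / W) powr (1/r) = (m powr r / W) powr (1/r) * ((c powr r) powr (1/r) * measure lborel B powr (1/r))"
        by (simp only: powr_mult)
      also have "(c powr r) powr (1/r) = c" using c r by (simp add: powr_powr)
      finally show ?thesis by (simp add: L_def)
    qed
    finally show "T_norm p q r \<beta> g \<le> ennreal (L * c * measure lborel B powr (1/r))" .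
  qed
qed

lemma test_fun_T_space:
  assumes g: "test_fun g" and p: "0 < p" and q: "0 < q" and r: "0 < r"
  shows "g \<in> T_space p q r \<beta>"
proof -
  have gm[measurable]: "g \<in> borel_measurable borel" using g by (simp add: test_fun_def)
  obtain c where c: "cmod (g z) \<le> c" for z using g by (auto simp: test_fun_def)
  obtain a b x0 \<rho> where box: "0 < a" "a \<le> b" "0 \<le> \<rho>" "g z \<noteq> 0 \<Longrightarrow> z \<in> {a<..b} \<times> ball x0 \<rho>" for z
    using g unfolding test_fun_def by blast
  have c0: "0 \<le> c" using c[of undefined] norm_ge_zero order.trans by blast
  have B: "{a<..b} \<times> ball x0 \<rho> \<in> sets borel" by (rule borel_Times) auto
  have "T_norm p q r \<beta> g < top"
  proof (rule T_norm_bounded_support[OF p q r box(1-3), where 'a='a and ?x0.0=x0 and \<beta>=\<beta>], goal_cases)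
    case (1 L)
    have "T_norm p q r \<beta> g \<le> ennreal (L * c * measure lborel ({a<..b} \<times> ball x0 \<rho>) powr (1/r))"
    proof (rule 1(2)[OF gm B order_refl c0])
      show "cmod (g z) \<le> c * indicator ({a<..b} \<times> ball x0 \<rho>) z" for z
        using c[of z] box(4)[of z] by (cases "g z = 0") (auto simp: c0)
    qed
    then show ?case by (rule order.strict_trans1) simp
  qed
  then show ?thesis using borel_measurable_hs[OF gm] by (simp add: T_space_def)
qed

section \<open>Bounded functionals on the tent space\<close>

locale tent_exponents =
  fixes p q r \<beta> :: real
  assumes p: "0 < p" "p < 1" and q: "0 < q" and r: "1 \<le> r"
begin

lemma r0: "0 < r"
  using r by simp

abbreviation X :: "(real \<times> 'a::euclidean_space \<Rightarrow> complex) set" where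
  "X \<equiv> T_space p q r \<beta>"

abbreviation N :: "(real \<times> 'a::euclidean_space \<Rightarrow> complex) \<Rightarrow> ennreal" where
  "N \<equiv> T_norm p q r \<beta>"

lemmas X_add = T_space_add[OF _ _ p(1) q r0]
lemmas X_cmult = T_space_cmult[OF _ p(1) q r0]
lemmas N_cmult = T_norm_cmult[OF _ p(1) q r0]
lemmas test_fun_X = test_fun_T_space[OF _ p(1) q r0]

lemma X_measurable: "g \<in> X \<Longrightarrow> measurable_hs g"
  by (simp add: T_space_def)

lemma N_finite: "g \<in> X \<Longrightarrow> N g < top"
  by (simp add: T_space_def)

lemma X_diff:
  assumes "g \<in> X" "h \<in> X"
  shows "(\<lambda>z. g z - h z) \<in> X"
proof -
  have "(\<lambda>z. g z + (-1) * h z) \<in> X" by (intro X_add X_cmult assms)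
  then show ?thesis by simp
qed

lemma measurable_hs_zero: "measurable_hs (\<lambda>z. 0)"
  by (rule borel_measurable_const)

lemma N_zero: "N (\<lambda>z :: real \<times> 'a::euclidean_space. 0) = 0"
proof -
  have "N (\<lambda>z :: real \<times> 'a. 0 * 0) = ennreal (cmod 0) * N (\<lambda>z :: real \<times> 'a. 0)"
    by (rule N_cmult[OF measurable_hs_zero])
  then show ?thesis by simp
qed

lemma X_zero: "(\<lambda>z. 0) \<in> X"
  by (simp add: T_space_def N_zero)

lemma X_cong: "hs_eq g g' \<Longrightarrow> measurable_hs g' \<Longrightarrow> g \<in> X \<Longrightarrow> g' \<in> X"
  using T_norm_cong[of g g'] by (simp add: T_space_def)

lemma antidual_add: "\<Phi> \<in> antidual X N \<Longrightarrow> g \<in> X \<Longrightarrow> h \<in> X \<Longrightarrow> \<Phi> (\<lambda>z. g z + h z) = \<Phi> g + \<Phi> h"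
  by (simp add: antidual_def)

lemma antidual_cmult: "\<Phi> \<in> antidual X N \<Longrightarrow> g \<in> X \<Longrightarrow> \<Phi> (\<lambda>z. c * g z) = cnj c * \<Phi> g"
  by (simp add: antidual_def)

lemma antidual_diff:
  assumes "\<Phi> \<in> antidual X N" "g \<in> X" "h \<in> X"
  shows "\<Phi> (\<lambda>z. g z - h z) = \<Phi> g - \<Phi> h"
proof -
  have "\<Phi> (\<lambda>z. g z + (-1) * h z) = \<Phi> g + \<Phi> (\<lambda>z. (-1) * h z)"
    by (intro antidual_add X_cmult assms)
  also have "\<Phi> (\<lambda>z. (-1) * h z) = cnj (-1) * \<Phi> h"
    by (intro antidual_cmult assms)
  finally show ?thesis by simp
qed

lemma antidual_zero: "\<Phi> \<in> antidual X N \<Longrightarrow> \<Phi> (\<lambda>z. 0) = 0"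
  using antidual_cmult[OF _ X_zero, of \<Phi> 0] by simp

lemma antidual_bound:
  assumes "\<Phi> \<in> antidual X N"
  obtains C :: real where "0 \<le> C" "\<And>g. g \<in> X \<Longrightarrow> ennreal (cmod (\<Phi> g)) \<le> ennreal C * N g"
proof -
  obtain C :: real where C: "\<forall>g\<in>X. ennreal (cmod (\<Phi> g)) \<le> ennreal C * N g"
    using assms unfolding antidual_def by blast
  have "ennreal (cmod (\<Phi> g)) \<le> ennreal (max C 0) * N g" if "g \<in> X" for g
    using C[rule_format, OF that] by (rule order.trans) (intro mult_right_mono ennreal_leI, auto)
  then show thesis by (intro that[of "max C 0"]) auto
qed

lemma antidual_cong:
  fixes g g' :: "real \<times> 'a::euclidean_space \<Rightarrow> complex"
  assumes \<Phi>: "\<Phi> \<in> antidual X N" and g: "g \<in> X" and eq: "hs_eq g g'" and g': "measurable_hs g'"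
  shows "\<Phi> g = \<Phi> g'"
proof -
  obtain C where C: "0 \<le> C" "\<And>g. g \<in> X \<Longrightarrow> ennreal (cmod (\<Phi> g)) \<le> ennreal C * N g"
    using antidual_bound[OF \<Phi>] by blast
  have g'X: "g' \<in> X" by (rule X_cong[OF eq g' g])
  have "hs_eq (\<lambda>z. g z - g' z) (\<lambda>z. 0)"
    using eq unfolding hs_eq_def by (rule eventually_mono) simp
  then have "N (\<lambda>z. g z - g' z) = N (\<lambda>z :: real \<times> 'a. 0)"
    by (rule T_norm_cong[OF _ X_measurable[OF X_diff[OF g g'X]] measurable_hs_zero])
  then have "\<Phi> (\<lambda>z. g z - g' z) = 0"
    using C(2)[OF X_diff[OF g g'X]] by (simp add: N_zero)
  then show ?thesis using antidual_diff[OF \<Phi> g g'X] by simp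
qed

text \<open>\<open>T_fun_tendsto_0\<close> applies to the differences with a multiple of
  \<open>g\<close> as dominating function, and boundedness transfers the convergence to \<Phi>. The
  constant \<open>c\<close> is 1 for truncations and 3 for approximation by simple
  functions.\<close>

lemma antidual_tendsto:
  fixes g :: "real \<times> 'a::euclidean_space \<Rightarrow> complex"
  assumes \<Phi>: "\<Phi> \<in> antidual X N" and g: "g \<in> borel_measurable borel" "g \<in> X"
    and h: "\<And>n. h n \<in> borel_measurable borel" "\<And>n. h n \<in> X"
    and le: "\<And>n z. cmod (g z - h n z) \<le> c * cmod (g z)" and c: "0 \<le> c"
    and lim: "\<And>z. 0 < fst z \<Longrightarrow> (\<lambda>n. h n z) \<longlonglongrightarrow> g z"
  shows "(\<lambda>n. \<Phi> (h n)) \<longlonglongrightarrow> \<Phi> g"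
proof -
  note [measurable] = g(1) h(1)
  obtain C where C: "0 \<le> C" "\<And>g. g \<in> X \<Longrightarrow> ennreal (cmod (\<Phi> g)) \<le> ennreal C * N g"
    using antidual_bound[OF \<Phi>] by blast
  have gh: "(\<lambda>z. g z - h n z) \<in> borel_measurable borel" for n by measurable
  have "(\<lambda>n. T_fun p q r (weighted \<beta> (\<lambda>z. g z - h n z))) \<longlonglongrightarrow> 0"
  proof (rule T_fun_tendsto_0[where v="weighted \<beta> (\<lambda>z. of_real c * g z)"])
    show "weighted \<beta> (\<lambda>z. g z - h n z) z \<le> weighted \<beta> (\<lambda>z. of_real c * g z) z" for n z
      using le[of z n] c unfolding weighted_def by (intro ennreal_leI mult_left_mono) (auto simp: norm_mult)
    show "(\<lambda>n. weighted \<beta> (\<lambda>z. g z - h n z) z) \<longlonglongrightarrow> 0" if "0 < fst z" for z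
    proof -
      have "(\<lambda>n. ennreal (fst z powr (-\<beta>) * cmod (g z - h n z))) \<longlonglongrightarrow> ennreal (fst z powr (-\<beta>) * cmod (g z - g z))"
        by (intro tendsto_intros tendsto_ennrealI lim that)
      then show ?thesis by (simp add: weighted_def)
    qed
    have "(\<lambda>z. of_real c * g z) \<in> borel_measurable borel" by measurable
    then show "T_fun p q r (weighted \<beta> (\<lambda>z. of_real c * g z)) < top"
      using N_finite[OF X_cmult[OF g(2)]] T_norm_eq_T_fun[OF _ r0] by metis
  qed (use p q r0 in auto)
  then have "(\<lambda>n. N (\<lambda>z. g z - h n z)) \<longlonglongrightarrow> 0"
    by (simp add: T_norm_eq_T_fun[OF gh r0])
  then have "(\<lambda>n. ennreal C * N (\<lambda>z. g z - h n z)) \<longlonglongrightarrow> ennreal C * 0"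
    by (intro ennreal_tendsto_cmult) auto
  then have "(\<lambda>n. ennreal C * N (\<lambda>z. g z - h n z)) \<longlonglongrightarrow> 0" by simp
  then have "(\<lambda>n. ennreal (cmod (\<Phi> g - \<Phi> (h n)))) \<longlonglongrightarrow> 0"
    by (rule tendsto_sandwich[where f="\<lambda>_. 0", rotated 3])
       (use C(2)[OF X_diff[OF g(2) h(2)]] antidual_diff[OF \<Phi> g(2) h(2)] in auto)
  then have "(\<lambda>n. cmod (\<Phi> g - \<Phi> (h n))) \<longlonglongrightarrow> 0"
    using tendsto_ennreal_iff[where F=sequentially and f="\<lambda>n. cmod (\<Phi> g - \<Phi> (h n))" and x=0] by simp
  then have "(\<lambda>n. \<Phi> g - (\<Phi> g - \<Phi> (h n))) \<longlonglongrightarrow> \<Phi> g - 0"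
    by (intro tendsto_intros) (simp add: tendsto_norm_zero_iff)
  then show ?thesis by simp
qed

text \<open>The shift by one keeps the lower end meaningful at \<open>n = 0\<close> and never above
  the upper end, as \<open>test_fun\<close> requires; \<open>exhaust 0\<close> is empty.\<close>

definition exhaust :: "nat \<Rightarrow> (real \<times> 'a::euclidean_space) set" where
  "exhaust n = {1 / (real n + 1)<..real n + 1} \<times> ball 0 (real n + 1)"

lemma exhaust_borel [measurable]: "exhaust n \<in> sets borel"
  unfolding exhaust_def by (rule borel_Times) auto

lemma exhaust_mono: "m \<le> n \<Longrightarrow> exhaust m \<subseteq> exhaust n"
proof -
  assume "m \<le> n"
  then have "1 / (real n + 1) \<le> 1 / (real m + 1)" by (intro divide_left_mono) auto
  then show ?thesis using \<open>m \<le> n\<close> unfolding exhaust_def by (intro Sigma_mono) auto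
qed

lemma exhaust_box:
  assumes "0 < a"
  obtains n where "{a<..b} \<times> ball x0 \<rho> \<subseteq> exhaust n"
proof -
  obtain k where k: "1 / Suc k < a" using nat_approx_posE[OF assms] by auto
  obtain l :: nat where l: "b \<le> real l" using real_arch_simple by blast
  obtain m :: nat where m: "norm x0 + \<rho> \<le> real m" using real_arch_simple by blast
  define n where "n = k + l + m"
  have "1 / (real n + 1) \<le> 1 / Suc k" unfolding n_def by (intro divide_left_mono) auto
  then have 1: "1 / (real n + 1) \<le> a" using k by simp
  have "norm y < real n + 1" if "dist x0 y < \<rho>" for y
    using that m norm_triangle_sub[of y x0] by (simp add: dist_norm norm_minus_commute n_def)
  then have "{a<..b} \<times> ball x0 \<rho> \<subseteq> exhaust n"
    using 1 l unfolding exhaust_def n_def by (auto simp: dist_norm)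
  then show thesis by (rule that)
qed

lemma exhaust_eventually:
  assumes "0 < fst z"
  obtains n where "\<And>m. n \<le> m \<Longrightarrow> z \<in> exhaust m"
proof -
  obtain n where "{fst z / 2<..fst z} \<times> ball (snd z) 1 \<subseteq> exhaust n"
    by (rule exhaust_box[of "fst z / 2" "fst z" "snd z" 1]) (use assms in auto)
  moreover have "z \<in> {fst z / 2<..fst z} \<times> ball (snd z) 1"
    using assms by (cases z) auto
  ultimately show thesis using exhaust_mono by (intro that[of n]) blast
qed

lemma test_fun_truncation:
  assumes [measurable]: "g \<in> borel_measurable borel"
  shows "test_fun (\<lambda>z. indicator (exhaust n \<inter> {z. cmod (g z) \<le> real n}) z * g z)"
  unfolding test_fun_def
proof (intro conjI)
  have "{z. cmod (g z) \<le> real n} \<in> sets borel"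
  proof -
    have "{z \<in> space borel. cmod (g z) \<le> real n} \<in> sets borel" by measurable
    then show ?thesis by simp
  qed
  then show "(\<lambda>z. indicator (exhaust n \<inter> {z. cmod (g z) \<le> real n}) z * g z) \<in> borel_measurable borel"
    by measurable
  show "\<exists>B. \<forall>z. cmod (indicator (exhaust n \<inter> {z. cmod (g z) \<le> real n}) z * g z) \<le> B"
    by (intro exI[of _ "real n"]) (auto simp: indicator_def)
  have "1 / (real n + 1) \<le> 1" by simp
  then have e: "1 / (real n + 1) \<le> real n + 1" by linarith
  show "\<exists>a b x0 \<rho>. 0 < a \<and> a \<le> b \<and> 0 \<le> \<rho> \<and>
      (\<forall>z. indicator (exhaust n \<inter> {z. cmod (g z) \<le> real n}) z * g z \<noteq> 0 \<longrightarrow> z \<in> {a<..b} \<times> ball x0 \<rho>)"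
    by (rule exI[of _ "1 / (real n + 1)"], rule exI[of _ "real n + 1"], rule exI[of _ 0], rule exI[of _ "real n + 1"])
       (use e in \<open>auto simp: indicator_def exhaust_def split: if_splits\<close>)
qed

text \<open>Restricting \<open>g\<close> to \<open>exhaust n\<close> and to the points with
  \<open>cmod (g z) <= n\<close> gives test functions that converge to \<open>g\<close> on the
  half-space, with differences dominated by \<open>g\<close>; so \<open>antidual_tendsto\<close>
  determines both functionals at \<open>g\<close>.\<close>

lemma antidual_eqI:
  fixes \<Phi> \<Psi> :: "(real \<times> 'a::euclidean_space \<Rightarrow> complex) \<Rightarrow> complex"
  assumes \<Phi>: "\<Phi> \<in> antidual X N" and \<Psi>: "\<Psi> \<in> antidual X N"
    and eq: "\<And>g. test_fun g \<Longrightarrow> \<Phi> g = \<Psi> g"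
  shows "\<Phi> = \<Psi>"
proof (rule extensionalityI)
  show "\<Phi> \<in> extensional X" "\<Psi> \<in> extensional X"
    using \<Phi> \<Psi> by (auto simp: antidual_def)
  fix g0 :: "real \<times> 'a \<Rightarrow> complex" assume g0: "g0 \<in> X"
  obtain g where g[measurable]: "g \<in> borel_measurable borel" and g0g: "hs_eq g0 g"
    using measurable_hs_borel_rep[OF X_measurable[OF g0]] .
  have gX: "g \<in> X" by (rule X_cong[OF g0g borel_measurable_hs[OF g] g0])
  define h where "h n z = indicator (exhaust n \<inter> {z. cmod (g z) \<le> real n}) z * g z" for n z
  have test: "test_fun (h n)" for n
    unfolding h_def[abs_def] by (rule test_fun_truncation[OF g])
  have lim: "(\<lambda>n. h n z) \<longlonglongrightarrow> g z" if z: "0 < fst z" for z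
  proof -
    obtain n where n: "\<And>m. n \<le> m \<Longrightarrow> z \<in> exhaust m" using exhaust_eventually[OF z] by blast
    obtain k :: nat where k: "cmod (g z) \<le> real k" using real_arch_simple by blast
    have "h m z = g z" if "max n k \<le> m" for m
    proof -
      have "cmod (g z) \<le> real m" using k that by simp
      then show ?thesis using n[of m] that by (simp add: h_def)
    qed
    then show ?thesis by (intro tendsto_eventually eventually_sequentiallyI[of "max n k"])
  qed
  have le: "cmod (g z - h n z) \<le> 1 * cmod (g z)" for n z
    by (auto simp: h_def indicator_def)
  have hm: "h n \<in> borel_measurable borel" for n using test[of n] by (simp add: test_fun_def)
  have "(\<lambda>n. \<Phi> (h n)) \<longlonglongrightarrow> \<Phi> g"
    by (rule antidual_tendsto[OF \<Phi> g gX hm test_fun_X[OF test] le _ lim]) auto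
  moreover have "(\<lambda>n. \<Psi> (h n)) \<longlonglongrightarrow> \<Psi> g"
    by (rule antidual_tendsto[OF \<Psi> g gX hm test_fun_X[OF test] le _ lim]) auto
  ultimately have "\<Phi> g = \<Psi> g"
    using eq[OF test] by (simp add: LIMSEQ_unique)
  then show "\<Phi> g0 = \<Psi> g0"
    using antidual_cong[OF \<Phi> g0 g0g borel_measurable_hs[OF g]] antidual_cong[OF \<Psi> g0 g0g borel_measurable_hs[OF g]] by simp
qed

section \<open>Representing a functional by a density on test functions\<close>

lemma antidual_sum:
  assumes \<Phi>: "\<Phi> \<in> antidual X N" and "finite S" and h: "\<And>v. v \<in> S \<Longrightarrow> h v \<in> X"
  shows "(\<lambda>z. \<Sum>v\<in>S. h v z) \<in> X \<and> \<Phi> (\<lambda>z. \<Sum>v\<in>S. h v z) = (\<Sum>v\<in>S. \<Phi> (h v))"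
  using \<open>finite S\<close> h
proof (induction S rule: finite_induct)
  case empty
  then show ?case using X_zero antidual_zero[OF \<Phi>] by simp
next
  case (insert v S)
  then have m: "h v \<in> X" "(\<lambda>z. \<Sum>v\<in>S. h v z) \<in> X" by auto
  show ?case
    using insert X_add[OF m] antidual_add[OF \<Phi> m] by simp
qed

text \<open>Evaluating \<Phi> at indicators of \<open>A \<inter> D\<close> gives a finitely additive
  set function with a power bound, so its real and imaginary parts have densities. Additivity and
  homogeneity extend the formula to simple functions, and dominated convergence, in the quasi-norm
  and under the integral, to bounded functions.\<close>

lemma antidual_local_density:
  fixes \<Phi> :: "(real \<times> 'a::euclidean_space \<Rightarrow> complex) \<Rightarrow> complex" and D :: "(real \<times> 'a) set"
  assumes \<Phi>: "\<Phi> \<in> antidual X N" and D[measurable]: "D \<in> sets borel"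
    and sub: "D \<subseteq> {a<..b} \<times> ball x0 \<rho>" and a: "0 < a" "a \<le> b" and \<rho>: "0 \<le> \<rho>"
  obtains \<kappa> :: "real \<times> 'a \<Rightarrow> complex" where "integrable lborel \<kappa>" "\<And>z. z \<notin> D \<Longrightarrow> \<kappa> z = 0"
    "\<And>g c. g \<in> borel_measurable borel \<Longrightarrow> (\<And>z. cmod (g z) \<le> c) \<Longrightarrow> (\<And>z. z \<notin> D \<Longrightarrow> g z = 0) \<Longrightarrow>
      \<Phi> g = (\<integral>z. \<kappa> z * cnj (g z) \<partial>lborel)"
proof -
  obtain C where C: "0 \<le> C" "\<And>g. g \<in> X \<Longrightarrow> ennreal (cmod (\<Phi> g)) \<le> ennreal C * N g"
    using antidual_bound[OF \<Phi>] by blast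
  have testD: "test_fun g" if "g \<in> borel_measurable borel" "\<And>z. cmod (g z) \<le> c" "\<And>z. z \<notin> D \<Longrightarrow> g z = 0"
    for g :: "real \<times> 'a \<Rightarrow> complex" and c
    unfolding test_fun_def
  proof (intro conjI)
    show "g \<in> borel_measurable borel" by fact
    show "\<exists>B. \<forall>z. cmod (g z) \<le> B" using that(2) by blast
    have "\<forall>z. g z \<noteq> 0 \<longrightarrow> z \<in> {a<..b} \<times> ball x0 \<rho>" using that(3) sub by blast
    then show "\<exists>a b x0 \<rho>. 0 < a \<and> a \<le> b \<and> 0 \<le> \<rho> \<and> (\<forall>z. g z \<noteq> 0 \<longrightarrow> z \<in> {a<..b} \<times> ball x0 \<rho>)"
      using a \<rho> by blast
  qed
  have indm: "(\<lambda>z. indicator B z :: complex) \<in> borel_measurable borel" if "B \<in> sets borel" for B :: "(real \<times> 'a) set"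
    using that by simp
  have indX: "(\<lambda>z. indicator B z) \<in> X" if B: "B \<in> sets borel" "B \<subseteq> D" for B
  proof (rule test_fun_X[OF testD[OF indm[OF B(1)]]])
    show "cmod (indicator B z) \<le> 1" for z by (auto simp: indicator_def)
    show "z \<notin> D \<Longrightarrow> indicator B z = (0::complex)" for z using B(2) by (auto simp: indicator_def)
  qed
  \<comment> \<open>A density in place of a restriction: the measurable sets remain those of
    \<open>borel\<close>, while the total mass becomes finite.\<close>
  define M where "M = density lborel (\<lambda>z. ennreal (indicator D z :: real))"
  have sM [simp]: "sets M = sets borel" by (simp add: M_def)
  have eM: "emeasure M A = emeasure lborel (A \<inter> D)" if "A \<in> sets borel" for A
  proof -
    have "emeasure M A = (\<integral>\<^sup>+z. indicator (A \<inter> D) z \<partial>lborel)"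
    proof -
      have "emeasure M A = (\<integral>\<^sup>+z. ennreal (indicator D z) * indicator A z \<partial>lborel)"
        unfolding M_def using that by (intro emeasure_density) auto
      also have "\<dots> = (\<integral>\<^sup>+z. indicator (A \<inter> D) z \<partial>lborel)"
        by (intro nn_integral_cong) (auto simp: indicator_def)
      finally show ?thesis .
    qed
    then show ?thesis using that by simp
  qed
  have bD: "bounded D" by (rule bounded_subset[OF _ sub]) (intro bounded_Times, auto)
  have finM: "finite_measure M"
  proof
    have "space M \<in> sets borel" using sets.top[of M] by simp
    then show "emeasure M (space M) \<noteq> \<infinity>"
      using eM[of "space M"] emeasure_bounded_finite[OF bounded_subset[OF bD, of "space M \<inter> D"]] by auto
  qed
  have mM: "measure M A = measure lborel (A \<inter> D)" if "A \<in> sets borel" for A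
    using eM[OF that] by (simp add: measure_def)
  define \<nu> where "\<nu> A = \<Phi> (\<lambda>z. indicator (A \<inter> D) z)" for A
  have \<nu>_add: "\<nu> (A \<union> B) = \<nu> A + \<nu> B" if "A \<in> sets borel" "B \<in> sets borel" "A \<inter> B = {}" for A B
  proof -
    have "(\<lambda>z. indicator ((A \<union> B) \<inter> D) z :: complex) = (\<lambda>z. indicator (A \<inter> D) z + indicator (B \<inter> D) z)"
      using that(3) by (auto simp: indicator_def fun_eq_iff)
    then show ?thesis
      unfolding \<nu>_def using that by (simp add: antidual_add[OF \<Phi> indX indX])
  qed
  obtain K where K: "0 \<le> K" "\<And>A. A \<in> sets borel \<Longrightarrow> cmod (\<nu> A) \<le> K * measure M A powr (1/r)"
  proof (rule T_norm_bounded_support[OF p(1) q r0 a \<rho>, where 'a='a and ?x0.0=x0 and \<beta>=\<beta>], goal_cases)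
    case L: (1 L)
    show ?case
    proof (rule L(1))
      show "0 \<le> C * L" using C(1) L(2) by simp
      fix A :: "(real \<times> 'a) set" assume A: "A \<in> sets borel"
      have "ennreal (cmod (\<nu> A)) \<le> ennreal C * N (\<lambda>z. indicator (A \<inter> D) z)"
        unfolding \<nu>_def using A by (intro C(2) indX) auto
      also have "\<dots> \<le> ennreal C * ennreal (L * 1 * measure lborel (A \<inter> D) powr (1/r))"
        by (intro mult_left_mono L(3)) (use A sub in \<open>auto simp: indicator_def\<close>)
      also have "\<dots> = ennreal (C * L * measure M A powr (1/r))"
        using C(1) L(2) by (simp add: mM[OF A] mult.assoc flip: ennreal_mult)
      finally show "cmod (\<nu> A) \<le> C * L * measure M A powr (1/r)"
        using C(1) L(2) by (subst (asm) ennreal_le_iff) auto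
    qed
  qed
  have r1: "0 < 1/r" using r0 by simp
  obtain f1 where f1: "integrable M f1" "\<And>A. A \<in> sets M \<Longrightarrow> Re (\<nu> A) = (\<integral>z. indicator A z * f1 z \<partial>M)"
  proof (rule Radon_Nikodym_power_bound[OF finM, where \<nu>="\<lambda>A. Re (\<nu> A)" and c=K and a="1/r"])
    show "\<bar>Re (\<nu> A)\<bar> \<le> K * measure M A powr (1/r)" if "A \<in> sets M" for A
      using abs_Re_le_cmod[of "\<nu> A"] K(2)[of A] that by simp
  qed (use \<nu>_add r1 K(1) in auto)
  obtain f2 where f2: "integrable M f2" "\<And>A. A \<in> sets M \<Longrightarrow> Im (\<nu> A) = (\<integral>z. indicator A z * f2 z \<partial>M)"
  proof (rule Radon_Nikodym_power_bound[OF finM, where \<nu>="\<lambda>A. Im (\<nu> A)" and c=K and a="1/r"])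
    show "\<bar>Im (\<nu> A)\<bar> \<le> K * measure M A powr (1/r)" if "A \<in> sets M" for A
      using abs_Im_le_cmod[of "\<nu> A"] K(2)[of A] that by simp
  qed (use \<nu>_add r1 K(1) in auto)
  have fm: "f1 \<in> borel_measurable lborel" "f2 \<in> borel_measurable lborel"
    using borel_measurable_integrable[OF f1(1)] borel_measurable_integrable[OF f2(1)]
    by (simp_all add: M_def)
  have fi: "integrable lborel (\<lambda>z. indicator D z * f1 z)" "integrable lborel (\<lambda>z. indicator D z * f2 z)"
    using f1(1) f2(1) fm unfolding M_def by (simp_all add: integrable_density)
  define \<kappa> where "\<kappa> z = of_real (indicator D z * f1 z) + \<i> * of_real (indicator D z * f2 z)" for z
  have \<kappa>i: "integrable lborel \<kappa>"
    unfolding \<kappa>_def using fi by (intro Bochner_Integration.integrable_add Bochner_Integration.integrable_mult_right integrable_of_real)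
  have \<kappa>m[measurable]: "\<kappa> \<in> borel_measurable borel"
    using borel_measurable_integrable[OF \<kappa>i] by simp
  have \<kappa>0: "\<kappa> z = 0" if "z \<notin> D" for z using that by (simp add: \<kappa>_def)
  have base: "\<Phi> (\<lambda>z. indicator B z) = (\<integral>z. \<kappa> z * cnj (indicator B z) \<partial>lborel)"
    if B[measurable]: "B \<in> sets borel" and BD: "B \<subseteq> D" for B
  proof -
    have i: "integrable lborel (\<lambda>z. indicator D z * (indicator B z * f1 z))"
      "integrable lborel (\<lambda>z. indicator D z * (indicator B z * f2 z))"
      using integrable_mult_indicator[OF _ fi(1), of B] integrable_mult_indicator[OF _ fi(2), of B]
      by (simp_all add: mult_ac)
    have dens: "(\<integral>z. indicator B z * k z \<partial>M) = (\<integral>z. indicator D z * (indicator B z * k z) \<partial>lborel)"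
      if "k \<in> borel_measurable lborel" for k :: "real \<times> 'a \<Rightarrow> real"
      unfolding M_def using that by (subst integral_density) auto
    have eq: "\<kappa> z * cnj (indicator B z) = of_real (indicator D z * (indicator B z * f1 z)) + \<i> * of_real (indicator D z * (indicator B z * f2 z))" for z
      by (auto simp: \<kappa>_def indicator_def)
    have "(\<integral>z. \<kappa> z * cnj (indicator B z) \<partial>lborel) = of_real (\<integral>z. indicator D z * (indicator B z * f1 z) \<partial>lborel)
      + \<i> * of_real (\<integral>z. indicator D z * (indicator B z * f2 z) \<partial>lborel)"
      unfolding eq using i by (subst Bochner_Integration.integral_add) (auto intro!: Bochner_Integration.integrable_mult_right integrable_of_real simp del: of_real_mult)
    also have "(\<integral>z. indicator D z * (indicator B z * f1 z) \<partial>lborel) = Re (\<nu> B)"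
      using f1(2)[of B] dens[OF fm(1)] by simp
    also have "(\<integral>z. indicator D z * (indicator B z * f2 z) \<partial>lborel) = Im (\<nu> B)"
      using f2(2)[of B] dens[OF fm(2)] by simp
    also have "of_real (Re (\<nu> B)) + \<i> * of_real (Im (\<nu> B)) = \<nu> B"
      by (rule complex_eq[symmetric])
    also have "\<nu> B = \<Phi> (\<lambda>z. indicator B z)"
      using BD by (simp add: \<nu>_def Int_absorb2)
    finally show ?thesis by simp
  qed
  have simple: "F \<in> X \<and> \<Phi> F = (\<integral>z. \<kappa> z * cnj (F z) \<partial>lborel)"
    if F: "simple_function lborel F" and FD: "\<And>z. z \<notin> D \<Longrightarrow> F z = 0" for F
  proof -
    \<comment> \<open>The value 0 is left out because its level set need not lie in
      \<open>D\<close>.\<close>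
    define S where "S = range F - {0}"
    have S: "finite S" using simple_functionD(1)[OF F] by (simp add: S_def)
    define A where "A v = F -` {v}" for v
    have Am: "A v \<in> sets borel" for v
      using simple_functionD(2)[OF F, of "{v}"] by (simp add: A_def)
    have AD: "A v \<subseteq> D" if "v \<in> S" for v
      using that FD by (auto simp: A_def S_def)
    have Feq: "F = (\<lambda>z. \<Sum>v\<in>S. v * indicator (A v) z)"
    proof
      fix z
      show "F z = (\<Sum>v\<in>S. v * indicator (A v) z)"
      proof (cases "F z = 0")
        case True
        then have "(\<Sum>v\<in>S. v * indicator (A v) z) = 0"
          by (intro sum.neutral) (auto simp: S_def A_def)
        then show ?thesis using True by simp
      next
        case False
        then have "(\<Sum>v\<in>S. v * indicator (A v) z) = (\<Sum>v\<in>{F z}. v * indicator (A v) z)"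
          using S by (intro sum.mono_neutral_right) (auto simp: S_def A_def)
        then show ?thesis by (simp add: A_def)
      qed
    qed
    have *: "(\<lambda>z. \<Sum>v\<in>S. v * indicator (A v) z) \<in> X \<and>
        \<Phi> (\<lambda>z. \<Sum>v\<in>S. v * indicator (A v) z) = (\<Sum>v\<in>S. \<Phi> (\<lambda>z. v * indicator (A v) z))"
      by (rule antidual_sum[OF \<Phi> S]) (intro X_cmult indX Am AD)
    \<comment> \<open>Indicators are real and do not show conjugate-linearity. It enters here,
      through the values \<open>v\<close>, and accounts for the conjugate in the
      representation.\<close>
    have "(\<Sum>v\<in>S. \<Phi> (\<lambda>z. v * indicator (A v) z)) = (\<Sum>v\<in>S. \<integral>z. cnj v * (\<kappa> z * cnj (indicator (A v) z)) \<partial>lborel)"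
    proof (rule sum.cong[OF refl])
      fix v assume v: "v \<in> S"
      have "\<Phi> (\<lambda>z. v * indicator (A v) z) = cnj v * \<Phi> (\<lambda>z. indicator (A v) z)"
        by (rule antidual_cmult[OF \<Phi> indX[OF Am AD[OF v]]])
      then show "\<Phi> (\<lambda>z. v * indicator (A v) z) = (\<integral>z. cnj v * (\<kappa> z * cnj (indicator (A v) z)) \<partial>lborel)"
        by (simp add: base[OF Am AD[OF v]])
    qed
    also have "\<dots> = (\<integral>z. (\<Sum>v\<in>S. cnj v * (\<kappa> z * cnj (indicator (A v) z))) \<partial>lborel)"
    proof (rule Bochner_Integration.integral_sum[symmetric])
      fix v
      have "integrable lborel (\<lambda>z. indicator (A v) z *\<^sub>R \<kappa> z)"
        using Am by (intro integrable_mult_indicator \<kappa>i) simp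
      then have "integrable lborel (\<lambda>z. \<kappa> z * cnj (indicator (A v) z))"
        by (rule Bochner_Integration.integrable_cong[THEN iffD1, rotated 2]) (auto simp: indicator_def)
      then show "integrable lborel (\<lambda>z. cnj v * (\<kappa> z * cnj (indicator (A v) z)))"
        by (rule Bochner_Integration.integrable_mult_right)
    qed
    also have "(\<lambda>z. (\<Sum>v\<in>S. cnj v * (\<kappa> z * cnj (indicator (A v) z)))) = (\<lambda>z. \<kappa> z * cnj (F z))"
      by (subst Feq) (simp add: sum_distrib_left mult_ac)
    finally show ?thesis using *[folded Feq] by simp
  qed
  show thesis
  proof (rule that[OF \<kappa>i \<kappa>0])
    fix g :: "real \<times> 'a \<Rightarrow> complex" and c
    assume g[measurable]: "g \<in> borel_measurable borel" and c: "\<And>z. cmod (g z) \<le> c" and g0: "\<And>z. z \<notin> D \<Longrightarrow> g z = 0"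
    have "g \<in> borel_measurable lborel" by simp
    from borel_measurable_implies_sequence_metric[OF this, of 0]
    obtain F where F: "\<And>i. simple_function lborel (F i)" "\<And>z. (\<lambda>i. F i z) \<longlonglongrightarrow> g z"
      "\<And>i z. cmod (F i z) \<le> 2 * cmod (g z)"
      by auto
    have F0: "F i z = 0" if "z \<notin> D" for i z
      using F(3)[of i z] g0[OF that] by simp
    have Fm[measurable]: "F i \<in> borel_measurable borel" for i
      using borel_measurable_simple_function[OF F(1)[of i]] by simp
    note Fs = simple[OF F(1) F0]
    \<comment> \<open>The simple approximants are at most twice as large as \<open>g\<close>, so
      their distance from \<open>g\<close> is at most three times \<open>cmod (g z)\<close>.\<close>
    have "(\<lambda>i. \<Phi> (F i)) \<longlonglongrightarrow> \<Phi> g"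
    proof (rule antidual_tendsto[OF \<Phi> g _ Fm, where c=3])
      show "g \<in> X" by (rule test_fun_X[OF testD[OF g c g0]])
      show "cmod (g z - F i z) \<le> 3 * cmod (g z)" for i z
        using norm_triangle_ineq4[of "g z" "F i z"] F(3)[of i z] by simp
    qed (use Fs F(2) in auto)
    moreover have "(\<lambda>i. \<integral>z. \<kappa> z * cnj (F i z) \<partial>lborel) \<longlonglongrightarrow> (\<integral>z. \<kappa> z * cnj (g z) \<partial>lborel)"
    proof (rule integral_dominated_convergence[where w="\<lambda>z. 2 * c * cmod (\<kappa> z)"])
      show "(\<lambda>z. \<kappa> z * cnj (g z)) \<in> borel_measurable lborel" "(\<lambda>z. \<kappa> z * cnj (F i z)) \<in> borel_measurable lborel" for i
        by measurable
      show "integrable lborel (\<lambda>z. 2 * c * cmod (\<kappa> z))"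
        using \<kappa>i by (intro Bochner_Integration.integrable_mult_right Bochner_Integration.integrable_norm)
      show "AE z in lborel. (\<lambda>i. \<kappa> z * cnj (F i z)) \<longlonglongrightarrow> \<kappa> z * cnj (g z)"
        by (intro AE_I2 tendsto_intros F(2))
      show "AE z in lborel. cmod (\<kappa> z * cnj (F i z)) \<le> 2 * c * cmod (\<kappa> z)" for i
      proof (rule AE_I2)
        fix z
        have "cmod (F i z) \<le> 2 * c" using F(3)[of i z] c[of z] by simp
        then show "cmod (\<kappa> z * cnj (F i z)) \<le> 2 * c * cmod (\<kappa> z)"
          by (simp add: norm_mult mult.commute mult_left_mono)
      qed
    qed
    ultimately show "\<Phi> g = (\<integral>z. \<kappa> z * cnj (g z) \<partial>lborel)"
      using Fs by (simp add: LIMSEQ_unique)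
  qed
qed

text \<open>Local densities are glued along the disjoint pieces of the exhaustion. Disjointness
  avoids comparing densities on overlaps.\<close>

lemma antidual_density:
  fixes \<Phi> :: "(real \<times> 'a::euclidean_space \<Rightarrow> complex) \<Rightarrow> complex"
  assumes \<Phi>: "\<Phi> \<in> antidual X N"
  obtains f where "f \<in> borel_measurable borel" "\<And>g. test_fun g \<Longrightarrow> \<Phi> g = pairing_int f g"
proof -
  define D :: "nat \<Rightarrow> (real \<times> 'a) set" where "D = disjointed exhaust"
  have Dm[measurable]: "D n \<in> sets borel" for n
    unfolding D_def by (rule sets.range_disjointed_sets[of exhaust, THEN range_subsetD]) auto
  have D_disj: "m = n" if "z \<in> D m" "z \<in> D n" for m n z
    using disjoint_family_disjointed[of exhaust] that unfolding D_def disjoint_family_on_def by blast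
  have D_exh: "D n \<subseteq> exhaust n" for n
    unfolding D_def by (rule disjointed_subset)
  have D_cover: "\<exists>n\<le>m. z \<in> D n" if "z \<in> exhaust m" for m z
  proof -
    have "z \<in> (\<Union>i\<in>{0..<Suc m}. exhaust i)" using that by auto
    then have "z \<in> (\<Union>i\<in>{0..<Suc m}. D i)"
      unfolding D_def by (simp add: finite_UN_disjointed_eq)
    then show ?thesis by (auto simp: less_Suc_eq_le)
  qed
  define P where "P n \<kappa> \<longleftrightarrow> integrable lborel \<kappa> \<and> (\<forall>z. z \<notin> D n \<longrightarrow> \<kappa> z = 0) \<and>
    (\<forall>g c. g \<in> borel_measurable borel \<longrightarrow> (\<forall>z. cmod (g z) \<le> c) \<longrightarrow> (\<forall>z. z \<notin> D n \<longrightarrow> g z = 0) \<longrightarrow>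
      \<Phi> g = (\<integral>z. \<kappa> z * cnj (g z) \<partial>lborel))" for n \<kappa>
  have "\<exists>\<kappa>. P n \<kappa>" for n
  proof -
    have "1 / (real n + 1) \<le> 1" by simp
    then have e: "1 / (real n + 1) \<le> real n + 1" by linarith
    have sub: "D n \<subseteq> {1 / (real n + 1)<..real n + 1} \<times> ball 0 (real n + 1)"
      using D_exh[of n] unfolding exhaust_def .
    show ?thesis
    proof (rule antidual_local_density[OF \<Phi> Dm[of n] sub _ e], goal_cases)
      case (3 \<kappa>)
      then show ?case unfolding P_def by (intro exI[of _ \<kappa>] conjI allI impI) blast+
    qed auto
  qed
  then obtain \<kappa> where "\<And>n. P n (\<kappa> n)"
    by metis
  then have \<kappa>i: "\<And>n. integrable lborel (\<kappa> n)" and \<kappa>0: "\<And>n z. z \<notin> D n \<Longrightarrow> \<kappa> n z = 0"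
    and \<kappa>: "\<And>n g c. g \<in> borel_measurable borel \<Longrightarrow> (\<And>z. cmod (g z) \<le> c) \<Longrightarrow> (\<And>z. z \<notin> D n \<Longrightarrow> g z = 0) \<Longrightarrow>
      \<Phi> g = (\<integral>z. \<kappa> n z * cnj (g z) \<partial>lborel)"
    unfolding P_def by blast+
  have \<kappa>m[measurable]: "\<kappa> n \<in> borel_measurable borel" for n
    using borel_measurable_integrable[OF \<kappa>i[of n]] by simp
  \<comment> \<open>At most one summand is nonzero at any point, so the series is finite everywhere.
    The factor \<open>fst z\<close> compensates the division in \<open>pairing_int\<close>.\<close>
  define f where "f z = of_real (fst z) * (\<Sum>n. \<kappa> n z)" for z
  have fm: "f \<in> borel_measurable borel" unfolding f_def by measurable
  have f_eq: "f z = of_real (fst z) * \<kappa> n z" if "z \<in> D n" for n z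
  proof -
    have "(\<Sum>k. \<kappa> k z) = (\<Sum>k\<in>{n}. \<kappa> k z)"
      by (rule suminf_finite) (use \<kappa>0 D_disj[OF that] in blast)+
    then show ?thesis by (simp add: f_def)
  qed
  show thesis
  proof (rule that[OF fm])
    fix g :: "real \<times> 'a \<Rightarrow> complex" assume test: "test_fun g"
    have gm[measurable]: "g \<in> borel_measurable borel" using test by (simp add: test_fun_def)
    obtain c where c: "\<And>z. cmod (g z) \<le> c" using test by (auto simp: test_fun_def)
    have c0: "0 \<le> c" using c[of undefined] norm_ge_zero order.trans by blast
    obtain a b x0 \<rho> where box: "0 < a" "\<And>z. g z \<noteq> 0 \<Longrightarrow> z \<in> {a<..b} \<times> ball x0 \<rho>"
      using test unfolding test_fun_def by blast
    obtain m where m: "{a<..b} \<times> ball x0 \<rho> \<subseteq> exhaust m"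
      using exhaust_box[OF box(1)] by blast
    define h where "h n z = indicator (D n) z * g z" for n z
    have hm: "h n \<in> borel_measurable borel" for n
      unfolding h_def by measurable
    have h0: "h n z = 0" if "z \<notin> D n" for n z using that by (simp add: h_def)
    have hc: "cmod (h n z) \<le> c" for n z using c[of z] c0 by (auto simp: h_def indicator_def)
    have h_test: "test_fun (h n)" for n
      unfolding test_fun_def
    proof (intro conjI)
      show "h n \<in> borel_measurable borel" by (rule hm)
      show "\<exists>B. \<forall>z. cmod (h n z) \<le> B" using hc by blast
      obtain a b x0 \<rho> where "0 < a" "a \<le> b" "0 \<le> \<rho>" "\<And>z. g z \<noteq> 0 \<Longrightarrow> z \<in> {a<..b} \<times> ball x0 \<rho>"
        using test unfolding test_fun_def by blast
      moreover have "g z \<noteq> 0" if "h n z \<noteq> 0" for z using that by (simp add: h_def)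
      ultimately show "\<exists>a b x0 \<rho>. 0 < a \<and> a \<le> b \<and> 0 \<le> \<rho> \<and> (\<forall>z. h n z \<noteq> 0 \<longrightarrow> z \<in> {a<..b} \<times> ball x0 \<rho>)"
        by blast
    qed
    have sum_D: "(\<Sum>n\<le>m. u n) = u k" if "z \<in> D k" "k \<le> m" "\<And>n. z \<notin> D n \<Longrightarrow> u n = 0" for z k and u :: "nat \<Rightarrow> complex"
    proof -
      have "(\<Sum>n\<le>m. u n) = (\<Sum>n\<in>{k}. u n)"
      proof (rule sum.mono_neutral_right)
        show "\<forall>n\<in>{..m} - {k}. u n = 0" using that(3) D_disj[OF that(1)] by blast
      qed (use that(2) in auto)
      then show ?thesis by simp
    qed
    \<comment> \<open>The support of \<open>g\<close> lies in \<open>exhaust m\<close> and so meets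
      only the pieces up to \<open>m\<close>; finite additivity of \<Phi> suffices.\<close>
    have g_eq: "g = (\<lambda>z. \<Sum>n\<le>m. h n z)"
    proof
      fix z
      show "g z = (\<Sum>n\<le>m. h n z)"
      proof (cases "g z = 0")
        case True
        then show ?thesis by (simp add: h_def)
      next
        case False
        then obtain k where "k \<le> m" "z \<in> D k" using box(2) m D_cover by blast
        then show ?thesis using sum_D[of z k "\<lambda>n. h n z"] h0 by (simp add: h_def)
      qed
    qed
    have hX: "h n \<in> X" for n by (rule test_fun_X[OF h_test])
    have \<kappa>h: "integrable lborel (\<lambda>z. \<kappa> n z * cnj (h n z))" for n
    proof (rule Bochner_Integration.integrable_bound)
      show "integrable lborel (\<lambda>z. c * cmod (\<kappa> n z))"
        by (intro Bochner_Integration.integrable_mult_right Bochner_Integration.integrable_norm \<kappa>i)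
      show "(\<lambda>z. \<kappa> n z * cnj (h n z)) \<in> borel_measurable lborel"
        using hm by measurable
      show "AE z in lborel. norm (\<kappa> n z * cnj (h n z)) \<le> norm (c * cmod (\<kappa> n z))"
      proof (rule AE_I2)
        fix z
        show "norm (\<kappa> n z * cnj (h n z)) \<le> norm (c * cmod (\<kappa> n z))"
          using mult_left_mono[OF hc[of n z], of "cmod (\<kappa> n z)"] c0 by (simp add: norm_mult mult.commute)
      qed
    qed
    have "\<Phi> (\<lambda>z. \<Sum>n\<le>m. h n z) = (\<Sum>n\<le>m. \<Phi> (h n))"
      using antidual_sum[OF \<Phi>, of "{..m}" h] hX by simp
    then have "\<Phi> g = (\<Sum>n\<le>m. \<Phi> (h n))"
      using g_eq by metis
    also have "\<dots> = (\<Sum>n\<le>m. \<integral>z. \<kappa> n z * cnj (h n z) \<partial>lborel)"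
      by (intro sum.cong refl \<kappa>[OF hm hc h0])
    also have "\<dots> = (\<integral>z. (\<Sum>n\<le>m. \<kappa> n z * cnj (h n z)) \<partial>lborel)"
      by (rule Bochner_Integration.integral_sum[symmetric]) (rule \<kappa>h)
    also have "(\<lambda>z. \<Sum>n\<le>m. \<kappa> n z * cnj (h n z)) = (\<lambda>z. indicator half_space z *\<^sub>R (f z * cnj (g z) / of_real (fst z)))"
    proof
      fix z
      show "(\<Sum>n\<le>m. \<kappa> n z * cnj (h n z)) = indicator half_space z *\<^sub>R (f z * cnj (g z) / of_real (fst z))"
      proof (cases "g z = 0")
        case True
        then show ?thesis by (simp add: h_def)
      next
        case False
        then obtain k where k: "k \<le> m" "z \<in> D k" using box(2) m D_cover by blast
        have s: "0 < fst z" using box(2)[OF False] box(1) by auto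
        have "(\<Sum>n\<le>m. \<kappa> n z * cnj (h n z)) = \<kappa> k z * cnj (h k z)"
          by (rule sum_D[OF k(2,1)]) (simp add: \<kappa>0)
        also have "\<dots> = indicator half_space z *\<^sub>R (f z * cnj (g z) / of_real (fst z))"
          using k s f_eq[OF k(2)] by (simp add: h_def)
        finally show ?thesis .
      qed
    qed
    finally show "\<Phi> g = pairing_int f g" unfolding pairing_int_def .
  qed
qed

section \<open>Linearity of the pairing in both arguments, and the dual norm\<close>

lemma pairing_nn_lincomb_finite:
  assumes [measurable]: "f \<in> borel_measurable borel" "h \<in> borel_measurable borel" "g \<in> borel_measurable borel"
    and fin: "pairing_nn f g < top" "pairing_nn h g < top"
  shows "pairing_nn (\<lambda>z. a * f z + b * h z) g < top"
proof -
  let ?i = "\<lambda>f z. ennreal (cmod (f z) * cmod (g z)) / ennreal (fst z) * indicator half_space z"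
  have "pairing_nn (\<lambda>z. a * f z + b * h z) g \<le>
    (\<integral>\<^sup>+z. ennreal (cmod a) * ?i f z + ennreal (cmod b) * ?i h z \<partial>lborel)"
    unfolding pairing_nn_def
  proof (intro nn_integral_mono)
    fix z
    have "cmod (a * f z + b * h z) * cmod (g z) \<le> (cmod (a * f z) + cmod (b * h z)) * cmod (g z)"
      by (intro mult_right_mono norm_triangle_ineq) auto
    also have "\<dots> = cmod a * (cmod (f z) * cmod (g z)) + cmod b * (cmod (h z) * cmod (g z))"
      by (simp add: norm_mult algebra_simps)
    finally have "ennreal (cmod (a * f z + b * h z) * cmod (g z)) \<le>
      ennreal (cmod a) * ennreal (cmod (f z) * cmod (g z)) + ennreal (cmod b) * ennreal (cmod (h z) * cmod (g z))"
      by (simp add: ennreal_leI flip: ennreal_mult ennreal_plus)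
    then have "ennreal (cmod (a * f z + b * h z) * cmod (g z)) / ennreal (fst z) \<le>
      (ennreal (cmod a) * ennreal (cmod (f z) * cmod (g z)) + ennreal (cmod b) * ennreal (cmod (h z) * cmod (g z))) / ennreal (fst z)"
      by (rule divide_right_mono_ennreal)
    then show "ennreal (cmod (a * f z + b * h z) * cmod (g z)) / ennreal (fst z) * indicator half_space z \<le>
      ennreal (cmod a) * ?i f z + ennreal (cmod b) * ?i h z"
      by (auto simp: indicator_def add_divide_distrib_ennreal simp flip: ennreal_times_divide)
  qed
  also have "\<dots> = ennreal (cmod a) * pairing_nn f g + ennreal (cmod b) * pairing_nn h g"
    unfolding pairing_nn_def by (simp add: nn_integral_add nn_integral_cmult)
  also have "\<dots> < top" using fin by (simp add: ennreal_mult_less_top)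
  finally show ?thesis .
qed

lemma pairing_int_lincomb:
  assumes m: "f \<in> borel_measurable borel" "h \<in> borel_measurable borel" "g \<in> borel_measurable borel"
    and fin: "pairing_nn f g < top" "pairing_nn h g < top"
  shows "pairing_int (\<lambda>z. a * f z + b * h z) g = a * pairing_int f g + b * pairing_int h g"
proof -
  note i = pairing_integrable[OF m(1,3) fin(1)] pairing_integrable[OF m(2,3) fin(2)]
  have "pairing_int (\<lambda>z. a * f z + b * h z) g =
    (\<integral>z. a * (indicator half_space z *\<^sub>R (f z * cnj (g z) / of_real (fst z)))
      + b * (indicator half_space z *\<^sub>R (h z * cnj (g z) / of_real (fst z))) \<partial>lborel)"
    unfolding pairing_int_def
    by (rule arg_cong[where f="integral\<^sup>L lborel"]) (auto simp: fun_eq_iff indicator_def add_divide_distrib algebra_simps)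
  also have "\<dots> = a * pairing_int f g + b * pairing_int h g"
    unfolding pairing_int_def
    by (subst Bochner_Integration.integral_add[OF Bochner_Integration.integrable_mult_right[OF i(1)]
          Bochner_Integration.integrable_mult_right[OF i(2)]])
       (simp only: integral_mult_right_zero)
  finally show ?thesis .
qed

lemma pairing_int_cnj: "pairing_int g f = cnj (pairing_int f g)"
  unfolding pairing_int_def by (subst Bochner_Integration.integral_cnj[symmetric])
    (simp add: mult.commute del: Bochner_Integration.integral_cnj)

lemma pairing_nn_commute: "pairing_nn g f = pairing_nn f g"
  by (simp add: pairing_nn_def mult.commute)

lemma pairing_int_lincomb_right:
  assumes "f \<in> borel_measurable borel" "h \<in> borel_measurable borel" "g \<in> borel_measurable borel"
    and "pairing_nn f g < top" "pairing_nn f h < top"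
  shows "pairing_int f (\<lambda>z. a * g z + b * h z) = cnj a * pairing_int f g + cnj b * pairing_int f h"
  using pairing_int_lincomb[of g h f a b] assms
  by (simp add: pairing_int_cnj[of f] pairing_nn_commute[of _ f])

text \<open>Normalising \<open>g\<close> by its quasi-norm reduces the claim to the supremum. A
  function of quasi-norm zero cannot be normalised, but a bounded functional vanishes on it.\<close>

lemma antidual_le_norm:
  assumes \<Phi>: "\<Phi> \<in> antidual X N" and g: "g \<in> X"
  shows "ennreal (cmod (\<Phi> g)) \<le> antidual_norm X N \<Phi> * N g"
proof -
  obtain C where C: "0 \<le> C" "\<And>g. g \<in> X \<Longrightarrow> ennreal (cmod (\<Phi> g)) \<le> ennreal C * N g"
    using antidual_bound[OF \<Phi>] by blast
  obtain n where n: "N g = ennreal n" "0 \<le> n" using N_finite[OF g] by (cases "N g") auto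
  show ?thesis
  proof (cases "n = 0")
    case True
    then show ?thesis using C(2)[OF g] n by simp
  next
    case False
    then have n0: "0 < n" using n by simp
    let ?h = "\<lambda>z. of_real (1/n) * g z"
    have "N ?h = 1"
      using N_cmult[OF X_measurable[OF g], of \<beta> "of_real (1/n)"] n n0 by (simp add: norm_divide flip: ennreal_mult)
    then have "ennreal (cmod (\<Phi> ?h)) \<le> antidual_norm X N \<Phi>"
      unfolding antidual_norm_def using X_cmult[OF g, of "of_real (1/n)"] by (intro SUP_upper) auto
    moreover have "\<Phi> g = of_real n * \<Phi> ?h"
      using antidual_cmult[OF \<Phi> g, of "of_real (1/n)"] n0 by simp
    ultimately show ?thesis
      using n n0 by (simp add: norm_mult ennreal_mult mult.commute mult_left_mono)
  qed
qed

end

section \<open>The identification\<close>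

theorem theorem3p26:
  fixes p q r \<beta> :: real
  assumes "0 < p" "p < 1" "0 < q" "1 \<le> r"
  shows "(\<exists>C::real. 0 < C \<and>
      (\<forall>f g :: real \<times> 'a::euclidean_space \<Rightarrow> complex. measurable_hs f \<longrightarrow> measurable_hs g \<longrightarrow>
        (\<integral>\<^sup>+s\<in>{0<..}. ((\<integral>\<^sup>+y. ennreal (cmod (f (s, y)) * cmod (g (s, y))) \<partial>lebesgue) / ennreal s) \<partial>lebesgue)
          \<le> ennreal C * Z_norm (conj_exponent r) (- \<beta> + real DIM('a) * (1 / p - 1)) f * T_norm p q r \<beta> g))
    \<and> identifies_antidual
        (T_space p q r \<beta> :: (real \<times> 'a \<Rightarrow> complex) set) (T_norm p q r \<beta>)
        (Z_space (conj_exponent r) (- \<beta> + real DIM('a) * (1 / p - 1)))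
        (Z_norm (conj_exponent r) (- \<beta> + real DIM('a) * (1 / p - 1)))"
proof -
  interpret tent_exponents p q r \<beta>
    by unfold_locales (use assms in auto)
  let ?X = "T_space p q r \<beta> :: (real \<times> 'a \<Rightarrow> complex) set"
  let ?N = "T_norm p q r \<beta> :: (real \<times> 'a \<Rightarrow> complex) \<Rightarrow> ennreal"
  let ?M = "Z_norm (conj_exponent r) (- \<beta> + real DIM('a) * (1 / p - 1)) :: (real \<times> 'a \<Rightarrow> complex) \<Rightarrow> ennreal"
  let ?Y = "Z_space (conj_exponent r) (- \<beta> + real DIM('a) * (1 / p - 1)) :: (real \<times> 'a \<Rightarrow> complex) set"
  let ?P = "pairing_functional ?X"
  obtain C1 where C1: "0 < C1" and bnd0: "\<forall>f g. f \<in> borel_measurable borel \<longrightarrow> g \<in> borel_measurable borel \<longrightarrow>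
      pairing_nn f g \<le> ennreal C1 * ?M f * ?N g"
    unfolding pairing_nn_def
  proof (rule pairing_bound_borel[OF assms, where 'a='a and \<beta>=\<beta>], goal_cases)
    case (1 C)
    show ?case by (rule 1(1)[OF 1(2)]) (use 1(3) in blast)
  qed
  note bnd = bnd0[rule_format]
  obtain C2 where C2: "0 < C2" and conv0: "\<forall>f M. f \<in> borel_measurable borel \<longrightarrow> pairing_bounded p q r \<beta> M f \<longrightarrow> 0 \<le> M \<longrightarrow>
      ?M f \<le> ennreal (C2 * M)"
  proof (rule Z_norm_le_of_pairing_bounded[OF assms, where 'a='a and \<beta>=\<beta>], goal_cases)
    case (1 C)
    show ?case by (rule 1(1)[OF 1(2)]) (use 1(3) in blast)
  qed
  note conv = conv0[rule_format]
  have M_cong: "?M f = ?M f'" if "hs_eq f f'" "measurable_hs f" "f' \<in> borel_measurable borel" for f f'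
    by (rule Z_norm_cong[OF that(1,2) borel_measurable_hs[OF that(3)]])
  have N_cong: "?N g = ?N g'" if "hs_eq g g'" "measurable_hs g" "g' \<in> borel_measurable borel" for g g'
    by (rule T_norm_cong[OF that(1,2) borel_measurable_hs[OF that(3)]])
  have ineq: "(\<integral>\<^sup>+s\<in>{0<..}. ((\<integral>\<^sup>+y. ennreal (cmod (f (s, y)) * cmod (g (s, y))) \<partial>lebesgue) / ennreal s) \<partial>lebesgue)
          \<le> ennreal C1 * ?M f * ?N g" if f: "measurable_hs f" and g: "measurable_hs g" for f g :: "real \<times> 'a \<Rightarrow> complex"
  proof -
    obtain f' where f': "f' \<in> borel_measurable borel" "hs_eq f f'" using measurable_hs_borel_rep[OF f] .
    obtain g' where g': "g' \<in> borel_measurable borel" "hs_eq g g'" using measurable_hs_borel_rep[OF g] .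
    show ?thesis
      unfolding pairing_lhs_eq[OF f' g'] M_cong[OF f'(2) f f'(1)] N_cong[OF g'(2) g g'(1)]
      by (rule bnd[OF f'(1) g'(1)])
  qed
  \<comment> \<open>Finiteness is what identifies the iterated integral \<open>L2_pairing\<close>
    with \<open>pairing_int\<close> on representatives, where linearity and estimates are
    available.\<close>
  have fin: "pairing_nn f' g' < top"
    if "f \<in> ?Y" "g \<in> ?X" "f' \<in> borel_measurable borel" "hs_eq f f'" "g' \<in> borel_measurable borel" "hs_eq g g'" for f g f' g'
  proof -
    have "?M f' < top" "?N g' < top"
      using that M_cong[of f f'] N_cong[of g g'] by (auto simp: Z_space_def T_space_def)
    then have "ennreal C1 * ?M f' * ?N g' < top" by (simp add: ennreal_mult_less_top)
    then show ?thesis using bnd[of f' g'] that by (meson order.strict_trans1)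
  qed
  have P_eq: "?P f g = pairing_int f' g'"
    if "f \<in> ?Y" "g \<in> ?X" "f' \<in> borel_measurable borel" "hs_eq f f'" "g' \<in> borel_measurable borel" "hs_eq g g'" for f g f' g'
    using that L2_pairing_eq[OF that(3-6) fin[OF that]] by (simp add: pairing_functional_def)
  have P_le: "ennreal (cmod (?P f g)) \<le> ennreal C1 * ?M f * ?N g" if f: "f \<in> ?Y" and g: "g \<in> ?X" for f g
  proof -
    have fm: "measurable_hs f" and gm: "measurable_hs g" using f g by (auto simp: Z_space_def T_space_def)
    obtain f' where f': "f' \<in> borel_measurable borel" "hs_eq f f'" using measurable_hs_borel_rep[OF fm] .
    obtain g' where g': "g' \<in> borel_measurable borel" "hs_eq g g'" using measurable_hs_borel_rep[OF gm] .
    have "ennreal (cmod (?P f g)) \<le> pairing_nn f' g'"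
      unfolding P_eq[OF f g f' g'] by (rule norm_pairing_int_le[OF f'(1) g'(1)])
    also have "\<dots> \<le> ennreal C1 * ?M f * ?N g"
      unfolding M_cong[OF f'(2) fm f'(1)] N_cong[OF g'(2) gm g'(1)] by (rule bnd[OF f'(1) g'(1)])
    finally show ?thesis .
  qed
  have P_antidual: "?P f \<in> antidual ?X ?N" if f: "f \<in> ?Y" for f
    unfolding antidual_def
  proof (intro CollectI conjI ballI allI)
    have fm: "measurable_hs f" using f by (auto simp: Z_space_def)
    obtain f' where f': "f' \<in> borel_measurable borel" "hs_eq f f'" using measurable_hs_borel_rep[OF fm] .
    show "?P f \<in> extensional ?X" by (simp add: pairing_functional_def)
    show "?P f (\<lambda>z. g z + h z) = ?P f g + ?P f h" if g: "g \<in> ?X" and h: "h \<in> ?X" for g h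
    proof -
      obtain g' where g': "g' \<in> borel_measurable borel" "hs_eq g g'" using measurable_hs_borel_rep[OF X_measurable[OF g]] .
      obtain h' where h': "h' \<in> borel_measurable borel" "hs_eq h h'" using measurable_hs_borel_rep[OF X_measurable[OF h]] .
      have "?P f (\<lambda>z. g z + h z) = pairing_int f' (\<lambda>z. g' z + h' z)"
        using g' h' by (intro P_eq f f' X_add g h hs_eq_add) auto
      also have "\<dots> = pairing_int f' g' + pairing_int f' h'"
        using pairing_int_lincomb_right[OF f'(1) h'(1) g'(1) fin[OF f g f' g'] fin[OF f h f' h'], of 1 1] by simp
      finally show ?thesis by (simp add: P_eq[OF f g f' g'] P_eq[OF f h f' h'])
    qed
    show "?P f (\<lambda>z. c * g z) = cnj c * ?P f g" if g: "g \<in> ?X" for c g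
    proof -
      obtain g' where g': "g' \<in> borel_measurable borel" "hs_eq g g'" using measurable_hs_borel_rep[OF X_measurable[OF g]] .
      have "?P f (\<lambda>z. c * g z) = pairing_int f' (\<lambda>z. c * g' z)"
        using g' by (intro P_eq f f' X_cmult g hs_eq_cmult) auto
      also have "\<dots> = cnj c * pairing_int f' g'"
        using pairing_int_lincomb_right[OF f'(1) g'(1) g'(1) fin[OF f g f' g'] fin[OF f g f' g'], of c 0] by simp
      finally show ?thesis by (simp add: P_eq[OF f g f' g'])
    qed
    show "\<exists>C::real. \<forall>g\<in>?X. ennreal (cmod (?P f g)) \<le> ennreal C * ?N g"
    proof -
      obtain m where m: "?M f = ennreal m" "0 \<le> m" using f by (cases "?M f") (auto simp: Z_space_def)
      then have "ennreal C1 * ?M f = ennreal (C1 * m)" using C1 by (simp add: ennreal_mult)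
      then show ?thesis using P_le[OF f] by (intro exI[of _ "C1 * m"]) simp
    qed
  qed
  have P_bounded: "pairing_bounded p q r \<beta> m f'"
    if f: "f \<in> ?Y" and f': "f' \<in> borel_measurable borel" "hs_eq f f'"
      and m: "\<And>g. g \<in> ?X \<Longrightarrow> ennreal (cmod (?P f g)) \<le> ennreal m * ?N g" for f f' m
    unfolding pairing_bounded_def
  proof (intro allI impI)
    fix g :: "real \<times> 'a \<Rightarrow> complex" assume g: "test_fun g"
    have gX: "g \<in> ?X" by (rule test_fun_X[OF g])
    have gm: "g \<in> borel_measurable borel" using g by (simp add: test_fun_def)
    show "ennreal (cmod (pairing_int f' g)) \<le> ennreal m * ?N g"
      using m[OF gX] P_eq[OF f gX f' gm] by simp
  qed
  have upper: "antidual_norm ?X ?N (?P f) \<le> ennreal C1 * ?M f" if f: "f \<in> ?Y" for f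
    unfolding antidual_norm_def
  proof (intro SUP_least)
    fix g assume g: "g \<in> {g \<in> ?X. ?N g \<le> 1}"
    then have "ennreal (cmod (?P f g)) \<le> ennreal C1 * ?M f * ?N g" by (intro P_le f) auto
    also have "\<dots> \<le> ennreal C1 * ?M f * 1" using g by (intro mult_left_mono) auto
    finally show "ennreal (cmod (?P f g)) \<le> ennreal C1 * ?M f" by simp
  qed
  \<comment> \<open>The dual norm of \<open>?P f\<close>, finite by \<open>upper\<close>, is itself
    an admissible constant in \<open>pairing_bounded\<close>, so the converse estimate bounds
    \<open>?M f\<close> by a multiple of it.\<close>
  have lower: "ennreal (1 / C2) * ?M f \<le> antidual_norm ?X ?N (?P f)" if f: "f \<in> ?Y" for f
  proof -
    have fm: "measurable_hs f" and Mf: "?M f < top" using f by (auto simp: Z_space_def)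
    obtain f' where f': "f' \<in> borel_measurable borel" "hs_eq f f'" using measurable_hs_borel_rep[OF fm] .
    have "antidual_norm ?X ?N (?P f) < top"
      by (rule order.strict_trans1[OF upper[OF f]]) (use Mf in \<open>simp add: ennreal_mult_less_top\<close>)
    then obtain m where m: "antidual_norm ?X ?N (?P f) = ennreal m" "0 \<le> m"
      by (cases "antidual_norm ?X ?N (?P f)") auto
    have "pairing_bounded p q r \<beta> m f'"
      by (rule P_bounded[OF f f']) (use antidual_le_norm[OF P_antidual[OF f]] m in simp)
    then have "?M f' \<le> ennreal (C2 * m)" using f' m by (intro conv) auto
    then have "ennreal (1 / C2) * ?M f' \<le> ennreal (1 / C2) * ennreal (C2 * m)" by (intro mult_left_mono) auto
    also have "\<dots> = ennreal m" using C2 m by (simp flip: ennreal_mult)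
    finally show ?thesis using m M_cong[OF f'(2) fm f'(1)] by simp
  qed
  \<comment> \<open>Closure under linear combinations comes from the converse Hoelder inequality, not from a triangle
    inequality for \<open>Z_norm\<close>.\<close>
  have lincomb: "(\<lambda>z. a * f1 z + b * f2 z) \<in> ?Y \<and>
      (\<forall>g\<in>?X. ?P (\<lambda>z. a * f1 z + b * f2 z) g = a * ?P f1 g + b * ?P f2 g)"
    if f1: "f1 \<in> ?Y" and f2: "f2 \<in> ?Y" for f1 f2 a b
  proof -
    have f1m: "measurable_hs f1" and f2m: "measurable_hs f2" using f1 f2 by (auto simp: Z_space_def)
    obtain f1' where f1': "f1' \<in> borel_measurable borel" "hs_eq f1 f1'" using measurable_hs_borel_rep[OF f1m] .
    obtain f2' where f2': "f2' \<in> borel_measurable borel" "hs_eq f2 f2'" using measurable_hs_borel_rep[OF f2m] .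
    let ?f = "\<lambda>z. a * f1 z + b * f2 z" and ?f' = "\<lambda>z. a * f1' z + b * f2' z"
    have f'm: "?f' \<in> borel_measurable borel" using f1'(1) f2'(1) by simp
    have fm: "measurable_hs ?f" by (intro measurable_hs_add measurable_hs_cmult f1m f2m)
    have ff': "hs_eq ?f ?f'" by (intro hs_eq_add hs_eq_cmult f1' f2')
    obtain m1 where m1: "?M f1 = ennreal m1" "0 \<le> m1" using f1 by (cases "?M f1") (auto simp: Z_space_def)
    obtain m2 where m2: "?M f2 = ennreal m2" "0 \<le> m2" using f2 by (cases "?M f2") (auto simp: Z_space_def)
    define m where "m = cmod a * (C1 * m1) + cmod b * (C1 * m2)"
    have m: "0 \<le> m" using C1 m1 m2 by (simp add: m_def)
    have int: "pairing_int ?f' g' = a * ?P f1 g + b * ?P f2 g" and nn: "pairing_nn ?f' g' < top"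
      if g: "g \<in> ?X" and g': "g' \<in> borel_measurable borel" "hs_eq g g'" for g g'
      using pairing_int_lincomb[OF f1'(1) f2'(1) g'(1) fin[OF f1 g f1' g'] fin[OF f2 g f2' g']]
        pairing_nn_lincomb_finite[OF f1'(1) f2'(1) g'(1) fin[OF f1 g f1' g'] fin[OF f2 g f2' g']]
      by (simp_all add: P_eq[OF f1 g f1' g'] P_eq[OF f2 g f2' g'])
    have "pairing_bounded p q r \<beta> m ?f'"
      unfolding pairing_bounded_def
    proof (intro allI impI)
      fix g :: "real \<times> 'a \<Rightarrow> complex" assume g: "test_fun g"
      have gX: "g \<in> ?X" by (rule test_fun_X[OF g])
      have gm: "g \<in> borel_measurable borel" using g by (simp add: test_fun_def)
      obtain n where n: "?N g = ennreal n" "0 \<le> n" using N_finite[OF gX] by (cases "?N g") auto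
      have b1: "cmod (?P f1 g) \<le> C1 * m1 * n"
      proof -
        have "ennreal (cmod (?P f1 g)) \<le> ennreal (C1 * m1 * n)"
          using P_le[OF f1 gX] C1 m1 n by (simp add: ennreal_mult)
        then show ?thesis using C1 m1 n by (subst (asm) ennreal_le_iff) auto
      qed
      have b2: "cmod (?P f2 g) \<le> C1 * m2 * n"
      proof -
        have "ennreal (cmod (?P f2 g)) \<le> ennreal (C1 * m2 * n)"
          using P_le[OF f2 gX] C1 m2 n by (simp add: ennreal_mult)
        then show ?thesis using C1 m2 n by (subst (asm) ennreal_le_iff) auto
      qed
      have "cmod (pairing_int ?f' g) \<le> cmod a * cmod (?P f1 g) + cmod b * cmod (?P f2 g)"
        unfolding int[OF gX gm hs_eq_refl] using norm_triangle_ineq[of "a * ?P f1 g" "b * ?P f2 g"]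
        by (simp add: norm_mult)
      also have "\<dots> \<le> cmod a * (C1 * m1 * n) + cmod b * (C1 * m2 * n)"
        by (intro add_mono mult_left_mono b1 b2) auto
      also have "\<dots> = m * n" by (simp add: m_def algebra_simps)
      finally have "ennreal (cmod (pairing_int ?f' g)) \<le> ennreal (m * n)" by (rule ennreal_leI)
      then show "ennreal (cmod (pairing_int ?f' g)) \<le> ennreal m * ?N g"
        using m n by (simp add: ennreal_mult)
    qed
    then have "?M ?f' \<le> ennreal (C2 * m)" using f'm m by (intro conv)
    then have "?M ?f < top"
      unfolding M_cong[OF ff' fm f'm] by (rule order.strict_trans1) simp
    then have fY: "?f \<in> ?Y" using fm by (simp add: Z_space_def)
    have "?P ?f g = a * ?P f1 g + b * ?P f2 g" if g: "g \<in> ?X" for g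
    proof -
      obtain g' where g': "g' \<in> borel_measurable borel" "hs_eq g g'" using measurable_hs_borel_rep[OF X_measurable[OF g]] .
      show ?thesis using P_eq[OF fY g f'm ff' g'] int[OF g g'] by simp
    qed
    then show ?thesis using fY by blast
  qed
  have M_zero: "hs_eq f (\<lambda>z. 0)" if f: "f \<in> ?Y" and 0: "?M f = 0" for f
  proof -
    have fm: "measurable_hs f" using f by (auto simp: Z_space_def)
    obtain f' where f': "f' \<in> borel_measurable borel" "hs_eq f f'" using measurable_hs_borel_rep[OF fm] .
    note [measurable] = f'(1)
    \<comment> \<open>The constant function 1 may have infinite quasi-norm: the inequality holds for
      all Borel functions, and zero times infinity is zero in \<open>ennreal\<close>.\<close>
    have "pairing_nn f' (\<lambda>z. 1) \<le> ennreal C1 * ?M f' * ?N (\<lambda>z. 1)"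
      using f'(1) by (intro bnd) auto
    also have "\<dots> = 0" using 0 M_cong[OF f'(2) fm f'(1)] by simp
    finally have "pairing_nn f' (\<lambda>z. 1) = 0" by simp
    then have "AE z in lborel. ennreal (cmod (f' z) * cmod 1) / ennreal (fst z) * indicator half_space z = 0"
      unfolding pairing_nn_def by (subst (asm) nn_integral_0_iff_AE) auto
    then have "hs_eq f' (\<lambda>z. 0)"
      unfolding hs_eq_def by (rule eventually_mono) (auto simp: ennreal_divide_eq split: if_splits)
    with f'(2) show ?thesis by (rule hs_eq_trans)
  qed
  \<comment> \<open>The density starts out as a mere Borel function. The bound of \<Phi> on test
    functions puts it into \<open>?Y\<close>; only then is \<open>?P f\<close> known to be a bounded
    functional, and agreement on test functions suffices.\<close>
  have surj: "\<exists>f\<in>?Y. \<Phi> = ?P f" if \<Phi>: "\<Phi> \<in> antidual ?X ?N" for \<Phi>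
  proof -
    obtain f where f: "f \<in> borel_measurable borel" and rep: "\<And>g. test_fun g \<Longrightarrow> \<Phi> g = pairing_int f g"
      using antidual_density[OF \<Phi>] by blast
    obtain C where C: "0 \<le> C" "\<And>g. g \<in> ?X \<Longrightarrow> ennreal (cmod (\<Phi> g)) \<le> ennreal C * ?N g"
      using antidual_bound[OF \<Phi>] by blast
    have "pairing_bounded p q r \<beta> C f"
      unfolding pairing_bounded_def
    proof (intro allI impI)
      fix g :: "real \<times> 'a \<Rightarrow> complex" assume g: "test_fun g"
      show "ennreal (cmod (pairing_int f g)) \<le> ennreal C * ?N g"
        using C(2)[OF test_fun_X[OF g]] rep[OF g] by simp
    qed
    then have "?M f \<le> ennreal (C2 * C)" using f C(1) by (intro conv)
    then have "?M f < top" by (rule order.strict_trans1) simp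
    then have fY: "f \<in> ?Y" using borel_measurable_hs[OF f] by (simp add: Z_space_def)
    have "\<Phi> = ?P f"
    proof (rule antidual_eqI[OF \<Phi> P_antidual[OF fY]])
      fix g :: "real \<times> 'a \<Rightarrow> complex" assume g: "test_fun g"
      have gm: "g \<in> borel_measurable borel" using g by (simp add: test_fun_def)
      show "\<Phi> g = ?P f g"
        using rep[OF g] P_eq[OF fY test_fun_X[OF g] f hs_eq_refl gm hs_eq_refl] by simp
    qed
    then show ?thesis using fY by blast
  qed
  \<comment> \<open>Equal functionals give a difference of dual norm zero; the lower estimate makes
    its \<open>Z_norm\<close> vanish, and \<open>M_zero\<close> turns this into equality almost
    everywhere.\<close>
  have inj: "?P f1 = ?P f2 \<longleftrightarrow> (AE z in lebesgue_on half_space. f1 z = f2 z)"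
    if f1: "f1 \<in> ?Y" and f2: "f2 \<in> ?Y" for f1 f2
    unfolding AE_lebesgue_on_half_space_iff hs_eq_def[symmetric]
  proof
    assume eq: "?P f1 = ?P f2"
    let ?f = "\<lambda>z. 1 * f1 z + (-1) * f2 z"
    have fY: "?f \<in> ?Y" and P0: "\<And>g. g \<in> ?X \<Longrightarrow> ?P ?f g = 0"
      using lincomb[OF f1 f2, of 1 "-1"] eq by auto
    have "antidual_norm ?X ?N (?P ?f) \<le> 0"
      unfolding antidual_norm_def by (intro SUP_least) (use P0 in auto)
    then have "ennreal (1 / C2) * ?M ?f \<le> 0" using lower[OF fY] by (rule order.trans[rotated])
    then have "?M ?f = 0" using C2 by simp
    then have "hs_eq ?f (\<lambda>z. 0)" by (rule M_zero[OF fY])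
    then show "hs_eq f1 f2"
      unfolding hs_eq_def by (rule eventually_mono) simp
  next
    assume eq: "hs_eq f1 f2"
    have f2m: "measurable_hs f2" using f2 by (auto simp: Z_space_def)
    obtain f' where f': "f' \<in> borel_measurable borel" "hs_eq f2 f'" using measurable_hs_borel_rep[OF f2m] .
    have f1': "hs_eq f1 f'" using eq f'(2) by (rule hs_eq_trans)
    show "?P f1 = ?P f2"
    proof
      fix g
      show "?P f1 g = ?P f2 g"
      proof (cases "g \<in> ?X")
        case True
        obtain g' where g': "g' \<in> borel_measurable borel" "hs_eq g g'" using measurable_hs_borel_rep[OF X_measurable[OF True]] .
        show ?thesis using P_eq[OF f1 True f'(1) f1' g'] P_eq[OF f2 True f' g'] by simp
      next
        case False
        then show ?thesis by (simp add: pairing_functional_def)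
      qed
    qed
  qed
  have "identifies_antidual ?X ?N ?Y ?M"
    unfolding identifies_antidual_def
  proof (intro conjI)
    show "?P ` ?Y = antidual ?X ?N"
      using P_antidual surj by blast
    show "\<forall>f1\<in>?Y. \<forall>f2\<in>?Y. (?P f1 = ?P f2) = (AE z in lebesgue_on half_space. f1 z = f2 z)"
      using inj by blast
    show "\<forall>f1\<in>?Y. \<forall>f2\<in>?Y. \<forall>a b. (\<lambda>z. a * f1 z + b * f2 z) \<in> ?Y \<and>
       (\<forall>g\<in>?X. ?P (\<lambda>z. a * f1 z + b * f2 z) g = a * ?P f1 g + b * ?P f2 g)"
      using lincomb by blast
    show "\<exists>c C::real. 0 < c \<and> 0 < C \<and> (\<forall>f\<in>?Y.
       ennreal c * ?M f \<le> antidual_norm ?X ?N (?P f) \<and> antidual_norm ?X ?N (?P f) \<le> ennreal C * ?M f)"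
      using lower upper C1 C2 by (intro exI[of _ "1 / C2"] exI[of _ C1]) auto
  qed
  then show ?thesis using ineq C1 by blast
qed

end
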